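(* Let $G,H$ be finite groups with $|G|=M+1$, $|H|=N+1$, $2\le|G|<|H|$, let $\mathcal B=G*H$, let $\omega_1,\omega_2>0$, and put $\kappa:=M\omega_1+N\omega_2$. Let $\mathcal L_{\mathcal Y}$ be the operator on $\ell^2(\mathcal B)$ $$(\mathcal L_{\mathcal Y}f)(x)=f(x)-\frac1\kappa\Big(\sum_{a\in G\setminus\{e\}}\omega_1f(xa)+\sum_{b\in H\setminus\{e\}}\omega_2f(xb)\Big),\quad x\in\mathcal B.$$ The spectrum of $\mathcal L_{\mathcal Y}$ on $\ell^2(\mathcal B)$ is the following closed subset of $\mathbb R$: $$\Big[c-\frac{R_0}{2\kappa},\,c-\frac{R_\pi}{2\kappa}\Big]\sqcup\{\lambda_1\}\sqcup\Big[c+\frac{R_\pi}{2\kappa},\,c+\frac{R_0}{2\kappa}\Big]\sqcup\{\lambda_2\}$$ (a disjoint union), where $$c=\frac{(M+1)\omega_1+(N+1)\omega_2}{2\kappa},$$ $$R_x=\sqrt{\big((M+1)\omega_1-(N+1)\omega_2\big)^2+4(M+N)\omega_1\omega_2+8\sqrt{MN}\,\omega_1\omega_2\cos x},$$ and $$\lambda_1=\frac{(N+1)\omega_2}{\kappa},\qquad\lambda_2=1+\frac{\omega_1+\omega_2}{\kappa}.$$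
   Context: $\mathcal L_{\mathcal Y}$ is the normalized Laplacian of the Cayley graph $\mathcal Y$ of the free product $\mathcal B=G*H$ with generating set $(G\setminus\{e\})\sqcup(H\setminus\{e\})$, where edges corresponding to $G$ have weight $\omega_1$ and edges corresponding to $H$ have weight $\omega_2$. *)

theory Defs
  imports "HOL-Analysis.Infinite_Sum" "HOL-Algebra.Coset"
begin

section \<open>The free product of two groups\<close>

text \<open>
  Elements are reduced words: lists of non-identity syllables, alternately from the two groups.
\<close>

definition fp_word :: "('a, 'c) monoid_scheme \<Rightarrow> ('b, 'd) monoid_scheme \<Rightarrow> ('a + 'b) list \<Rightarrow> bool" where
  "fp_word G H w \<longleftrightarrow>
     set w \<subseteq> (carrier G - {\<one>\<^bsub>G\<^esub>}) <+> (carrier H - {\<one>\<^bsub>H\<^esub>}) \<and>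
     successively (\<lambda>s t. isl s \<noteq> isl t) w"

definition fp_inl :: "('a, 'c) monoid_scheme \<Rightarrow> 'a \<Rightarrow> ('a + 'b) list" where
  "fp_inl G a = (if a = \<one>\<^bsub>G\<^esub> then [] else [Inl a])"

definition fp_inr :: "('b, 'd) monoid_scheme \<Rightarrow> 'b \<Rightarrow> ('a + 'b) list" where
  "fp_inr H b = (if b = \<one>\<^bsub>H\<^esub> then [] else [Inr b])"

text \<open>Left multiplication of a reduced word by one element of \<open>G\<close> or \<open>H\<close>.\<close>

fun fp_cons :: "('a, 'c) monoid_scheme \<Rightarrow> ('b, 'd) monoid_scheme \<Rightarrow> 'a + 'b \<Rightarrow> ('a + 'b) list \<Rightarrow> ('a + 'b) list"
where
  "fp_cons G H (Inl a) (Inl a' # w) = fp_inl G (a \<otimes>\<^bsub>G\<^esub> a') @ w"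
| "fp_cons G H (Inr b) (Inr b' # w) = fp_inr H (b \<otimes>\<^bsub>H\<^esub> b') @ w"
| "fp_cons G H (Inl a) w = fp_inl G a @ w"
| "fp_cons G H (Inr b) w = fp_inr H b @ w"

definition free_product ::
  "('a, 'c) monoid_scheme \<Rightarrow> ('b, 'd) monoid_scheme \<Rightarrow> ('a + 'b) list monoid" where
  "free_product G H =
     \<lparr>carrier = {w. fp_word G H w}, monoid.mult = \<lambda>v w. foldr (fp_cons G H) v w, one = []\<rparr>"

lemma fp_word_Nil [simp]: "fp_word G H []"
  by (simp add: fp_word_def)

lemma fp_word_Inl_Cons:
  "fp_word G H (Inl a # w) \<longleftrightarrow>
     a \<in> carrier G \<and> a \<noteq> \<one>\<^bsub>G\<^esub> \<and> fp_word G H w \<and> (\<forall>a' w'. w \<noteq> Inl a' # w')"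
  by (cases w) (auto simp: fp_word_def isl_def)

lemma fp_word_Inr_Cons:
  "fp_word G H (Inr b # w) \<longleftrightarrow>
     b \<in> carrier H \<and> b \<noteq> \<one>\<^bsub>H\<^esub> \<and> fp_word G H w \<and> (\<forall>b' w'. w \<noteq> Inr b' # w')"
  by (cases w) (auto simp: fp_word_def isl_def)

lemmas fp_word_Cons = fp_word_Inl_Cons fp_word_Inr_Cons

lemma fp_cons_Inl: "\<forall>a' w'. w \<noteq> Inl a' # w' \<Longrightarrow> fp_cons G H (Inl a) w = fp_inl G a @ w"
  by (cases w rule: list.exhaust; cases "hd w") auto

lemma fp_cons_Inr: "\<forall>b' w'. w \<noteq> Inr b' # w' \<Longrightarrow> fp_cons G H (Inr b) w = fp_inr H b @ w"
  by (cases w rule: list.exhaust; cases "hd w") auto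

lemma fp_word_Cons_cases:
  assumes "fp_word G H (s # w)"
  obtains a where "s = Inl a" "a \<in> carrier G" "a \<noteq> \<one>\<^bsub>G\<^esub>" "fp_word G H w" "\<forall>a' w'. w \<noteq> Inl a' # w'"
    | b where "s = Inr b" "b \<in> carrier H" "b \<noteq> \<one>\<^bsub>H\<^esub>" "fp_word G H w" "\<forall>b' w'. w \<noteq> Inr b' # w'"
  using assms by (cases s) (auto simp: fp_word_Cons)

context
  fixes G :: "('a, 'c) monoid_scheme" and H :: "('b, 'd) monoid_scheme"
  assumes G: "group G" and H: "group H"
begin

interpretation G: group G by (rule G)
interpretation H: group H by (rule H)

lemma fp_cons_word:
  assumes "s \<in> carrier G <+> carrier H" "fp_word G H w"
  shows "fp_word G H (fp_cons G H s w)"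
  using assms
  by (cases "(G, H, s, w)" rule: fp_cons.cases) (auto simp: fp_word_Cons fp_inl_def fp_inr_def)

lemma fp_cons_one:
  assumes "fp_word G H w"
  shows "fp_cons G H (Inl \<one>\<^bsub>G\<^esub>) w = w" "fp_cons G H (Inr \<one>\<^bsub>H\<^esub>) w = w"
  using assms
  by (cases "(G, H, Inl \<one>\<^bsub>G\<^esub> :: 'a + 'b, w)" rule: fp_cons.cases;
      auto simp: fp_word_Cons fp_inl_def fp_inr_def)
    (use assms in \<open>cases "(G, H, Inr \<one>\<^bsub>H\<^esub> :: 'a + 'b, w)" rule: fp_cons.cases;
      auto simp: fp_word_Cons fp_inl_def fp_inr_def\<close>)

lemma fp_cons_mult_Inl:
  assumes "a \<in> carrier G" "a' \<in> carrier G" "fp_word G H w"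
  shows "fp_cons G H (Inl a) (fp_cons G H (Inl a') w) = fp_cons G H (Inl (a \<otimes>\<^bsub>G\<^esub> a')) w"
proof (cases "\<exists>a'' w'. w = Inl a'' # w'")
  case True
  then obtain a'' w' where w: "w = Inl a'' # w'" by blast
  have "a \<otimes>\<^bsub>G\<^esub> (a' \<otimes>\<^bsub>G\<^esub> a'') = a \<otimes>\<^bsub>G\<^esub> a' \<otimes>\<^bsub>G\<^esub> a''"
    using assms w by (simp add: fp_word_Cons G.m_assoc)
  moreover have "a = a \<otimes>\<^bsub>G\<^esub> a' \<otimes>\<^bsub>G\<^esub> a''" if "a' \<otimes>\<^bsub>G\<^esub> a'' = \<one>\<^bsub>G\<^esub>"
    using assms w that by (simp add: fp_word_Cons G.m_assoc)
  ultimately show ?thesis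
    using assms by (auto simp: w fp_word_Cons fp_inl_def fp_cons_Inl)
next
  case False
  then show ?thesis
    using assms by (auto simp: fp_cons_Inl fp_inl_def)
qed

lemma fp_cons_mult_Inr:
  assumes "b \<in> carrier H" "b' \<in> carrier H" "fp_word G H w"
  shows "fp_cons G H (Inr b) (fp_cons G H (Inr b') w) = fp_cons G H (Inr (b \<otimes>\<^bsub>H\<^esub> b')) w"
proof (cases "\<exists>b'' w'. w = Inr b'' # w'")
  case True
  then obtain b'' w' where w: "w = Inr b'' # w'" by blast
  have "b \<otimes>\<^bsub>H\<^esub> (b' \<otimes>\<^bsub>H\<^esub> b'') = b \<otimes>\<^bsub>H\<^esub> b' \<otimes>\<^bsub>H\<^esub> b''"
    using assms w by (simp add: fp_word_Cons H.m_assoc)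
  moreover have "b = b \<otimes>\<^bsub>H\<^esub> b' \<otimes>\<^bsub>H\<^esub> b''" if "b' \<otimes>\<^bsub>H\<^esub> b'' = \<one>\<^bsub>H\<^esub>"
    using assms w that by (simp add: fp_word_Cons H.m_assoc)
  ultimately show ?thesis
    using assms by (auto simp: w fp_word_Cons fp_inr_def fp_cons_Inr)
next
  case False
  then show ?thesis
    using assms by (auto simp: fp_cons_Inr fp_inr_def)
qed

lemma fp_foldr_word:
  "set v \<subseteq> carrier G <+> carrier H \<Longrightarrow> fp_word G H w \<Longrightarrow> fp_word G H (foldr (fp_cons G H) v w)"
  by (induction v) (auto intro!: fp_cons_word)

lemma fp_word_set: "fp_word G H w \<Longrightarrow> set w \<subseteq> carrier G <+> carrier H"
  by (auto simp: fp_word_def)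

lemma fp_foldr_cons:
  assumes s: "s \<in> carrier G <+> carrier H" and v: "fp_word G H v" and w: "fp_word G H w"
  shows "foldr (fp_cons G H) (fp_cons G H s v) w = fp_cons G H s (foldr (fp_cons G H) v w)"
proof -
  have word: "fp_word G H (foldr (fp_cons G H) u w)" if "fp_word G H u" for u
    using that w by (simp add: fp_foldr_word fp_word_set)
  show ?thesis
  proof (cases v)
    case Nil
    with s w show ?thesis
      by (auto simp: fp_cons_Inl fp_cons_Inr fp_inl_def fp_inr_def fp_cons_one)
  next
    case (Cons t u)
    from v Cons have u: "fp_word G H u"
      by (cases t) (auto simp: fp_word_Cons)
    show ?thesis
      using s v word[OF u] word[OF v] Cons
      by (cases s; cases t)
        (auto simp: fp_word_Cons fp_inl_def fp_inr_def fp_cons_one fp_cons_mult_Inl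
          fp_cons_mult_Inr)
  qed
qed

lemma fp_foldr_assoc:
  assumes "set u \<subseteq> carrier G <+> carrier H" "fp_word G H v" "fp_word G H w"
  shows "foldr (fp_cons G H) (foldr (fp_cons G H) u v) w =
         foldr (fp_cons G H) u (foldr (fp_cons G H) v w)"
  using assms by (induction u) (auto simp: fp_foldr_cons fp_foldr_word)

lemma fp_foldr_Nil: "fp_word G H w \<Longrightarrow> foldr (fp_cons G H) w [] = w"
proof (induction w)
  case (Cons s w)
  from Cons.prems show ?case
    by (cases rule: fp_word_Cons_cases)
      (use Cons.IH in \<open>auto simp: fp_cons_Inl fp_cons_Inr fp_inl_def fp_inr_def\<close>)
qed simp

lemma fp_left_inverse:
  "fp_word G H w \<Longrightarrow> \<exists>v. fp_word G H v \<and> foldr (fp_cons G H) v w = []"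
proof (induction w)
  case Nil
  show ?case by (rule exI[of _ "[]"]) simp
next
  case (Cons s w)
  from Cons.prems have w: "fp_word G H w" and s: "s \<in> carrier G <+> carrier H"
    by (cases s; auto simp: fp_word_Cons)+
  from Cons.IH[OF w] obtain v where v: "fp_word G H v" "foldr (fp_cons G H) v w = []"
    by blast
  obtain t where t: "t \<in> carrier G <+> carrier H" "fp_word G H [t]" "fp_cons G H t (s # w) = w"
    using Cons.prems
    by (cases rule: fp_word_Cons_cases)
      (auto simp: fp_inl_def fp_inr_def fp_word_Cons intro: that[of "Inl (inv\<^bsub>G\<^esub> _)"] that[of "Inr (inv\<^bsub>H\<^esub> _)"])
  have "foldr (fp_cons G H) (foldr (fp_cons G H) v [t]) (s # w) = []"
    using v t Cons.prems by (simp add: fp_foldr_assoc fp_word_set)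
  moreover have "fp_word G H (foldr (fp_cons G H) v [t])"
    using v t by (simp add: fp_foldr_word fp_word_set)
  ultimately show ?case by blast
qed

lemma group_free_product: "group (free_product G H)"
  by (rule groupI)
    (auto simp: free_product_def fp_foldr_word fp_word_set fp_foldr_assoc dest: fp_left_inverse)

lemma fp_inl_hom: "fp_inl G \<in> hom G (free_product G H)"
  by (rule homI) (auto simp: free_product_def fp_inl_def fp_word_Cons)

lemma fp_inr_hom: "fp_inr H \<in> hom H (free_product G H)"
  by (rule homI) (auto simp: free_product_def fp_inr_def fp_word_Cons)

text \<open>The universal property of the coproduct.\<close>

lemma free_product_universal:
  assumes K: "group K" and f: "f \<in> hom G K" and g: "g \<in> hom H K"
  shows "\<exists>h \<in> hom (free_product G H) K.
           (\<forall>a \<in> carrier G. h (fp_inl G a) = f a) \<and> (\<forall>b \<in> carrier H. h (fp_inr H b) = g b) \<and>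
           (\<forall>h' \<in> hom (free_product G H) K.
              (\<forall>a \<in> carrier G. h' (fp_inl G a) = f a) \<and> (\<forall>b \<in> carrier H. h' (fp_inr H b) = g b)
              \<longrightarrow> (\<forall>x \<in> carrier (free_product G H). h' x = h x))"
proof -
  interpret K: group K by (rule K)
  interpret f: group_hom G K f by unfold_locales (rule f)
  interpret g: group_hom H K g by unfold_locales (rule g)
  interpret B: group "free_product G H" by (rule group_free_product)
  define p where "p = case_sum f g"
  define h where "h w = foldr (\<lambda>s k. p s \<otimes>\<^bsub>K\<^esub> k) w \<one>\<^bsub>K\<^esub>" for w
  have p: "p s \<in> carrier K" if "s \<in> carrier G <+> carrier H" for s
    using that by (auto simp: p_def)
  have h_simps: "h [] = \<one>\<^bsub>K\<^esub>" "h (s # w) = p s \<otimes>\<^bsub>K\<^esub> h w" for s w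
    by (simp_all add: h_def)
  have h_closed: "h w \<in> carrier K" if "set w \<subseteq> carrier G <+> carrier H" for w
    using that by (induction w) (auto simp: h_simps p)
  have h_cons: "h (fp_cons G H s w) = p s \<otimes>\<^bsub>K\<^esub> h w"
    if "s \<in> carrier G <+> carrier H" "fp_word G H w" for s w
    using that
    by (cases "(G, H, s, w)" rule: fp_cons.cases)
      (auto simp: fp_word_Cons h_simps p_def fp_inl_def fp_inr_def h_closed fp_word_set
        K.m_assoc[symmetric] simp flip: f.hom_mult g.hom_mult)
  have h_mult: "h (foldr (fp_cons G H) v w) = h v \<otimes>\<^bsub>K\<^esub> h w"
    if "set v \<subseteq> carrier G <+> carrier H" "fp_word G H w" for v w
    using that
    by (induction v)
      (simp_all add: h_simps h_closed fp_word_set h_cons fp_foldr_word K.m_assoc p)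
  have "h \<in> hom (free_product G H) K"
    by (rule homI) (simp_all add: free_product_def h_closed h_mult fp_word_set)
  moreover have "h (fp_inl G a) = f a" if "a \<in> carrier G" for a
    using that by (simp add: fp_inl_def h_simps p_def)
  moreover have "h (fp_inr H b) = g b" if "b \<in> carrier H" for b
    using that by (simp add: fp_inr_def h_simps p_def)
  moreover have "h' x = h x"
    if h': "h' \<in> hom (free_product G H) K"
      and l: "\<forall>a \<in> carrier G. h' (fp_inl G a) = f a" and r: "\<forall>b \<in> carrier H. h' (fp_inr H b) = g b"
      and "x \<in> carrier (free_product G H)" for h' x
  proof -
    interpret h': group_hom "free_product G H" K h' by unfold_locales (rule h')
    have "fp_word G H x" using that(4) by (simp add: free_product_def)
    then show ?thesis
    proof (induction x)
      case Nil
      show ?case using h'.hom_one by (simp add: free_product_def h_simps)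
    next
      case (Cons s w)
      from Cons.prems have w: "fp_word G H w" and s: "fp_word G H [s]"
        by (cases s; auto simp: fp_word_Cons)+
      have "s # w = [s] \<otimes>\<^bsub>free_product G H\<^esub> w"
        using Cons.prems
        by (cases rule: fp_word_Cons_cases)
          (auto simp: free_product_def fp_cons_Inl fp_cons_Inr fp_inl_def fp_inr_def)
      then have "h' (s # w) = h' [s] \<otimes>\<^bsub>K\<^esub> h' w"
        using h'.hom_mult[of "[s]" w] w s by (simp add: free_product_def)
      moreover have "h' [s] = p s"
      proof (cases s)
        case (Inl a)
        with s l[rule_format, of a] show ?thesis by (simp add: fp_word_Cons fp_inl_def p_def)
      next
        case (Inr b)
        with s r[rule_format, of b] show ?thesis by (simp add: fp_word_Cons fp_inr_def p_def)
      qed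
      ultimately show ?case using Cons.IH[OF w] by (simp add: h_simps)
    qed
  qed
  ultimately show ?thesis by blast
qed

end


section \<open>Square-summable functions and spectra\<close>

text \<open>
  The space of square-summable complex functions on a set \<open>X\<close>; its elements are represented by
  functions on the whole type that vanish outside \<open>X\<close>.
\<close>

definition ell2 :: "'x set \<Rightarrow> ('x \<Rightarrow> complex) set" where
  "ell2 X = {f. (\<forall>x. x \<notin> X \<longrightarrow> f x = 0) \<and> (\<lambda>x. (cmod (f x))\<^sup>2) summable_on X}"

definition ell2_norm :: "'x set \<Rightarrow> ('x \<Rightarrow> complex) \<Rightarrow> real" where
  "ell2_norm X f = sqrt (\<Sum>\<^sub>\<infinity>x\<in>X. (cmod (f x))\<^sup>2)"

definition ell2_bounded_op :: "'x set \<Rightarrow> (('x \<Rightarrow> complex) \<Rightarrow> ('x \<Rightarrow> complex)) \<Rightarrow> bool" where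
  "ell2_bounded_op X T \<longleftrightarrow>
     (\<forall>f \<in> ell2 X. T f \<in> ell2 X) \<and>
     (\<forall>f \<in> ell2 X. \<forall>g \<in> ell2 X. T (\<lambda>x. f x + g x) = (\<lambda>x. T f x + T g x)) \<and>
     (\<forall>c. \<forall>f \<in> ell2 X. T (\<lambda>x. c * f x) = (\<lambda>x. c * T f x)) \<and>
     (\<exists>C. \<forall>f \<in> ell2 X. ell2_norm X (T f) \<le> C * ell2_norm X f)"

text \<open>The complex numbers \<open>z\<close> for which \<open>T - z\<close> has no bounded two-sided inverse.\<close>

definition ell2_spectrum :: "'x set \<Rightarrow> (('x \<Rightarrow> complex) \<Rightarrow> ('x \<Rightarrow> complex)) \<Rightarrow> complex set" where
  "ell2_spectrum X T =
     {z. \<not> (\<exists>S. ell2_bounded_op X S \<and>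
               (\<forall>f \<in> ell2 X. S (\<lambda>x. T f x - z * f x) = f \<and>
                             (\<lambda>x. T (S f) x - z * S f x) = f))}"


section \<open>The normalized Laplacian of the Cayley graph of a free product\<close>

definition fp_laplacian ::
  "('a, 'c) monoid_scheme \<Rightarrow> ('b, 'd) monoid_scheme \<Rightarrow> real \<Rightarrow> real \<Rightarrow>
     (('a + 'b) list \<Rightarrow> complex) \<Rightarrow> ('a + 'b) list \<Rightarrow> complex" where
  "fp_laplacian G H \<omega>\<^sub>1 \<omega>\<^sub>2 f x =
     (let B = free_product G H;
          \<kappa> = (real (order G) - 1) * \<omega>\<^sub>1 + (real (order H) - 1) * \<omega>\<^sub>2
      in if x \<in> carrier B then
           f x - 1 / complex_of_real \<kappa> *
             ((\<Sum>a \<in> carrier G - {\<one>\<^bsub>G\<^esub>}. complex_of_real \<omega>\<^sub>1 * f (x \<otimes>\<^bsub>B\<^esub> fp_inl G a)) +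
              (\<Sum>b \<in> carrier H - {\<one>\<^bsub>H\<^esub>}. complex_of_real \<omega>\<^sub>2 * f (x \<otimes>\<^bsub>B\<^esub> fp_inr H b)))
         else 0)"

end

theory Submission
  imports Defs "HOL-Analysis.Convex"
begin

text \<open>
  Let \<open>P\<close> and \<open>Q\<close> be the averages over the cosets \<open>x G\<close> and \<open>x H\<close>, two orthogonal projections, and put
  \<open>\<alpha> = (M + 1) \<omega>\<^sub>1\<close>, \<open>\<beta> = (N + 1) \<omega>\<^sub>2\<close> and \<open>T = \<alpha> P + \<beta> Q\<close>. Then \<open>\<kappa>\<close> times the Laplacian is \<open>\<alpha> + \<beta> - T\<close>
  (\<open>fp_laplacian_eq_averaging_op\<close>), so everything is about the spectrum of \<open>T\<close>.

  By the algebra of two projections, a point \<open>z\<close> other than \<open>0\<close> and \<open>\<alpha>\<close> is in the spectrum of \<open>T\<close> iff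
  \<open>s = (z - \<alpha>) (z - \<beta>) / (\<alpha> \<beta>)\<close> is in the spectrum of \<open>Q P Q\<close> on the range of \<open>Q\<close>
  (\<open>two_projection_resolvent\<close>, \<open>two_projection_lower_bound\<close>). The range of \<open>Q\<close> consists of the functions on the
  cosets of \<open>H\<close>. The cosets of \<open>G\<close> and \<open>H\<close> are the vertices of a tree with degrees \<open>M + 1\<close> and \<open>N + 1\<close>, and \<open>Q P Q\<close> is
  the two-step random walk on one of the two classes of vertices. On a tree its Green's function is explicit: if \<open>n\<close> is
  the number of letters of \<open>inv x \<otimes> y\<close> from \<open>G\<close>, then \<open>\<rho> ^ n\<close>, as a function of \<open>y\<close>, satisfies the eigenvalue
  equation with eigenvalue
  \<open>s = (M + N + 1 / \<rho> + M N \<rho>) / ((M + 1) (N + 1))\<close> except at the coset of \<open>x\<close> (\<open>radial_green_identity\<close>). Substituting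
  \<open>\<rho> = \<tau> / sqrt (M N)\<close> gives \<open>M + N + sqrt (M N) (\<tau> + 1 / \<tau>)\<close> in the numerator, so every complex \<open>s\<close> occurs for some
  \<open>\<tau>\<close> with \<open>0 < |\<tau>| \<le> 1\<close>.

  If \<open>|\<tau>| < 1\<close>, then the kernel defines a bounded operator by the Schur test (\<open>radial_kernel_bounded\<close>), and the
  resolvent exists. If \<open>|\<tau>| = 1\<close>, then replacing \<open>\<tau>\<close> by \<open>t \<tau>\<close> with \<open>t < 1\<close> gives square-summable almost eigenfunctions whose norms explode as \<open>t\<close> tends
  to \<open>1\<close> (\<open>averaging_op_band\<close>). The exceptional values \<open>0\<close> and \<open>\<alpha>\<close> are eigenvalues, with eigenfunctions that are
  multiplicative over the letters of a word (\<open>averaging_op_eigenvalues\<close>); they give \<open>lam\<^sub>2\<close> and \<open>lam\<^sub>1\<close>.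

  On the unit circle \<open>\<tau> + 1 / \<tau>\<close> runs through \<open>2 cos x\<close>, and solving
  \<open>(z - \<alpha>) (z - \<beta>) = \<omega>\<^sub>1 \<omega>\<^sub>2 (M + N + 2 sqrt (M N) cos x)\<close> for \<open>z\<close> gives the two bands, at distance
  \<open>R x / (2 \<kappa>)\<close> from the centre \<open>c\<close>.
\<close>

section \<open>Square-summable functions and bounded operators\<close>

lemma ell2_outside: "f \<in> ell2 X \<Longrightarrow> x \<notin> X \<Longrightarrow> f x = 0"
  by (simp add: ell2_def)

lemma ell2_norm_nonneg [simp]: "0 \<le> ell2_norm X f"
  by (simp add: ell2_norm_def infsum_nonneg)

lemma ell2_norm_sq: "(ell2_norm X f)\<^sup>2 = (\<Sum>\<^sub>\<infinity>x\<in>X. (cmod (f x))\<^sup>2)"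
  by (simp add: ell2_norm_def infsum_nonneg)

lemma ell2I:
  assumes "\<And>x. x \<notin> X \<Longrightarrow> f x = 0"
    and "\<And>F. finite F \<Longrightarrow> F \<subseteq> X \<Longrightarrow> (\<Sum>x\<in>F. (cmod (f x))\<^sup>2) \<le> C\<^sup>2" and "0 \<le> C"
  shows "f \<in> ell2 X" and "ell2_norm X f \<le> C"
proof -
  have s: "(\<lambda>x. (cmod (f x))\<^sup>2) summable_on X"
    by (rule nonneg_bdd_above_summable_on) (auto intro!: bdd_aboveI2[where M = "C\<^sup>2"] assms)
  then show "f \<in> ell2 X"
    using assms(1) by (simp add: ell2_def)
  have "(ell2_norm X f)\<^sup>2 \<le> C\<^sup>2"
    unfolding ell2_norm_sq using s assms(2) by (rule infsum_le_finite_sums)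
  then show "ell2_norm X f \<le> C"
    using assms(3) by (rule power2_le_imp_le)
qed

lemma ell2_sum_le:
  assumes "f \<in> ell2 X" "finite F" "F \<subseteq> X"
  shows "(\<Sum>x\<in>F. (cmod (f x))\<^sup>2) \<le> (ell2_norm X f)\<^sup>2"
  unfolding ell2_norm_sq using assms by (intro finite_sum_le_infsum) (auto simp: ell2_def)

lemma ell2_eq_zeroI:
  assumes "f \<in> ell2 X" "ell2_norm X f \<le> 0"
  shows "f x = 0"
proof (cases "x \<in> X")
  case True
  have n: "ell2_norm X f = 0"
    using assms(2) ell2_norm_nonneg[of X f] by linarith
  show ?thesis
    using ell2_sum_le[OF assms(1), of "{x}"] True n by simp
qed (use assms in \<open>simp add: ell2_outside\<close>)

text \<open>
  The constant \<open>2\<close> comes from \<open>|a + b|\<^sup>2 \<le> 2 |a|\<^sup>2 + 2 |b|\<^sup>2\<close>. The sharp triangle inequality would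
  give \<open>1\<close>, but only the existence of bounds matters for spectra.
\<close>

lemma ell2_add:
  assumes f: "f \<in> ell2 X" and g: "g \<in> ell2 X"
  shows "(\<lambda>x. f x + g x) \<in> ell2 X"
    and "ell2_norm X (\<lambda>x. f x + g x) \<le> 2 * (ell2_norm X f + ell2_norm X g)"
proof -
  have le: "(\<Sum>x\<in>F. (cmod (f x + g x))\<^sup>2) \<le> (2 * (ell2_norm X f + ell2_norm X g))\<^sup>2"
    if "finite F" "F \<subseteq> X" for F
  proof -
    have "(cmod (a + b))\<^sup>2 \<le> 2 * (cmod a)\<^sup>2 + 2 * (cmod b)\<^sup>2" for a b
    proof -
      have "(cmod (a + b))\<^sup>2 \<le> (cmod a + cmod b)\<^sup>2"
        by (intro power_mono norm_triangle_ineq) auto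
      also have "\<dots> \<le> 2 * (cmod a)\<^sup>2 + 2 * (cmod b)\<^sup>2"
        using sum_squares_bound[of "cmod a" "cmod b"] by (simp add: power2_sum)
      finally show ?thesis .
    qed
    then have "(\<Sum>x\<in>F. (cmod (f x + g x))\<^sup>2)
        \<le> (\<Sum>x\<in>F. 2 * (cmod (f x))\<^sup>2 + 2 * (cmod (g x))\<^sup>2)"
      by (intro sum_mono)
    also have "\<dots> = 2 * (\<Sum>x\<in>F. (cmod (f x))\<^sup>2) + 2 * (\<Sum>x\<in>F. (cmod (g x))\<^sup>2)"
      by (simp add: sum.distrib sum_distrib_left)
    also have "\<dots> \<le> 2 * (ell2_norm X f)\<^sup>2 + 2 * (ell2_norm X g)\<^sup>2"
      using ell2_sum_le[OF f that] ell2_sum_le[OF g that] by linarith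
    also have "\<dots> \<le> (2 * (ell2_norm X f + ell2_norm X g))\<^sup>2"
      by (simp add: power2_sum power_mult_distrib)
    finally show ?thesis .
  qed
  show "(\<lambda>x. f x + g x) \<in> ell2 X"
    and "ell2_norm X (\<lambda>x. f x + g x) \<le> 2 * (ell2_norm X f + ell2_norm X g)"
    by (rule ell2I[OF _ le]; simp add: ell2_outside[OF f] ell2_outside[OF g])+
qed

lemma ell2_scale:
  assumes f: "f \<in> ell2 X"
  shows "(\<lambda>x. c * f x) \<in> ell2 X"
    and "ell2_norm X (\<lambda>x. c * f x) = cmod c * ell2_norm X f"
proof -
  show "(\<lambda>x. c * f x) \<in> ell2 X"
    using f by (auto simp: ell2_def norm_mult power_mult_distrib intro: summable_on_cmult_right)
  show "ell2_norm X (\<lambda>x. c * f x) = cmod c * ell2_norm X f"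
    by (simp add: ell2_norm_def norm_mult power_mult_distrib infsum_cmult_right' real_sqrt_mult)
qed

lemma ell2_zero: "(\<lambda>x. 0) \<in> ell2 X"
  by (simp add: ell2_def)

lemma ell2_diff:
  assumes "f \<in> ell2 X" "g \<in> ell2 X"
  shows "(\<lambda>x. f x - g x) \<in> ell2 X"
  using ell2_add(1)[OF assms(1) ell2_scale(1)[OF assms(2), of "-1"]] by simp

lemma bounded_opD:
  assumes "ell2_bounded_op X T"
  shows bounded_op_in: "f \<in> ell2 X \<Longrightarrow> T f \<in> ell2 X"
    and bounded_op_add:
      "f \<in> ell2 X \<Longrightarrow> g \<in> ell2 X \<Longrightarrow> T (\<lambda>x. f x + g x) = (\<lambda>x. T f x + T g x)"
    and bounded_op_scale: "f \<in> ell2 X \<Longrightarrow> T (\<lambda>x. c * f x) = (\<lambda>x. c * T f x)"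
  using assms by (auto simp: ell2_bounded_op_def)

lemma bounded_opI:
  assumes "\<And>f. f \<in> ell2 X \<Longrightarrow> T f \<in> ell2 X"
    and "\<And>f. f \<in> ell2 X \<Longrightarrow> ell2_norm X (T f) \<le> C * ell2_norm X f"
    and "\<And>f g x. f \<in> ell2 X \<Longrightarrow> g \<in> ell2 X \<Longrightarrow> T (\<lambda>x. f x + g x) x = T f x + T g x"
    and "\<And>c f x. f \<in> ell2 X \<Longrightarrow> T (\<lambda>x. c * f x) x = c * T f x"
  shows "ell2_bounded_op X T"
  unfolding ell2_bounded_op_def using assms by (auto simp: fun_eq_iff)

lemma bounded_op_diff:
  assumes T: "ell2_bounded_op X T" and fg: "f \<in> ell2 X" "g \<in> ell2 X"
  shows "T (\<lambda>x. f x - g x) = (\<lambda>x. T f x - T g x)"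
  using bounded_op_add[OF T fg(1) ell2_scale(1)[OF fg(2), of "-1"]]
    bounded_op_scale[OF T fg(2), of "-1"]
  by simp

lemma bounded_op_bound:
  assumes "ell2_bounded_op X T"
  obtains C where "0 \<le> C" "\<And>f. f \<in> ell2 X \<Longrightarrow> ell2_norm X (T f) \<le> C * ell2_norm X f"
proof -
  obtain C where C: "\<And>f. f \<in> ell2 X \<Longrightarrow> ell2_norm X (T f) \<le> C * ell2_norm X f"
    using assms unfolding ell2_bounded_op_def by blast
  have "ell2_norm X (T f) \<le> max 0 C * ell2_norm X f" if "f \<in> ell2 X" for f
    using C[OF that] mult_right_mono[of C "max 0 C" "ell2_norm X f"] by simp
  then show thesis
    using that[of "max 0 C"] by simp
qed

lemma bounded_op_id: "ell2_bounded_op X (\<lambda>f. f)"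
  by (auto simp: ell2_bounded_op_def intro!: exI[of _ 1])

lemma bounded_op_zero: "ell2_bounded_op X (\<lambda>f x. 0)"
  by (auto simp: ell2_bounded_op_def ell2_zero ell2_norm_def intro!: exI[of _ 1] infsum_nonneg)

lemma bounded_op_comp:
  assumes S: "ell2_bounded_op X S" and T: "ell2_bounded_op X T"
  shows "ell2_bounded_op X (\<lambda>f. S (T f))"
proof -
  obtain C where C: "0 \<le> C" "\<And>f. f \<in> ell2 X \<Longrightarrow> ell2_norm X (S f) \<le> C * ell2_norm X f"
    by (rule bounded_op_bound[OF S]) blast
  obtain D where D: "0 \<le> D" "\<And>f. f \<in> ell2 X \<Longrightarrow> ell2_norm X (T f) \<le> D * ell2_norm X f"
    by (rule bounded_op_bound[OF T]) blast
  have "ell2_norm X (S (T f)) \<le> (C * D) * ell2_norm X f" if f: "f \<in> ell2 X" for f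
    using C(2)[OF bounded_op_in[OF T f]] mult_left_mono[OF D(2)[OF f] C(1)]
    by (simp add: mult.assoc)
  then show ?thesis
    unfolding ell2_bounded_op_def
    by (auto simp: bounded_op_in[OF S] bounded_op_in[OF T] bounded_op_add[OF S]
        bounded_op_add[OF T] bounded_op_scale[OF S] bounded_op_scale[OF T])
qed

lemma bounded_op_plus:
  assumes S: "ell2_bounded_op X S" and T: "ell2_bounded_op X T"
  shows "ell2_bounded_op X (\<lambda>f x. S f x + T f x)"
proof -
  obtain C where C: "0 \<le> C" "\<And>f. f \<in> ell2 X \<Longrightarrow> ell2_norm X (S f) \<le> C * ell2_norm X f"
    by (rule bounded_op_bound[OF S]) blast
  obtain D where D: "0 \<le> D" "\<And>f. f \<in> ell2 X \<Longrightarrow> ell2_norm X (T f) \<le> D * ell2_norm X f"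
    by (rule bounded_op_bound[OF T]) blast
  have "ell2_norm X (\<lambda>x. S f x + T f x) \<le> (2 * (C + D)) * ell2_norm X f"
    if f: "f \<in> ell2 X" for f
    using ell2_add(2)[OF bounded_op_in[OF S f] bounded_op_in[OF T f]] C(2)[OF f] D(2)[OF f]
    by (simp add: algebra_simps)
  then show ?thesis
    by (rule bounded_opI[rotated])
      (auto simp: bounded_op_in[OF S] bounded_op_in[OF T] bounded_op_add[OF S]
        bounded_op_add[OF T] bounded_op_scale[OF S] bounded_op_scale[OF T] ell2_add algebra_simps)
qed

lemma bounded_op_cmult:
  assumes T: "ell2_bounded_op X T"
  shows "ell2_bounded_op X (\<lambda>f x. c * T f x)"
proof -
  obtain C where C: "0 \<le> C" "\<And>f. f \<in> ell2 X \<Longrightarrow> ell2_norm X (T f) \<le> C * ell2_norm X f"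
    by (rule bounded_op_bound[OF T]) blast
  have "ell2_norm X (\<lambda>x. c * T f x) \<le> (cmod c * C) * ell2_norm X f" if f: "f \<in> ell2 X" for f
    using mult_left_mono[OF C(2)[OF f], of "cmod c"]
    by (simp add: ell2_scale(2)[OF bounded_op_in[OF T f]] mult.assoc)
  then show ?thesis
    by (rule bounded_opI[rotated])
      (auto simp: bounded_op_in[OF T] bounded_op_add[OF T] bounded_op_scale[OF T] ell2_scale
        algebra_simps)
qed

lemma bounded_op_cong:
  assumes T: "ell2_bounded_op X T" and eq: "\<And>f. f \<in> ell2 X \<Longrightarrow> L f = T f"
  shows "ell2_bounded_op X L"
proof -
  obtain C where "\<And>f. f \<in> ell2 X \<Longrightarrow> ell2_norm X (T f) \<le> C * ell2_norm X f"
    by (rule bounded_op_bound[OF T]) blast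
  then show ?thesis
    by (intro bounded_opI[where C = C])
      (auto simp: eq ell2_add ell2_scale bounded_op_in[OF T] bounded_op_add[OF T] bounded_op_scale[OF T])
qed

lemma bounded_op_minus:
  assumes "ell2_bounded_op X S" "ell2_bounded_op X T"
  shows "ell2_bounded_op X (\<lambda>f x. S f x - T f x)"
  using bounded_op_plus[OF assms(1) bounded_op_cmult[OF assms(2), of "-1"]] by simp

lemma bounded_op_sum:
  "finite A \<Longrightarrow> (\<And>a. a \<in> A \<Longrightarrow> ell2_bounded_op X (T a)) \<Longrightarrow>
    ell2_bounded_op X (\<lambda>f x. \<Sum>a\<in>A. T a f x)"
  by (induction A rule: finite_induct) (auto intro: bounded_op_zero bounded_op_plus)

text \<open>
  A bounded inverse of \<open>T - z\<close> forces \<open>T - z\<close> to be bounded below. Both ways used here of showing that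
  \<open>z\<close> is in the spectrum, eigenfunctions and families of almost eigenfunctions, contradict this.
\<close>

lemma resolvent_lower_bound:
  assumes T: "\<And>f. f \<in> ell2 X \<Longrightarrow> T f \<in> ell2 X" and z: "z \<notin> ell2_spectrum X T"
  obtains C where "0 \<le> C"
    and "\<And>f. f \<in> ell2 X \<Longrightarrow> ell2_norm X f \<le> C * ell2_norm X (\<lambda>x. T f x - z * f x)"
proof -
  obtain S where S: "ell2_bounded_op X S"
      and inv: "\<And>f. f \<in> ell2 X \<Longrightarrow> S (\<lambda>x. T f x - z * f x) = f"
    using z by (auto simp: ell2_spectrum_def)
  obtain C where C: "0 \<le> C" "\<And>f. f \<in> ell2 X \<Longrightarrow> ell2_norm X (S f) \<le> C * ell2_norm X f"
    by (rule bounded_op_bound[OF S]) blast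
  have "ell2_norm X f \<le> C * ell2_norm X (\<lambda>x. T f x - z * f x)" if f: "f \<in> ell2 X" for f
    using C(2)[OF ell2_diff[OF T[OF f] ell2_scale(1)[OF f]], of z] inv[OF f] by simp
  with C(1) show thesis by (rule that)
qed

lemma eigenvalue_in_spectrum:
  assumes T: "\<And>f. f \<in> ell2 X \<Longrightarrow> T f \<in> ell2 X"
    and f: "f \<in> ell2 X" "f x \<noteq> 0" and ev: "T f = (\<lambda>x. z * f x)"
  shows "z \<in> ell2_spectrum X T"
proof (rule ccontr)
  assume "z \<notin> ell2_spectrum X T"
  then obtain C where
    "\<And>f. f \<in> ell2 X \<Longrightarrow> ell2_norm X f \<le> C * ell2_norm X (\<lambda>x. T f x - z * f x)"
    by (rule resolvent_lower_bound[rotated]) (use T in blast)+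
  from this[OF f(1)] have "ell2_norm X f \<le> C * ell2_norm X (\<lambda>x. T f x - z * f x)" .
  then have "ell2_norm X f \<le> 0"
    by (simp add: ev ell2_norm_def)
  with f show False
    by (auto dest: ell2_eq_zeroI)
qed

section \<open>The Schur test\<close>

text \<open>
  Write \<open>a g\<close> as \<open>\<surd>(a h) \<cdot> (\<surd>(a / h) g)\<close> and apply the Cauchy-Schwarz inequality in each row. The first factor
  is controlled by the hypothesis on the rows; after exchanging the sums, the second is controlled by the
  same hypothesis on the columns, because \<open>a\<close> is symmetric.
\<close>

lemma finite_Schur_test:
  fixes a :: "'x \<Rightarrow> 'x \<Rightarrow> real"
  assumes X: "F \<subseteq> X" "F' \<subseteq> X" and fin: "finite F" "finite F'"
    and a: "\<And>x y. 0 \<le> a x y" "\<And>x y. x \<in> X \<Longrightarrow> y \<in> X \<Longrightarrow> a x y = a y x"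
    and h: "\<And>x. x \<in> X \<Longrightarrow> 0 < h x" and C: "0 \<le> C"
    and bound: "\<And>x F. x \<in> X \<Longrightarrow> finite F \<Longrightarrow> F \<subseteq> X \<Longrightarrow> (\<Sum>y\<in>F. a x y * h y) \<le> C * h x"
  shows "(\<Sum>x\<in>F. (\<Sum>y\<in>F'. a x y * g y)\<^sup>2) \<le> C\<^sup>2 * (\<Sum>y\<in>F'. (g y)\<^sup>2)"
proof -
  have "(\<Sum>y\<in>F'. a x y * g y)\<^sup>2 \<le> C * h x * (\<Sum>y\<in>F'. a x y * ((g y)\<^sup>2 / h y))" if "x \<in> F" for x
  proof -
    have x: "x \<in> X" using that X by auto
    have hy: "0 < h y" if "y \<in> F'" for y using that X h by auto
    have eq: "(\<Sum>y\<in>F'. a x y * g y)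
        = (\<Sum>y\<in>F'. sqrt (a x y * h y) * (sqrt (a x y / h y) * g y))"
    proof (rule sum.cong)
      fix y assume "y \<in> F'"
      with hy have "sqrt (a x y * h y) * sqrt (a x y / h y) = a x y"
        using a(1)[of x y] by (simp add: real_sqrt_mult[symmetric] less_imp_neq[THEN not_sym])
      then show "a x y * g y = sqrt (a x y * h y) * (sqrt (a x y / h y) * g y)"
        by (simp add: mult.assoc[symmetric])
    qed simp
    have "(\<Sum>y\<in>F'. a x y * g y)\<^sup>2
        \<le> (\<Sum>y\<in>F'. (sqrt (a x y * h y))\<^sup>2) * (\<Sum>y\<in>F'. (sqrt (a x y / h y) * g y)\<^sup>2)"
      unfolding eq by (rule Cauchy_Schwarz_ineq_sum)
    also have "(\<Sum>y\<in>F'. (sqrt (a x y * h y))\<^sup>2) = (\<Sum>y\<in>F'. a x y * h y)"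
      using a(1) hy by (intro sum.cong) (auto simp: less_imp_le)
    also have "(\<Sum>y\<in>F'. (sqrt (a x y / h y) * g y)\<^sup>2) = (\<Sum>y\<in>F'. a x y * ((g y)\<^sup>2 / h y))"
      using a(1) hy by (intro sum.cong) (auto simp: less_imp_le power_mult_distrib)
    also have "(\<Sum>y\<in>F'. a x y * h y) * (\<Sum>y\<in>F'. a x y * ((g y)\<^sup>2 / h y))
        \<le> C * h x * (\<Sum>y\<in>F'. a x y * ((g y)\<^sup>2 / h y))"
      using bound[OF x fin(2) X(2)] a(1) hy
      by (intro mult_right_mono sum_nonneg) (auto simp: less_imp_le)
    finally show ?thesis .
  qed
  then have "(\<Sum>x\<in>F. (\<Sum>y\<in>F'. a x y * g y)\<^sup>2)
      \<le> (\<Sum>x\<in>F. C * h x * (\<Sum>y\<in>F'. a x y * ((g y)\<^sup>2 / h y)))"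
    by (rule sum_mono)
  also have "\<dots> = (\<Sum>y\<in>F'. C * ((g y)\<^sup>2 / h y) * (\<Sum>x\<in>F. a y x * h x))"
    unfolding sum_distrib_left
    apply (subst sum.swap)
    apply (intro sum.cong refl)
    subgoal for y x
      using a(2)[of x y] X by (auto simp: algebra_simps)
    done
  also have "\<dots> \<le> (\<Sum>y\<in>F'. C * ((g y)\<^sup>2 / h y) * (C * h y))"
    using X h C by (intro sum_mono mult_left_mono bound fin) (auto simp: less_imp_le)
  also have "\<dots> = (\<Sum>y\<in>F'. C\<^sup>2 * (g y)\<^sup>2)"
  proof (rule sum.cong)
    fix y assume "y \<in> F'"
    then have "h y \<noteq> 0" using h[of y] X by auto
    then show "C * ((g y)\<^sup>2 / h y) * (C * h y) = C\<^sup>2 * (g y)\<^sup>2"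
      by (simp add: power2_eq_square)
  qed simp
  also have "\<dots> = C\<^sup>2 * (\<Sum>y\<in>F'. (g y)\<^sup>2)"
    by (simp add: sum_distrib_left)
  finally show ?thesis .
qed

text \<open>
  The passage to infinite index sets. Symmetry gives \<open>|K x y| / h y \<le> C / h x\<close>, so each row is absolutely
  summable against a square-summable function by the inequality between arithmetic and geometric mean;
  the norm bound is the limit of the finite one.
\<close>

lemma Schur_test:
  fixes K :: "'x \<Rightarrow> 'x \<Rightarrow> complex" and h :: "'x \<Rightarrow> real"
  assumes sym: "\<And>x y. x \<in> X \<Longrightarrow> y \<in> X \<Longrightarrow> cmod (K x y) = cmod (K y x)"
    and h: "\<And>x. x \<in> X \<Longrightarrow> 0 < h x" and C: "0 \<le> C"
    and bound: "\<And>x F. x \<in> X \<Longrightarrow> finite F \<Longrightarrow> F \<subseteq> X \<Longrightarrow>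
                  (\<Sum>y\<in>F. cmod (K x y) * h y) \<le> C * h x"
  shows Schur_test_summable:
      "\<And>f x. f \<in> ell2 X \<Longrightarrow> x \<in> X \<Longrightarrow> (\<lambda>y. K x y * f y) summable_on X"
    and Schur_test_bounded:
      "ell2_bounded_op X (\<lambda>f x. if x \<in> X then \<Sum>\<^sub>\<infinity>y\<in>X. K x y * f y else 0)"
proof -
  show summable: "(\<lambda>y. K x y * f y) summable_on X" if f: "f \<in> ell2 X" and x: "x \<in> X" for f x
  proof (rule abs_summable_summable, rule nonneg_bdd_above_summable_on)
    define B where "B = (C * h x + (C / h x) * (ell2_norm X f)\<^sup>2) / 2"
    have "(\<Sum>y\<in>F. norm (K x y * f y)) \<le> B" if F: "finite F" "F \<subseteq> X" for F
    proof -
      have term_le: "norm (K x y * f y)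
          \<le> (cmod (K x y) * h y + (C / h x) * (cmod (f y))\<^sup>2) / 2" if "y \<in> F" for y
      proof -
        have y: "y \<in> X" "0 < h y" using that F h by auto
        have "cmod (K x y) * h x \<le> C * h y"
          using bound[OF y(1), of "{x}"] x sym[OF x y(1)] by simp
        then have le: "cmod (K x y) / h y \<le> C / h x"
          using y h[OF x] by (simp add: field_simps)
        have "2 * (h y * cmod (f y)) \<le> (h y)\<^sup>2 + (cmod (f y))\<^sup>2"
          using sum_squares_bound[of "h y" "cmod (f y)"] by (simp add: mult.assoc)
        then have "2 * cmod (f y) \<le> h y + (cmod (f y))\<^sup>2 / h y"
          using y(2) by (simp add: field_simps power2_eq_square)
        then have "cmod (K x y) * (2 * cmod (f y)) \<le> cmod (K x y) * (h y + (cmod (f y))\<^sup>2 / h y)"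
          by (rule mult_left_mono) simp
        also have "\<dots> = cmod (K x y) * h y + (cmod (K x y) / h y) * (cmod (f y))\<^sup>2"
          by (simp add: algebra_simps)
        also have "\<dots> \<le> cmod (K x y) * h y + (C / h x) * (cmod (f y))\<^sup>2"
          using mult_right_mono[OF le, of "(cmod (f y))\<^sup>2"] by simp
        finally show ?thesis
          by (simp add: norm_mult)
      qed
      have "(\<Sum>y\<in>F. norm (K x y * f y))
          \<le> (\<Sum>y\<in>F. (cmod (K x y) * h y + (C / h x) * (cmod (f y))\<^sup>2) / 2)"
        by (rule sum_mono) (rule term_le)
      also have "\<dots> = ((\<Sum>y\<in>F. cmod (K x y) * h y) + (C / h x) * (\<Sum>y\<in>F. (cmod (f y))\<^sup>2)) / 2"
        by (simp only: sum.distrib sum_distrib_left[symmetric] sum_divide_distrib[symmetric])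
      also have "\<dots> \<le> B"
        unfolding B_def using bound[OF x F] ell2_sum_le[OF f F] C h[OF x]
        by (intro divide_right_mono add_mono mult_left_mono) auto
      finally show ?thesis .
    qed
    then show "bdd_above (sum (\<lambda>y. norm (K x y * f y)) ` {F. F \<subseteq> X \<and> finite F})"
      by (intro bdd_aboveI2[where M = B]) auto
  qed auto
  define T where "T f x = (if x \<in> X then \<Sum>\<^sub>\<infinity>y\<in>X. K x y * f y else 0)" for f x
  have le: "(\<Sum>x\<in>F. (cmod (T f x))\<^sup>2) \<le> (C * ell2_norm X f)\<^sup>2"
    if f: "f \<in> ell2 X" and F: "finite F" "F \<subseteq> X" for f F
  proof -
    have "((\<lambda>F'. \<Sum>x\<in>F. (cmod (\<Sum>y\<in>F'. K x y * f y))\<^sup>2) \<longlongrightarrow> (\<Sum>x\<in>F. (cmod (T f x))\<^sup>2))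
        (finite_subsets_at_top X)"
      using F summable[OF f]
      by (auto simp: T_def subset_iff intro!: tendsto_intros infsum_tendsto)
    moreover have "\<forall>\<^sub>F F' in finite_subsets_at_top X.
        (\<Sum>x\<in>F. (cmod (\<Sum>y\<in>F'. K x y * f y))\<^sup>2) \<le> (C * ell2_norm X f)\<^sup>2"
    proof (rule eventually_finite_subsets_at_top_weakI)
      fix F' assume F': "finite F'" "F' \<subseteq> X"
      have "(\<Sum>x\<in>F. (cmod (\<Sum>y\<in>F'. K x y * f y))\<^sup>2)
          \<le> (\<Sum>x\<in>F. (\<Sum>y\<in>F'. cmod (K x y) * cmod (f y))\<^sup>2)"
        by (intro sum_mono power_mono sum_norm_le) (auto simp: norm_mult)
      also have "\<dots> \<le> C\<^sup>2 * (\<Sum>y\<in>F'. (cmod (f y))\<^sup>2)"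
        using F F' sym h C bound by (intro finite_Schur_test[where X = X and h = h]) auto
      also have "\<dots> \<le> C\<^sup>2 * (ell2_norm X f)\<^sup>2"
        by (intro mult_left_mono ell2_sum_le f F') auto
      finally show "(\<Sum>x\<in>F. (cmod (\<Sum>y\<in>F'. K x y * f y))\<^sup>2) \<le> (C * ell2_norm X f)\<^sup>2"
        by (simp add: power_mult_distrib)
    qed
    ultimately show ?thesis
      by (rule tendsto_upperbound) simp
  qed
  have T: "T f \<in> ell2 X" "ell2_norm X (T f) \<le> C * ell2_norm X f" if "f \<in> ell2 X" for f
    by (rule ell2I[OF _ le[OF that]]; simp add: T_def C)+
  have "ell2_bounded_op X T"
    unfolding ell2_bounded_op_def
    using T
    by (auto simp: T_def fun_eq_iff distrib_left infsum_add summable infsum_cmult_right'[symmetric]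
        mult.left_commute intro!: exI[of _ C])
  then show "ell2_bounded_op X (\<lambda>f x. if x \<in> X then \<Sum>\<^sub>\<infinity>y\<in>X. K x y * f y else 0)"
    by (simp add: T_def[abs_def])
qed

section \<open>The spectrum of a combination of two projections\<close>

lemma affine_not_in_spectrum:
  assumes T: "ell2_bounded_op X T" and b: "b \<noteq> 0" and z: "z \<notin> ell2_spectrum X T"
    and L: "\<And>f x. f \<in> ell2 X \<Longrightarrow> L f x = a * f x - b * T f x"
  shows "a - b * z \<notin> ell2_spectrum X L"
proof -
  obtain S where S: "ell2_bounded_op X S"
      and inv: "\<And>f. f \<in> ell2 X \<Longrightarrow> S (\<lambda>x. T f x - z * f x) = f"
        "\<And>f. f \<in> ell2 X \<Longrightarrow> (\<lambda>x. T (S f) x - z * S f x) = f"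
    using z by (auto simp: ell2_spectrum_def)
  let ?S = "\<lambda>f x. (- 1 / b) * S f x"
  have "?S (\<lambda>x. L f x - (a - b * z) * f x) = f" if f: "f \<in> ell2 X" for f
  proof -
    have Tf: "(\<lambda>x. T f x - z * f x) \<in> ell2 X"
      by (intro ell2_diff ell2_scale(1) bounded_op_in[OF T] f)
    have "(\<lambda>x. L f x - (a - b * z) * f x) = (\<lambda>x. (- b) * (T f x - z * f x))"
      by (simp add: L[OF f] algebra_simps)
    then show ?thesis
      using b by (simp only: bounded_op_scale[OF S Tf] inv(1)[OF f]) simp
  qed
  moreover have "(\<lambda>x. L (?S f) x - (a - b * z) * ?S f x) = f" if f: "f \<in> ell2 X" for f
  proof
    fix x
    have Sf: "S f \<in> ell2 X" using bounded_op_in[OF S f] .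
    have "L (?S f) x - (a - b * z) * ?S f x = T (S f) x - z * S f x"
      using b by (simp only: L[OF ell2_scale(1)[OF Sf]] bounded_op_scale[OF T Sf])
        (simp add: field_simps)
    then show "L (?S f) x - (a - b * z) * ?S f x = f x"
      using fun_cong[OF inv(2)[OF f], of x] by simp
  qed
  ultimately show ?thesis
    using bounded_op_cmult[OF S, of "- 1 / b"] unfolding ell2_spectrum_def by blast
qed

lemma affine_spectrum:
  assumes T: "ell2_bounded_op X T" and b: "b \<noteq> 0"
    and L: "\<And>f x. f \<in> ell2 X \<Longrightarrow> L f x = a * f x - b * T f x" and L_op: "ell2_bounded_op X L"
  shows "a - b * z \<in> ell2_spectrum X L \<longleftrightarrow> z \<in> ell2_spectrum X T"
proof
  have "T f x = (a / b) * f x - (1 / b) * L f x" if "f \<in> ell2 X" for f x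
    using L[OF that] b by (simp add: field_simps)
  then have "a - b * z \<notin> ell2_spectrum X L \<Longrightarrow>
      (a / b) - (1 / b) * (a - b * z) \<notin> ell2_spectrum X T"
    by (rule affine_not_in_spectrum[OF L_op, rotated 2]) (use b in auto)
  moreover have "(a / b) - (1 / b) * (a - b * z) = z"
    using b by (simp add: field_simps)
  ultimately show "z \<in> ell2_spectrum X T \<Longrightarrow> a - b * z \<in> ell2_spectrum X L"
    by auto
qed (use affine_not_in_spectrum[OF T b _ L] in blast)

text \<open>
  The resolvent of \<open>T = \<alpha> P + \<beta> Q\<close> reduces to an inverse of \<open>Q P Q - s\<close> on the range of \<open>Q\<close>. Suppose
  \<open>(T - z) f = g\<close> and put \<open>u = P f\<close>, \<open>v = Q f\<close>. Applying \<open>P\<close> gives \<open>(z - \<alpha>) u = \<beta> P v - P g\<close>; applying \<open>Q\<close>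
  gives \<open>(z - \<beta>) v = \<alpha> Q u - Q g\<close>. Eliminating \<open>u\<close> leaves
  \<open>\<alpha> \<beta> (Q P - s) v = \<alpha> Q P g + (z - \<alpha>) Q g\<close>. The operator \<open>K\<close> inverts \<open>Q P Q - s\<close> on the range of \<open>Q\<close>, and
  \<open>z f = \<alpha> u + \<beta> v - g\<close>. The operators \<open>V\<close>, \<open>U\<close> and \<open>S\<close> of the proof send \<open>g\<close> to these \<open>v\<close>, \<open>u\<close> and \<open>f\<close>.

  Eliminating \<open>u\<close> instead of \<open>v\<close> matters: it allows \<open>z = \<beta>\<close>, but not \<open>z = \<alpha>\<close>.
\<close>

lemma two_projection_resolvent:
  assumes P: "ell2_bounded_op X P" and Q: "ell2_bounded_op X Q" and K: "ell2_bounded_op X K"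
    and PP: "\<And>f. f \<in> ell2 X \<Longrightarrow> P (P f) = P f"
    and QK: "\<And>f. f \<in> ell2 X \<Longrightarrow> Q (K f) = K f" and KQ: "\<And>f. f \<in> ell2 X \<Longrightarrow> K (Q f) = K f"
    and QPK: "\<And>f. f \<in> ell2 X \<Longrightarrow> Q (P (K f)) = (\<lambda>x. s * K f x + Q f x)"
    and KPQ: "\<And>f. f \<in> ell2 X \<Longrightarrow> K (P (Q f)) = (\<lambda>x. s * K f x + Q f x)"
    and nz: "\<alpha> \<noteq> 0" "\<beta> \<noteq> 0" "z \<noteq> 0" "z \<noteq> \<alpha>" and s: "\<alpha> * \<beta> * s = (z - \<alpha>) * (z - \<beta>)"
  shows "z \<notin> ell2_spectrum X (\<lambda>f x. \<alpha> * P f x + \<beta> * Q f x)"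
proof -
  define T where "T f x = \<alpha> * P f x + \<beta> * Q f x" for f x
  define V where "V f x = (1 / \<beta>) * K (P f) x + ((z - \<alpha>) / (\<alpha> * \<beta>)) * K f x" for f x
  define U where "U f x = (\<beta> / (z - \<alpha>)) * P (V f) x - (1 / (z - \<alpha>)) * P f x" for f x
  define S where "S f x = (\<alpha> / z) * U f x + (\<beta> / z) * V f x - (1 / z) * f x" for f x
  have T: "ell2_bounded_op X T"
    unfolding T_def[abs_def] by (intro bounded_op_plus bounded_op_cmult P Q)
  have V: "ell2_bounded_op X V"
    unfolding V_def[abs_def] by (intro bounded_op_plus bounded_op_cmult bounded_op_comp[OF K] P K)
  have U: "ell2_bounded_op X U"
    unfolding U_def[abs_def] by (intro bounded_op_minus bounded_op_cmult bounded_op_comp[OF P] P V)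
  have S: "ell2_bounded_op X S"
    unfolding S_def[abs_def]
    by (intro bounded_op_minus bounded_op_plus bounded_op_cmult bounded_op_id U V)
  note cl = bounded_op_in[OF P] bounded_op_in[OF Q] bounded_op_in[OF K] bounded_op_in[OF T]
    bounded_op_in[OF U] bounded_op_in[OF V] bounded_op_in[OF S] ell2_scale(1) ell2_add(1) ell2_diff
  note lin = bounded_op_add bounded_op_scale bounded_op_diff
  have left: "S (\<lambda>x. T g x - z * g x) = g" if g: "g \<in> ell2 X" for g
  proof
    fix x
    define w where "w = (\<lambda>x. T g x - z * g x)"
    have w: "w \<in> ell2 X"
      unfolding w_def by (intro cl g)
    have Pw: "P w = (\<lambda>x. (\<alpha> - z) * P g x + \<beta> * P (Q g) x)"
      unfolding w_def T_def
      by (simp add: lin[OF P] cl g PP fun_eq_iff algebra_simps)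
    have Kw: "K w = (\<lambda>x. \<alpha> * K (P g) x + (\<beta> - z) * K g x)"
      unfolding w_def T_def
      by (simp add: lin[OF K] cl g KQ fun_eq_iff algebra_simps)
    have KPw: "K (P w) = (\<lambda>x. (\<alpha> - z) * K (P g) x + \<beta> * (s * K g x + Q g x))"
      unfolding Pw by (simp add: lin[OF K] cl g KPQ fun_eq_iff)
    have Vw: "V w = Q g"
    proof
      fix x
      have "\<alpha> * \<beta> * V w x = \<alpha> * K (P w) x + (z - \<alpha>) * K w x"
        using nz by (simp add: V_def field_simps)
      also have "\<dots> = \<alpha> * \<beta> * Q g x + (\<alpha> * \<beta> * s - (z - \<alpha>) * (z - \<beta>)) * K g x"
        by (simp add: KPw Kw algebra_simps)
      finally show "V w x = Q g x"
        using nz by (simp add: s)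
    qed
    have "(z - \<alpha>) * U w x = \<beta> * P (Q g) x - P w x"
      using nz by (simp add: U_def Vw right_diff_distrib)
    also have "\<dots> = (z - \<alpha>) * P g x"
      by (simp add: Pw algebra_simps)
    finally have Uw: "U w x = P g x"
      using nz by simp
    have "z * S w x = \<alpha> * U w x + \<beta> * V w x - w x"
      using nz by (simp add: S_def field_simps)
    also have "\<dots> = z * g x"
      unfolding Uw Vw by (simp add: w_def T_def)
    finally show "S (\<lambda>x. T g x - z * g x) x = g x"
      using nz by (simp add: w_def)
  qed
  have right: "(\<lambda>x. T (S g) x - z * S g x) = g" if g: "g \<in> ell2 X" for g
  proof
    fix x
    have PU: "P (U g) x = U g x"
      unfolding U_def[abs_def] by (simp only: lin[OF P] cl g PP)
    have QV: "Q (V g) x = V g x"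
      unfolding V_def[abs_def] by (simp only: lin[OF Q] cl g QK)
    have QPV: "\<alpha> * \<beta> * Q (P (V g)) x = \<alpha> * \<beta> * s * V g x + \<alpha> * Q (P g) x + (z - \<alpha>) * Q g x"
    proof -
      have "Q (P (V g)) x = (1 / \<beta>) * (s * K (P g) x + Q (P g) x)
          + ((z - \<alpha>) / (\<alpha> * \<beta>)) * (s * K g x + Q g x)"
        unfolding V_def[abs_def] by (simp only: lin[OF P] lin[OF Q] cl g QPK)
      moreover have "\<alpha> * \<beta> * ((1 / \<beta>) * a + ((z - \<alpha>) / (\<alpha> * \<beta>)) * b) = \<alpha> * a + (z - \<alpha>) * b"
        for a b
        using nz by (simp add: distrib_left)
      ultimately have "\<alpha> * \<beta> * Q (P (V g)) x
            = \<alpha> * (s * K (P g) x + Q (P g) x) + (z - \<alpha>) * (s * K g x + Q g x)"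
          and "\<alpha> * \<beta> * V g x = \<alpha> * K (P g) x + (z - \<alpha>) * K g x"
        by (simp_all only: V_def)
      moreover have "\<alpha> * \<beta> * s * V g x = s * (\<alpha> * \<beta> * V g x)"
        by simp
      ultimately show ?thesis
        by (simp only:) (simp add: algebra_simps)
    qed
    have "(z - \<alpha>) * P (U g) x = \<beta> * P (V g) x - P g x"
      unfolding PU using nz by (simp add: U_def right_diff_distrib)
    moreover have "z * P (S g) x = \<alpha> * P (U g) x + \<beta> * P (V g) x - P g x"
      unfolding S_def[abs_def] using nz
      by (simp only: lin[OF P] cl g) (simp add: distrib_left right_diff_distrib)
    moreover have "z * U g x = \<alpha> * U g x + (z - \<alpha>) * U g x"
      by (simp add: algebra_simps)
    ultimately have "z * P (S g) x = z * U g x"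
      unfolding PU by simp
    then have PS: "P (S g) x = U g x"
      using nz by simp
    have "z * Q (S g) x = \<alpha> * Q (U g) x + \<beta> * V g x - Q g x"
      unfolding S_def[abs_def] using nz QV
      by (simp only: lin[OF Q] cl g) (simp add: distrib_left right_diff_distrib)
    moreover have "(z - \<alpha>) * Q (U g) x = \<beta> * Q (P (V g)) x - Q (P g) x"
      unfolding U_def[abs_def] using nz
      by (simp only: lin[OF Q] cl g) (simp add: distrib_left right_diff_distrib)
    moreover have "(z - \<alpha>) * (\<alpha> * a + b - d) = \<alpha> * ((z - \<alpha>) * a) + (z - \<alpha>) * (b - d)"
      for a b d
      by (simp add: algebra_simps)
    ultimately have "(z - \<alpha>) * (z * Q (S g) x)
        = \<alpha> * (\<beta> * Q (P (V g)) x - Q (P g) x) + (z - \<alpha>) * (\<beta> * V g x - Q g x)"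
      by (simp only:)
    also have "\<dots> = (\<alpha> * \<beta> * s + (z - \<alpha>) * \<beta>) * V g x"
      using QPV by (simp add: algebra_simps)
    also have "\<dots> = (z - \<alpha>) * (z * V g x)"
      unfolding s by (simp add: algebra_simps)
    finally have QS: "Q (S g) x = V g x"
      using nz by simp
    have "z * S g x = \<alpha> * U g x + \<beta> * V g x - g x"
      using nz by (simp add: S_def field_simps)
    then show "T (S g) x - z * S g x = g x"
      by (simp add: T_def PS QS)
  qed
  show ?thesis
    unfolding ell2_spectrum_def using S left right by (auto simp: T_def[abs_def])
qed

text \<open>
  The converse of the reduction: for \<open>v\<close> in the range of \<open>Q\<close>, the function
  \<open>f = (\<alpha> \<beta> / (z - \<alpha>)) P v + \<beta> v\<close> satisfies \<open>(T - z) f = c (Q P v - s v)\<close>, and \<open>v\<close> is recovered from \<open>f\<close> by the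
  bounded operator \<open>W\<close>. Hence a lower bound for \<open>T - z\<close> gives one for \<open>Q P - s\<close>.
\<close>

lemma two_projection_lower_bound:
  assumes P: "ell2_bounded_op X P" and Q: "ell2_bounded_op X Q"
    and PP: "\<And>f. f \<in> ell2 X \<Longrightarrow> P (P f) = P f"
    and nz: "\<alpha> \<noteq> 0" "\<beta> \<noteq> 0" "z \<noteq> 0" "z \<noteq> \<alpha>" and s: "\<alpha> * \<beta> * s = (z - \<alpha>) * (z - \<beta>)"
    and z: "z \<notin> ell2_spectrum X (\<lambda>f x. \<alpha> * P f x + \<beta> * Q f x)"
  obtains C where "0 \<le> C"
    and "\<And>v. v \<in> ell2 X \<Longrightarrow> Q v = v \<Longrightarrow> ell2_norm X v \<le> C * ell2_norm X (\<lambda>x. Q (P v) x - s * v x)"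
proof -
  define T where "T f x = \<alpha> * P f x + \<beta> * Q f x" for f x
  define W where "W f x = (1 / \<beta>) * f x - (\<alpha> / (\<beta> * z)) * P f x" for f x
  define c where "c = \<alpha> * \<beta> * \<beta> / (z - \<alpha>)"
  have T: "ell2_bounded_op X T"
    unfolding T_def[abs_def] by (intro bounded_op_plus bounded_op_cmult P Q)
  have W: "ell2_bounded_op X W"
    unfolding W_def[abs_def] by (intro bounded_op_minus bounded_op_cmult bounded_op_id P)
  have "z \<notin> ell2_spectrum X T"
    using z by (simp add: T_def[abs_def])
  then obtain C where C: "0 \<le> C"
    "\<And>f. f \<in> ell2 X \<Longrightarrow> ell2_norm X f \<le> C * ell2_norm X (\<lambda>x. T f x - z * f x)"
    by (rule resolvent_lower_bound[rotated]) (use bounded_op_in[OF T] in blast)+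
  obtain D where D: "0 \<le> D" "\<And>f. f \<in> ell2 X \<Longrightarrow> ell2_norm X (W f) \<le> D * ell2_norm X f"
    by (rule bounded_op_bound[OF W]) blast
  have "ell2_norm X v \<le> (D * C * cmod c) * ell2_norm X (\<lambda>x. Q (P v) x - s * v x)"
    if v: "v \<in> ell2 X" and Qv: "Q v = v" for v
  proof -
    note cl = bounded_op_in[OF P] bounded_op_in[OF Q] ell2_scale(1) ell2_add(1) ell2_diff
    note lin = bounded_op_add bounded_op_scale bounded_op_diff
    define f where "f = (\<lambda>x. (\<alpha> * \<beta> / (z - \<alpha>)) * P v x + \<beta> * v x)"
    have f: "f \<in> ell2 X"
      unfolding f_def by (intro cl v)
    have "P f x = (\<beta> * z / (z - \<alpha>)) * P v x" for x
    proof -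
      have "P f x = (\<alpha> * \<beta> / (z - \<alpha>) + \<beta>) * P v x"
        unfolding f_def by (simp only: lin[OF P] cl v PP distrib_right)
      also have "\<alpha> * \<beta> / (z - \<alpha>) + \<beta> = \<beta> * z / (z - \<alpha>)"
        using nz by (simp add: field_simps)
      finally show ?thesis .
    qed
    note Pf = this
    have Wf: "W f = v"
    proof
      fix x
      have "(1 / \<beta>) * f x = (\<alpha> / (z - \<alpha>)) * P v x + v x"
        using nz by (simp add: f_def distrib_left)
      moreover have "(\<alpha> / (\<beta> * z)) * P f x = (\<alpha> / (z - \<alpha>)) * P v x"
        using nz by (simp add: Pf)
      ultimately show "W f x = v x"
        by (simp add: W_def)
    qed
    have "T f x - z * f x = c * (Q (P v) x - s * v x)" for x
    proof -
      have "(z - \<alpha>) * (T f x - z * f x)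
          = (z - \<alpha>) * \<alpha> * P f x + (z - \<alpha>) * \<beta> * Q f x - (z - \<alpha>) * z * f x"
        by (simp add: T_def algebra_simps)
      also have "(z - \<alpha>) * \<alpha> * P f x = \<alpha> * \<beta> * z * P v x"
        using nz by (simp add: Pf)
      also have "(z - \<alpha>) * \<beta> * Q f x = \<alpha> * \<beta> * \<beta> * Q (P v) x + (z - \<alpha>) * \<beta> * \<beta> * v x"
      proof -
        have "Q f x = (\<alpha> * \<beta> / (z - \<alpha>)) * Q (P v) x + \<beta> * v x"
          unfolding f_def by (simp only: lin[OF Q] cl v Qv)
        then show ?thesis
          using nz by (simp add: distrib_left)
      qed
      also have "(z - \<alpha>) * z * f x = \<alpha> * \<beta> * z * P v x + (z - \<alpha>) * \<beta> * z * v x"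
        using nz by (simp add: f_def distrib_left)
      also have "\<alpha> * \<beta> * z * P v x + (\<alpha> * \<beta> * \<beta> * Q (P v) x + (z - \<alpha>) * \<beta> * \<beta> * v x)
            - (\<alpha> * \<beta> * z * P v x + (z - \<alpha>) * \<beta> * z * v x)
          = \<beta> * (\<alpha> * \<beta> * Q (P v) x - (z - \<alpha>) * (z - \<beta>) * v x)"
        by (simp add: algebra_simps)
      also have "\<dots> = (z - \<alpha>) * (c * (Q (P v) x - s * v x))"
      proof -
        have "(z - \<alpha>) * c = \<alpha> * \<beta> * \<beta>"
          using nz by (simp add: c_def)
        then show ?thesis
          unfolding s[symmetric] mult.assoc[of "z - \<alpha>", symmetric] by (simp add: algebra_simps)
      qed
      finally show ?thesis
        using nz by simp
    qed
    then have Tf: "(\<lambda>x. T f x - z * f x) = (\<lambda>x. c * (Q (P v) x - s * v x))"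
      by (rule ext)
    have "ell2_norm X v \<le> D * ell2_norm X f"
      using D(2)[OF f] by (simp add: Wf)
    also have "\<dots> \<le> D * (C * ell2_norm X (\<lambda>x. T f x - z * f x))"
      by (intro mult_left_mono C f D)
    also have "ell2_norm X (\<lambda>x. T f x - z * f x)
        = cmod c * ell2_norm X (\<lambda>x. Q (P v) x - s * v x)"
      unfolding Tf by (intro ell2_scale cl v)
    finally show ?thesis
      by (simp add: mult.assoc)
  qed
  then show thesis
    using C(1) D(1) by (intro that[of "D * C * cmod c"]) auto
qed

section \<open>Convolution operators on a group\<close>

lemma has_sum_finite_sum:
  fixes f :: "'i \<Rightarrow> 'x \<Rightarrow> 'b::{topological_comm_monoid_add, t2_space}"
  assumes "finite A" and "\<And>i. i \<in> A \<Longrightarrow> (f i has_sum l i) X"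
  shows "((\<lambda>x. \<Sum>i\<in>A. f i x) has_sum (\<Sum>i\<in>A. l i)) X"
  using assms by (induction A rule: finite_induct) (auto intro: has_sum_add)

lemma
  fixes f :: "'i \<Rightarrow> 'x \<Rightarrow> 'b::{topological_comm_monoid_add, t2_space}"
  assumes "finite A" and "\<And>i. i \<in> A \<Longrightarrow> f i summable_on X"
  shows summable_on_finite_sum: "(\<lambda>x. \<Sum>i\<in>A. f i x) summable_on X"
    and infsum_finite_sum: "(\<Sum>\<^sub>\<infinity>x\<in>X. \<Sum>i\<in>A. f i x) = (\<Sum>i\<in>A. \<Sum>\<^sub>\<infinity>x\<in>X. f i x)"
  using has_sum_finite_sum[OF assms(1) has_sum_infsum[OF assms(2)]]
  by (auto simp: has_sum_iff)

text \<open>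
  For a finite subgroup \<open>A\<close>, the orthogonal projection onto the functions that are constant on the cosets
  \<open>x A\<close>.
\<close>

definition coset_average ::
  "('g, 'm) monoid_scheme \<Rightarrow> 'g set \<Rightarrow> ('g \<Rightarrow> complex) \<Rightarrow> 'g \<Rightarrow> complex" where
  "coset_average G A f x =
     (if x \<in> carrier G then (\<Sum>u\<in>A. f (x \<otimes>\<^bsub>G\<^esub> u)) / of_nat (card A) else 0)"

text \<open>
  The kernel \<open>k (inv x \<otimes> y)\<close> is invariant under left translations, so \<open>kernel_op\<close> is a convolution from the right;
  the coset averages are further examples of such operators.
\<close>

definition kernel_op ::
  "('g, 'm) monoid_scheme \<Rightarrow> ('g \<Rightarrow> complex) \<Rightarrow> ('g \<Rightarrow> complex) \<Rightarrow> 'g \<Rightarrow> complex" where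
  "kernel_op G k f x =
     (if x \<in> carrier G then \<Sum>\<^sub>\<infinity>y\<in>carrier G. k (inv\<^bsub>G\<^esub> x \<otimes>\<^bsub>G\<^esub> y) * f y else 0)"

definition admissible_kernel :: "('g, 'm) monoid_scheme \<Rightarrow> ('g \<Rightarrow> complex) \<Rightarrow> bool" where
  "admissible_kernel G k \<longleftrightarrow>
     (\<forall>f\<in>ell2 (carrier G). \<forall>x\<in>carrier G. (\<lambda>y. k (inv\<^bsub>G\<^esub> x \<otimes>\<^bsub>G\<^esub> y) * f y) summable_on carrier G)"

lemma admissible_kernelD:
  "admissible_kernel G k \<Longrightarrow> f \<in> ell2 (carrier G) \<Longrightarrow> x \<in> carrier G \<Longrightarrow>
    (\<lambda>y. k (inv\<^bsub>G\<^esub> x \<otimes>\<^bsub>G\<^esub> y) * f y) summable_on carrier G"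
  by (simp add: admissible_kernel_def)

context group
begin

lemma bij_betw_right_mult: "u \<in> carrier G \<Longrightarrow> bij_betw (\<lambda>x. x \<otimes> u) (carrier G) (carrier G)"
  by (rule bij_betw_byWitness[where f' = "\<lambda>x. x \<otimes> inv u"]) (auto simp: m_assoc)

lemma subgroup_sum_shift:
  assumes A: "subgroup A G" and a: "a \<in> A"
  shows "(\<Sum>u\<in>A. \<phi> (a \<otimes> u)) = (\<Sum>u\<in>A. \<phi> u)"
proof (rule sum.reindex_bij_witness[where i = "\<lambda>u. inv a \<otimes> u" and j = "\<lambda>u. a \<otimes> u"])
qed (use a subgroup.mem_carrier[OF A] subgroup.m_closed[OF A] subgroup.m_inv_closed[OF A]
    in \<open>auto simp: m_assoc[symmetric]\<close>)

lemma subgroup_sum_shift_right: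
  assumes A: "subgroup A G" and a: "a \<in> A"
  shows "(\<Sum>u\<in>A. \<phi> (u \<otimes> a)) = (\<Sum>u\<in>A. \<phi> u)"
proof (rule sum.reindex_bij_witness[where i = "\<lambda>u. u \<otimes> inv a" and j = "\<lambda>u. u \<otimes> a"])
qed (use a subgroup.mem_carrier[OF A] subgroup.m_closed[OF A] subgroup.m_inv_closed[OF A]
    in \<open>auto simp: m_assoc\<close>)

lemma subgroup_sum_inv:
  assumes A: "subgroup A G"
  shows "(\<Sum>u\<in>A. \<phi> (inv u)) = (\<Sum>u\<in>A. \<phi> u)"
proof (rule sum.reindex_bij_witness[where i = "\<lambda>u. inv u" and j = "\<lambda>u. inv u"])
qed (use subgroup.mem_carrier[OF A] subgroup.m_inv_closed[OF A] in auto)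

lemma translation_bounded_op:
  assumes u: "u \<in> carrier G"
  shows "ell2_bounded_op (carrier G) (\<lambda>f x. if x \<in> carrier G then f (x \<otimes> u) else 0)"
proof -
  have sq: "(cmod (if x \<in> carrier G then f (x \<otimes> u) else 0))\<^sup>2 = (cmod (f (x \<otimes> u)))\<^sup>2"
    if "x \<in> carrier G" for f :: "'a \<Rightarrow> complex" and x
    using that by simp
  have "(\<lambda>x. if x \<in> carrier G then f (x \<otimes> u) else 0) \<in> ell2 (carrier G)"
    if f: "f \<in> ell2 (carrier G)" for f
    using f summable_on_reindex_bij_betw[OF bij_betw_right_mult[OF u], of "\<lambda>x. (cmod (f x))\<^sup>2"]
    by (auto simp: ell2_def sq cong: summable_on_cong)
  moreover have "ell2_norm (carrier G) (\<lambda>x. if x \<in> carrier G then f (x \<otimes> u) else 0)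
      = ell2_norm (carrier G) f" for f
    using infsum_reindex_bij_betw[OF bij_betw_right_mult[OF u], of "\<lambda>x. (cmod (f x))\<^sup>2"]
    by (simp add: ell2_norm_def sq cong: infsum_cong)
  ultimately show ?thesis
    by (intro bounded_opI[where C = 1]) auto
qed

lemma coset_average_bounded_op:
  assumes "finite A" and "A \<subseteq> carrier G"
  shows "ell2_bounded_op (carrier G) (coset_average G A)"
proof -
  have "coset_average G A =
      (\<lambda>f x. (1 / of_nat (card A)) * (\<Sum>u\<in>A. if x \<in> carrier G then f (x \<otimes> u) else 0))"
    by (auto simp: coset_average_def fun_eq_iff)
  moreover have "ell2_bounded_op (carrier G) \<dots>"
    using assms by (intro bounded_op_cmult bounded_op_sum translation_bounded_op) auto
  ultimately show ?thesis
    by simp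
qed

lemma coset_average_idem:
  assumes A: "subgroup A G" and fin: "finite A"
  shows "coset_average G A (coset_average G A f) = coset_average G A f"
proof
  fix x
  show "coset_average G A (coset_average G A f) x = coset_average G A f x"
  proof (cases "x \<in> carrier G")
    case True
    have card: "of_nat (card A) \<noteq> (0 :: complex)"
      using subgroup.one_closed[OF A] fin by auto
    have "(\<Sum>v\<in>A. f (x \<otimes> u \<otimes> v)) = (\<Sum>v\<in>A. f (x \<otimes> v))" if "u \<in> A" for u
      using subgroup_sum_shift[OF A that, of "\<lambda>v. f (x \<otimes> v)"] True that subgroup.mem_carrier[OF A]
      by (simp add: m_assoc)
    then have "coset_average G A f (x \<otimes> u) = coset_average G A f x" if "u \<in> A" for u
      using True that subgroup.mem_carrier[OF A] by (simp add: coset_average_def)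
    then have "(\<Sum>u\<in>A. coset_average G A f (x \<otimes> u)) = of_nat (card A) * coset_average G A f x"
      by simp
    then show ?thesis
      using True card by (simp add: coset_average_def[of _ _ "coset_average G A f"])
  qed (simp add: coset_average_def)
qed

lemma admissible_left_average:
  assumes k: "admissible_kernel G k" and A: "finite A" "A \<subseteq> carrier G"
  shows "admissible_kernel G (\<lambda>w. (\<Sum>u\<in>A. k (u \<otimes> w)) / of_nat (card A))"
  unfolding admissible_kernel_def
proof (intro ballI)
  fix f x assume f: "f \<in> ell2 (carrier G)" and x: "x \<in> carrier G"
  have "(\<lambda>y. k (u \<otimes> (inv x \<otimes> y)) * f y) summable_on carrier G" if u: "u \<in> A" for u
  proof -
    have "x \<otimes> inv u \<in> carrier G" using u A x by auto
    then have sm: "(\<lambda>y. k (inv (x \<otimes> inv u) \<otimes> y) * f y) summable_on carrier G"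
      by (rule admissible_kernelD[OF k f])
    have eq: "k (inv (x \<otimes> inv u) \<otimes> y) * f y = k (u \<otimes> (inv x \<otimes> y)) * f y"
      if "y \<in> carrier G" for y
      using u A x that by (auto simp: inv_mult_group m_assoc subset_iff)
    show ?thesis
      using sm by (rule summable_on_cong[THEN iffD1, rotated]) (rule eq)
  qed
  then have "(\<lambda>y. (\<Sum>u\<in>A. k (u \<otimes> (inv x \<otimes> y)) * f y) * (1 / of_nat (card A)))
      summable_on carrier G"
    using A by (intro summable_on_cmult_left summable_on_finite_sum) auto
  then show "(\<lambda>y. (\<Sum>u\<in>A. k (u \<otimes> (inv x \<otimes> y))) / of_nat (card A) * f y) summable_on carrier G"
    by (simp add: sum_distrib_right sum_divide_distrib)
qed

text \<open>
  Composing a convolution with a coset average averages the kernel: on the left of its argument if the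
  average is applied last, and on the right if it is applied first.
\<close>

lemma coset_average_kernel_op:
  assumes k: "admissible_kernel G k" and A: "subgroup A G" and fin: "finite A"
    and f: "f \<in> ell2 (carrier G)"
  shows "coset_average G A (kernel_op G k f)
           = kernel_op G (\<lambda>w. (\<Sum>u\<in>A. k (u \<otimes> w)) / of_nat (card A)) f"
proof
  fix x
  show "coset_average G A (kernel_op G k f) x
      = kernel_op G (\<lambda>w. (\<Sum>u\<in>A. k (u \<otimes> w)) / of_nat (card A)) f x"
  proof (cases "x \<in> carrier G")
    case x: True
    note mem = subgroup.mem_carrier[OF A]
    have sm: "(\<lambda>y. k (inv (x \<otimes> u) \<otimes> y) * f y) summable_on carrier G" if "u \<in> A" for u
      using k f x mem[OF that] unfolding admissible_kernel_def by auto
    have "(\<Sum>u\<in>A. kernel_op G k f (x \<otimes> u))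
        = (\<Sum>u\<in>A. \<Sum>\<^sub>\<infinity>y\<in>carrier G. k (inv (x \<otimes> u) \<otimes> y) * f y)"
      using x mem by (simp add: kernel_op_def)
    also have "\<dots> = (\<Sum>\<^sub>\<infinity>y\<in>carrier G. \<Sum>u\<in>A. k (inv (x \<otimes> u) \<otimes> y) * f y)"
      using sm fin by (intro infsum_finite_sum[symmetric]) auto
    also have "\<dots> = (\<Sum>\<^sub>\<infinity>y\<in>carrier G. (\<Sum>u\<in>A. k (u \<otimes> (inv x \<otimes> y))) * f y)"
    proof (rule infsum_cong)
      fix y assume y: "y \<in> carrier G"
      have "(\<Sum>u\<in>A. k (inv (x \<otimes> u) \<otimes> y) * f y) = (\<Sum>u\<in>A. k (inv u \<otimes> (inv x \<otimes> y))) * f y"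
        using x y mem by (simp add: inv_mult_group m_assoc sum_distrib_right)
      also have "(\<Sum>u\<in>A. k (inv u \<otimes> (inv x \<otimes> y))) = (\<Sum>u\<in>A. k (u \<otimes> (inv x \<otimes> y)))"
        using subgroup_sum_inv[OF A, of "\<lambda>u. k (u \<otimes> (inv x \<otimes> y))"] .
      finally show "(\<Sum>u\<in>A. k (inv (x \<otimes> u) \<otimes> y) * f y) = (\<Sum>u\<in>A. k (u \<otimes> (inv x \<otimes> y))) * f y" .
    qed
    finally have "coset_average G A (kernel_op G k f) x
        = (1 / of_nat (card A)) * (\<Sum>\<^sub>\<infinity>y\<in>carrier G. (\<Sum>u\<in>A. k (u \<otimes> (inv x \<otimes> y))) * f y)"
      using x by (simp add: coset_average_def)
    also have "\<dots> = kernel_op G (\<lambda>w. (\<Sum>u\<in>A. k (u \<otimes> w)) / of_nat (card A)) f x"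
      using x unfolding infsum_cmult_right'[symmetric] by (simp add: kernel_op_def)
    finally show ?thesis .
  qed (simp add: coset_average_def kernel_op_def)
qed

lemma kernel_op_coset_average:
  assumes k: "admissible_kernel G k" and A: "finite A" "A \<subseteq> carrier G"
    and f: "f \<in> ell2 (carrier G)"
  shows "kernel_op G k (coset_average G A f)
           = kernel_op G (\<lambda>w. (\<Sum>u\<in>A. k (w \<otimes> inv u)) / of_nat (card A)) f"
proof
  fix x
  show "kernel_op G k (coset_average G A f) x
      = kernel_op G (\<lambda>w. (\<Sum>u\<in>A. k (w \<otimes> inv u)) / of_nat (card A)) f x"
  proof (cases "x \<in> carrier G")
    case x: True
    have sm: "(\<lambda>y. k (inv x \<otimes> y) * f (y \<otimes> u)) summable_on carrier G" if "u \<in> A" for u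
    proof -
      have "u \<in> carrier G" using that A by auto
      then have "(\<lambda>y. k (inv x \<otimes> y) * (if y \<in> carrier G then f (y \<otimes> u) else 0)) summable_on carrier G"
        by (intro admissible_kernelD[OF k _ x] bounded_op_in[OF translation_bounded_op f])
      then show ?thesis
        by (simp cong: summable_on_cong)
    qed
    have "(\<Sum>\<^sub>\<infinity>y\<in>carrier G. \<Sum>u\<in>A. k (inv x \<otimes> y) * f (y \<otimes> u))
        = (\<Sum>u\<in>A. \<Sum>\<^sub>\<infinity>y\<in>carrier G. k (inv x \<otimes> y) * f (y \<otimes> u))"
      using sm A by (intro infsum_finite_sum) auto
    also have "\<dots> = (\<Sum>u\<in>A. \<Sum>\<^sub>\<infinity>y\<in>carrier G. k (inv x \<otimes> y \<otimes> inv u) * f y)"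
    proof (rule sum.cong)
      fix u assume "u \<in> A"
      then have u: "u \<in> carrier G" using A by auto
      have "(\<Sum>\<^sub>\<infinity>y\<in>carrier G. k (inv x \<otimes> y) * f (y \<otimes> u))
          = (\<Sum>\<^sub>\<infinity>y\<in>carrier G. k (inv x \<otimes> (y \<otimes> u) \<otimes> inv u) * f (y \<otimes> u))"
        using x u by (intro infsum_cong) (simp add: m_assoc)
      also have "\<dots> = (\<Sum>\<^sub>\<infinity>y\<in>carrier G. k (inv x \<otimes> y \<otimes> inv u) * f y)"
        by (rule infsum_reindex_bij_betw[OF bij_betw_right_mult[OF u],
              where f = "\<lambda>y. k (inv x \<otimes> y \<otimes> inv u) * f y"])
      finally show "(\<Sum>\<^sub>\<infinity>y\<in>carrier G. k (inv x \<otimes> y) * f (y \<otimes> u))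
          = (\<Sum>\<^sub>\<infinity>y\<in>carrier G. k (inv x \<otimes> y \<otimes> inv u) * f y)" .
    qed simp
    also have "\<dots> = (\<Sum>\<^sub>\<infinity>y\<in>carrier G. \<Sum>u\<in>A. k (inv x \<otimes> y \<otimes> inv u) * f y)"
    proof (rule infsum_finite_sum[symmetric])
      fix u assume uA: "u \<in> A"
      then have u: "u \<in> carrier G" using A by auto
      have "(\<lambda>y. k (inv x \<otimes> (y \<otimes> u) \<otimes> inv u) * f (y \<otimes> u)) summable_on carrier G"
        using sm[OF uA] x u by (simp add: m_assoc cong: summable_on_cong)
      then show "(\<lambda>y. k (inv x \<otimes> y \<otimes> inv u) * f y) summable_on carrier G"
        using summable_on_reindex_bij_betw[OF bij_betw_right_mult[OF u],
            where f = "\<lambda>y. k (inv x \<otimes> y \<otimes> inv u) * f y"] by simp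
    qed (use A in simp)
    finally have *: "(\<Sum>\<^sub>\<infinity>y\<in>carrier G. \<Sum>u\<in>A. k (inv x \<otimes> y) * f (y \<otimes> u))
        = (\<Sum>\<^sub>\<infinity>y\<in>carrier G. \<Sum>u\<in>A. k (inv x \<otimes> y \<otimes> inv u) * f y)" .
    have "kernel_op G k (coset_average G A f) x
        = (\<Sum>\<^sub>\<infinity>y\<in>carrier G. (1 / of_nat (card A)) * (\<Sum>u\<in>A. k (inv x \<otimes> y) * f (y \<otimes> u)))"
      using x by (simp add: kernel_op_def coset_average_def sum_distrib_left sum_divide_distrib cong: infsum_cong)
    also have "\<dots> = (\<Sum>\<^sub>\<infinity>y\<in>carrier G.
        (1 / of_nat (card A)) * (\<Sum>u\<in>A. k (inv x \<otimes> y \<otimes> inv u) * f y))"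
      by (simp only: infsum_cmult_right' *)
    also have "\<dots> = kernel_op G (\<lambda>w. (\<Sum>u\<in>A. k (w \<otimes> inv u)) / of_nat (card A)) f x"
      using x by (simp add: kernel_op_def sum_distrib_right)
    finally show ?thesis .
  qed (simp add: kernel_op_def)
qed

lemma admissible_right_average:
  assumes k: "admissible_kernel G k" and A: "finite A" "A \<subseteq> carrier G"
  shows "admissible_kernel G (\<lambda>w. (\<Sum>u\<in>A. k (w \<otimes> inv u)) / of_nat (card A))"
  unfolding admissible_kernel_def
proof (intro ballI)
  fix f x assume f: "f \<in> ell2 (carrier G)" and x: "x \<in> carrier G"
  have "(\<lambda>y. k (inv x \<otimes> y \<otimes> inv u) * f y) summable_on carrier G" if "u \<in> A" for u
  proof -
    have u: "u \<in> carrier G" using that A by auto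
    then have "(\<lambda>y. k (inv x \<otimes> y) * (if y \<in> carrier G then f (y \<otimes> u) else 0)) summable_on carrier G"
      by (intro admissible_kernelD[OF k _ x] bounded_op_in[OF translation_bounded_op f])
    then have "(\<lambda>y. k (inv x \<otimes> (y \<otimes> u) \<otimes> inv u) * f (y \<otimes> u)) summable_on carrier G"
      using x u by (simp add: m_assoc cong: summable_on_cong)
    then show ?thesis
      using summable_on_reindex_bij_betw[OF bij_betw_right_mult[OF u],
          where f = "\<lambda>y. k (inv x \<otimes> y \<otimes> inv u) * f y"] by simp
  qed
  then have "(\<lambda>y. (\<Sum>u\<in>A. k (inv x \<otimes> y \<otimes> inv u) * f y) * (1 / of_nat (card A)))
      summable_on carrier G"
    using A by (intro summable_on_cmult_left summable_on_finite_sum) auto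
  then show "(\<lambda>y. (\<Sum>u\<in>A. k (inv x \<otimes> y \<otimes> inv u)) / of_nat (card A) * f y) summable_on carrier G"
    by (simp add: sum_distrib_right sum_divide_distrib)
qed

lemma kernel_op_cong:
  assumes "\<And>w. w \<in> carrier G \<Longrightarrow> k w = k' w"
  shows "kernel_op G k f = kernel_op G k' f"
  using assms by (auto simp: kernel_op_def fun_eq_iff intro!: infsum_cong)

text \<open>
  The indicator function of \<open>A\<close> is the kernel of \<open>card A\<close> times the coset average.
\<close>

lemma kernel_op_add_indicator:
  assumes k: "admissible_kernel G k" and A: "subgroup A G" and fin: "finite A"
    and f: "f \<in> ell2 (carrier G)"
  shows "kernel_op G (\<lambda>w. s * k w + c * of_bool (w \<in> A)) f
           = (\<lambda>x. s * kernel_op G k f x + c * of_nat (card A) * coset_average G A f x)"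
proof
  fix x
  show "kernel_op G (\<lambda>w. s * k w + c * of_bool (w \<in> A)) f x
      = s * kernel_op G k f x + c * of_nat (card A) * coset_average G A f x"
  proof (cases "x \<in> carrier G")
    case x: True
    note mem = subgroup.mem_carrier[OF A]
    have card: "of_nat (card A) \<noteq> (0 :: complex)"
      using subgroup.one_closed[OF A] fin by auto
    have inj: "inj_on (\<lambda>u. x \<otimes> u) A"
      using x mem by (auto intro!: inj_onI)
    have coset: "(\<lambda>u. x \<otimes> u) ` A \<subseteq> carrier G"
      using x mem by auto
    have ind: "y \<in> (\<lambda>u. x \<otimes> u) ` A \<longleftrightarrow> inv x \<otimes> y \<in> A" if y: "y \<in> carrier G" for y
    proof
      assume "inv x \<otimes> y \<in> A"
      moreover have "y = x \<otimes> (inv x \<otimes> y)"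
        using x y by (simp add: m_assoc[symmetric])
      ultimately show "y \<in> (\<lambda>u. x \<otimes> u) ` A" by blast
    qed (use x mem in \<open>auto simp: m_assoc[symmetric]\<close>)
    have neutral: "(\<Sum>\<^sub>\<infinity>y\<in>carrier G. of_bool (inv x \<otimes> y \<in> A) * f y)
        = (\<Sum>\<^sub>\<infinity>y\<in>(\<lambda>u. x \<otimes> u) ` A. f y)"
      using coset ind by (intro infsum_cong_neutral) auto
    also have "\<dots> = (\<Sum>u\<in>A. f (x \<otimes> u))"
      using fin by (simp add: sum.reindex[OF inj] o_def)
    also have "\<dots> = of_nat (card A) * coset_average G A f x"
      using x card by (simp add: coset_average_def)
    finally have ind_sum: "(\<Sum>\<^sub>\<infinity>y\<in>carrier G. of_bool (inv x \<otimes> y \<in> A) * f y)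
        = of_nat (card A) * coset_average G A f x" .
    have "(\<lambda>y. of_bool (inv x \<otimes> y \<in> A) * f y) summable_on carrier G \<longleftrightarrow>
        f summable_on (\<lambda>u. x \<otimes> u) ` A"
      using coset ind by (intro summable_on_cong_neutral) auto
    with fin have sm: "(\<lambda>y. of_bool (inv x \<otimes> y \<in> A) * f y) summable_on carrier G"
      by simp
    have "(\<Sum>\<^sub>\<infinity>y\<in>carrier G. s * (k (inv x \<otimes> y) * f y) + c * (of_bool (inv x \<otimes> y \<in> A) * f y))
        = s * (\<Sum>\<^sub>\<infinity>y\<in>carrier G. k (inv x \<otimes> y) * f y)
          + c * (\<Sum>\<^sub>\<infinity>y\<in>carrier G. of_bool (inv x \<otimes> y \<in> A) * f y)"
      using k f x sm unfolding admissible_kernel_def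
      by (subst infsum_add) (auto simp: infsum_cmult_right' intro!: summable_on_cmult_right)
    moreover have "kernel_op G (\<lambda>w. s * k w + c * of_bool (w \<in> A)) f x
        = (\<Sum>\<^sub>\<infinity>y\<in>carrier G. s * (k (inv x \<otimes> y) * f y) + c * (of_bool (inv x \<otimes> y \<in> A) * f y))"
      using x by (simp add: kernel_op_def distrib_right mult.assoc)
    ultimately show ?thesis
      using x by (simp only: ind_sum) (simp add: kernel_op_def)
  qed (simp add: kernel_op_def coset_average_def)
qed

text \<open>
  Operator identities from identities between kernels. A kernel that is invariant under \<open>B\<close> on both sides
  and satisfies the averaged equation \<open>eq\<close> convolves to an operator that, up to a scalar, inverts
  \<open>Q P Q - s\<close> on the range of \<open>Q\<close>, with \<open>P\<close> and \<open>Q\<close> the averages over \<open>A\<close> and \<open>B\<close>. Since \<open>k\<close> is symmetric,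
  invariance and the equation are only required on the left.
\<close>

lemma kernel_op_two_projections:
  assumes A: "subgroup A G" "finite A" and B: "subgroup B G" "finite B"
    and k: "admissible_kernel G k" and sym: "\<And>w. w \<in> carrier G \<Longrightarrow> k (inv w) = k w"
    and inv: "\<And>b w. b \<in> B \<Longrightarrow> w \<in> carrier G \<Longrightarrow> k (b \<otimes> w) = k w"
    and eq: "\<And>w. w \<in> carrier G \<Longrightarrow> (\<Sum>b\<in>B. \<Sum>a\<in>A. k (a \<otimes> (b \<otimes> w)))
               = of_nat (card A) * of_nat (card B) * (s * k w + c * of_bool (w \<in> B))"
    and f: "f \<in> ell2 (carrier G)"
  shows "coset_average G B (kernel_op G k f) = kernel_op G k f"
    and "kernel_op G k (coset_average G B f) = kernel_op G k f"
    and "coset_average G B (coset_average G A (kernel_op G k f))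
           = (\<lambda>x. s * kernel_op G k f x + c * of_nat (card B) * coset_average G B f x)"
    and "kernel_op G k (coset_average G A (coset_average G B f))
           = (\<lambda>x. s * kernel_op G k f x + c * of_nat (card B) * coset_average G B f x)"
proof -
  note memA = subgroup.mem_carrier[OF A(1)] and memB = subgroup.mem_carrier[OF B(1)]
  have subA: "A \<subseteq> carrier G" and subB: "B \<subseteq> carrier G"
    using memA memB by auto
  have cardA: "of_nat (card A) \<noteq> (0 :: complex)"
    using subgroup.one_closed[OF A(1)] A(2) by auto
  have cardB: "of_nat (card B) \<noteq> (0 :: complex)"
    using subgroup.one_closed[OF B(1)] B(2) by auto
  have inv_right: "k (w \<otimes> inv b) = k w" if "b \<in> B" "w \<in> carrier G" for b w
    using sym[of "w \<otimes> inv b"] sym[of w] inv[of b "inv w"] that memB by (simp add: inv_mult_group)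
  show "coset_average G B (kernel_op G k f) = kernel_op G k f"
    unfolding coset_average_kernel_op[OF k B f] using cardB by (intro kernel_op_cong) (simp add: inv)
  show "kernel_op G k (coset_average G B f) = kernel_op G k f"
    unfolding kernel_op_coset_average[OF k B(2) subB f] using cardB
    by (intro kernel_op_cong) (simp add: inv_right)
  show "coset_average G B (coset_average G A (kernel_op G k f))
      = (\<lambda>x. s * kernel_op G k f x + c * of_nat (card B) * coset_average G B f x)"
    unfolding coset_average_kernel_op[OF k A f] kernel_op_add_indicator[OF k B f, symmetric]
      coset_average_kernel_op[OF admissible_left_average[OF k A(2) subA] B f]
    using cardA cardB by (intro kernel_op_cong) (simp add: eq flip: sum_divide_distrib)
  have eq_right: "(\<Sum>b\<in>B. \<Sum>a\<in>A. k (w \<otimes> inv b \<otimes> inv a))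
      = of_nat (card A) * of_nat (card B) * (s * k w + c * of_bool (w \<in> B))"
    if w: "w \<in> carrier G" for w
  proof -
    have "(\<Sum>b\<in>B. \<Sum>a\<in>A. k (w \<otimes> inv b \<otimes> inv a)) = (\<Sum>b\<in>B. \<Sum>a\<in>A. k (a \<otimes> (b \<otimes> inv w)))"
    proof (intro sum.cong refl)
      fix a b assume "a \<in> A" "b \<in> B"
      then show "k (w \<otimes> inv b \<otimes> inv a) = k (a \<otimes> (b \<otimes> inv w))"
        using sym[of "w \<otimes> inv b \<otimes> inv a"] w memA memB by (simp add: inv_mult_group)
    qed
    moreover have "inv w \<in> B \<longleftrightarrow> w \<in> B"
      using subgroup.m_inv_closed[OF B(1), of w] subgroup.m_inv_closed[OF B(1), of "inv w"] w by auto
    ultimately show ?thesis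
      using w by (simp add: eq sym)
  qed
  show "kernel_op G k (coset_average G A (coset_average G B f))
      = (\<lambda>x. s * kernel_op G k f x + c * of_nat (card B) * coset_average G B f x)"
    unfolding kernel_op_coset_average[OF k A(2) subA
        bounded_op_in[OF coset_average_bounded_op[OF B(2) subB] f]]
      kernel_op_coset_average[OF admissible_right_average[OF k A(2) subA] B(2) subB f]
      kernel_op_add_indicator[OF k B f, symmetric]
    using cardA cardB by (intro kernel_op_cong) (simp add: eq_right flip: sum_divide_distrib)
qed

end

section \<open>Reduced words in the free product\<close>

text \<open>
  Both factors are treated at once by a Boolean parameter: \<open>True\<close> stands for the letters of the first group
  (those with \<open>isl\<close>) and \<open>False\<close> for those of the second. A weight assigns a number to each of the two types and
  is multiplied over the letters of a word, so that for the weight \<open>(\<rho>, 1)\<close> it is \<open>\<rho>\<close> to the number of letters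
  from the first group.
\<close>

definition word_weight :: "(bool \<Rightarrow> 'k::comm_monoid_mult) \<Rightarrow> ('a + 'b) list \<Rightarrow> 'k" where
  "word_weight t w = prod_list (map (\<lambda>s. t (isl s)) w)"

lemma word_weight_simps [simp]:
  "word_weight t [] = 1"
  "word_weight t (s # w) = t (isl s) * word_weight t w"
  "word_weight t (v @ w) = word_weight t v * word_weight t w"
  by (simp_all add: word_weight_def)

lemma word_weight_mult: "word_weight (\<lambda>c. r c * t c) w = word_weight r w * word_weight t w"
  by (induction w) (auto simp: ac_simps)

lemma word_weight_nonneg: "(\<And>c. 0 \<le> t c) \<Longrightarrow> 0 \<le> (word_weight t w :: real)"
  by (induction w) auto

lemma word_weight_pos: "(\<And>c. 0 < t c) \<Longrightarrow> 0 < (word_weight t w :: real)"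
  by (induction w) auto

lemma cmod_word_weight: "cmod (word_weight t w) = word_weight (\<lambda>c. cmod (t c)) w"
  by (induction w) (auto simp: norm_mult)

lemma word_weight_rev_pattern:
  fixes v w :: "('a + 'b) list"
  assumes "map isl v = rev (map isl w)"
  shows "word_weight t v = word_weight t w"
proof -
  have *: "word_weight t u = prod_list (map t (map isl u))" for u :: "('a + 'b) list"
    by (simp add: word_weight_def o_def)
  have "prod_list (rev xs) = prod_list xs" for xs :: "'k::comm_monoid_mult list"
    by (induction xs) (auto simp: ac_simps)
  then show ?thesis
    unfolding * assms by (simp only: rev_map[symmetric])
qed

locale finite_free_product = G: group G + H: group H
  for G :: "('a, 'c) monoid_scheme" (structure) and H :: "('b, 'd) monoid_scheme" +
  assumes finite_G: "finite (carrier G)" and finite_H: "finite (carrier H)"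
begin

abbreviation B where "B \<equiv> free_product G H"

sublocale B: group B
  by (rule group_free_product[OF G.group_axioms H.group_axioms])

definition letters :: "bool \<Rightarrow> ('a + 'b) set" where
  "letters c = (if c then Inl ` (carrier G - {\<one>\<^bsub>G\<^esub>}) else Inr ` (carrier H - {\<one>\<^bsub>H\<^esub>}))"

text \<open>
  Since the letters of a reduced word alternate, \<open>headed (\<not> c) w\<close> says that a letter of type \<open>c\<close> can be put
  in front of \<open>w\<close> without cancellation. The empty word is headed by both types.
\<close>

definition headed :: "bool \<Rightarrow> ('a + 'b) list \<Rightarrow> bool" where
  "headed c w \<longleftrightarrow> w = [] \<or> isl (hd w) = c"

abbreviation deg :: "bool \<Rightarrow> real" where
  "deg c \<equiv> real (card (letters c))"

text \<open>
  The copies of the two groups inside the free product.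
\<close>

definition factor :: "bool \<Rightarrow> ('a + 'b) list set" where
  "factor c = insert [] ((\<lambda>s. [s]) ` letters c)"

text \<open>
  The shortest element of the coset of \<open>w\<close> under left multiplication by \<open>factor c\<close>.
\<close>

definition strip :: "bool \<Rightarrow> ('a + 'b) list \<Rightarrow> ('a + 'b) list" where
  "strip c w = (if w \<noteq> [] \<and> isl (hd w) = c then tl w else w)"

definition words :: "bool \<Rightarrow> nat \<Rightarrow> ('a + 'b) list set" where
  "words c n = {w. fp_word G H w \<and> headed c w \<and> length w \<le> n}"

lemma carrier_B: "w \<in> carrier B \<longleftrightarrow> fp_word G H w"
  by (simp add: free_product_def)

lemma mult_B: "v \<otimes>\<^bsub>B\<^esub> w = foldr (fp_cons G H) v w"
  by (simp add: free_product_def)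

lemma one_B: "\<one>\<^bsub>B\<^esub> = []"
  by (simp add: free_product_def)

lemma isl_letters: "s \<in> letters c \<Longrightarrow> isl s = c"
  by (auto simp: letters_def split: if_splits)

lemma finite_letters: "finite (letters c)"
  using finite_G finite_H by (simp add: letters_def)

lemma headed_Nil [simp]: "headed c []"
  and headed_Cons [simp]: "headed c (s # w) \<longleftrightarrow> isl s = c"
  by (auto simp: headed_def)

lemma word_Cons:
  "fp_word G H (s # w) \<longleftrightarrow> s \<in> letters (isl s) \<and> fp_word G H w \<and> headed (\<not> isl s) w"
proof (cases w)
  case Nil
  then show ?thesis by (cases s) (auto simp: fp_word_Cons letters_def)
next
  case (Cons t v)
  then show ?thesis by (cases s; cases t) (auto simp: fp_word_Cons letters_def)
qed

lemma word_iff: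
  "fp_word G H w \<longleftrightarrow> set w \<subseteq> letters True \<union> letters False \<and> successively (\<noteq>) (map isl w)"
proof -
  have "(carrier G - {\<one>\<^bsub>G\<^esub>}) <+> (carrier H - {\<one>\<^bsub>H\<^esub>}) = letters True \<union> letters False"
    by (auto simp: letters_def)
  then show ?thesis
    by (simp add: fp_word_def successively_map)
qed

lemma cons_letter:
  assumes "s \<in> letters c" and "headed (\<not> c) w"
  shows "fp_cons G H s w = s # w"
proof (cases w)
  case Nil
  with assms show ?thesis
    by (cases s) (auto simp: letters_def fp_inl_def fp_inr_def split: if_splits)
next
  case (Cons t v)
  with assms show ?thesis
    by (cases s; cases t) (auto simp: letters_def fp_inl_def fp_inr_def split: if_splits)
qed

lemma mult_letter:
  assumes "s \<in> letters c" and "headed (\<not> c) w"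
  shows "[s] \<otimes>\<^bsub>B\<^esub> w = s # w"
  using assms by (simp add: mult_B cons_letter)

lemma mult_append: "fp_word G H (u @ v) \<Longrightarrow> u \<otimes>\<^bsub>B\<^esub> v = u @ v"
proof (induction u)
  case (Cons s u)
  then have "s \<in> letters (isl s)" "fp_word G H (u @ v)" "headed (\<not> isl s) (u @ v)"
    by (auto simp: word_Cons)
  with Cons.IH show ?case
    using cons_letter by (simp add: mult_B)
qed (simp add: mult_B)

text \<open>
  The inverse of a reduced word consists of the inverse letters in reverse order; only the pattern of letter
  types is recorded, which is all that weights depend on.
\<close>

lemma inv_word:
  assumes "fp_word G H w"
  shows "fp_word G H (inv\<^bsub>B\<^esub> w)" and "map isl (inv\<^bsub>B\<^esub> w) = rev (map isl w)"
proof -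
  have "\<exists>v. set v \<subseteq> letters True \<union> letters False \<and> map isl v = rev (map isl w)
          \<and> foldr (fp_cons G H) v w = []"
    using assms
  proof (induction w)
    case (Cons s w)
    then obtain v where v: "set v \<subseteq> letters True \<union> letters False"
        "map isl v = rev (map isl w)" "foldr (fp_cons G H) v w = []"
      by (auto simp: word_Cons)
    obtain t where t: "t \<in> letters (isl s)" "fp_cons G H t (s # w) = w"
    proof (cases s)
      case (Inl a)
      with Cons.prems have a: "a \<in> carrier G" "a \<noteq> \<one>\<^bsub>G\<^esub>"
        by (auto simp: fp_word_Cons)
      then show thesis
        using Inl by (intro that[of "Inl (inv\<^bsub>G\<^esub> a)"]) (auto simp: letters_def fp_inl_def)
    next
      case (Inr b)
      with Cons.prems have b: "b \<in> carrier H" "b \<noteq> \<one>\<^bsub>H\<^esub>"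
        by (auto simp: fp_word_Cons)
      then show thesis
        using Inr by (intro that[of "Inr (inv\<^bsub>H\<^esub> b)"]) (auto simp: letters_def fp_inr_def)
    qed
    have "t \<in> letters True \<union> letters False"
      using t(1) by (cases "isl s") auto
    with v t isl_letters[OF t(1)] show ?case
      by (intro exI[of _ "v @ [t]"]) auto
  qed simp
  then obtain v where v: "set v \<subseteq> letters True \<union> letters False"
      "map isl v = rev (map isl w)" "foldr (fp_cons G H) v w = []"
    by blast
  have swap: "(\<lambda>x y :: bool. y \<noteq> x) = (\<noteq>)"
    by auto
  have "successively (\<noteq>) (rev (map isl w)) \<longleftrightarrow> successively (\<noteq>) (map isl w)"
    using arg_cong[OF swap, of "\<lambda>P. successively P (map isl w)"]
    by (rule trans[OF successively_rev])
  then have word: "fp_word G H v"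
    using assms v(1) unfolding word_iff v(2) by blast
  then have "inv\<^bsub>B\<^esub> w = v"
    using assms v(3) by (intro B.inv_equality) (auto simp: carrier_B mult_B one_B)
  with word v(2) show "fp_word G H (inv\<^bsub>B\<^esub> w)" "map isl (inv\<^bsub>B\<^esub> w) = rev (map isl w)"
    by auto
qed

lemma mult_inv_append:
  assumes x: "fp_word G H x" and w: "fp_word G H w" and hd: "headed c x" "headed (\<not> c) w"
  shows "inv\<^bsub>B\<^esub> x \<otimes>\<^bsub>B\<^esub> w = inv\<^bsub>B\<^esub> x @ w"
proof (rule mult_append)
  have rev: "map isl (inv\<^bsub>B\<^esub> x) = rev (map isl x)"
    using x by (rule inv_word)
  have "successively (\<noteq>) (rev (map isl x) @ map isl w)"
  proof (cases "x = [] \<or> w = []")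
    case True
    then show ?thesis
      using inv_word[OF x] w by (auto simp: word_iff)
  next
    case False
    then have "last (rev (map isl x)) \<noteq> hd (map isl w)"
      using hd by (auto simp: headed_def last_rev hd_map)
    then show ?thesis
      using inv_word[OF x] w by (auto simp: word_iff successively_append_iff)
  qed
  then show "fp_word G H (inv\<^bsub>B\<^esub> x @ w)"
    using inv_word(1)[OF x] w by (simp add: word_iff rev)
qed

lemma factor_eq: "factor True = fp_inl G ` carrier G" "factor False = fp_inr H ` carrier H"
  by (auto simp: factor_def letters_def fp_inl_def fp_inr_def image_iff)

lemma subgroup_factor: "subgroup (factor c) B"
proof -
  interpret l: group_hom G B "fp_inl G"
    by unfold_locales (rule fp_inl_hom[OF G.group_axioms H.group_axioms])
  interpret r: group_hom H B "fp_inr H"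
    by unfold_locales (rule fp_inr_hom[OF G.group_axioms H.group_axioms])
  show ?thesis
    using l.img_is_subgroup r.img_is_subgroup by (cases c) (simp_all add: factor_eq)
qed

lemma finite_factor: "finite (factor c)"
  by (simp add: factor_def finite_letters)

lemma sum_factor: "(\<Sum>u\<in>factor c. \<phi> u) = \<phi> [] + (\<Sum>s\<in>letters c. \<phi> [s])"
  unfolding factor_def
  by (subst sum.insert) (auto simp: finite_letters sum.reindex inj_on_def)

lemma card_factor: "card (factor c) = card (letters c) + 1"
  unfolding factor_def
  by (subst card_insert_disjoint) (auto simp: finite_letters card_image inj_on_def)

lemma card_letters: "card (letters True) = order G - 1" "card (letters False) = order H - 1"
  by (auto simp: letters_def order_def card_image inj_on_def)

lemma strip_Nil [simp]: "strip c [] = []"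
  and strip_Cons [simp]: "strip c (s # w) = (if isl s = c then w else s # w)"
  by (auto simp: strip_def)

lemma word_strip:
  assumes "fp_word G H w"
  shows "fp_word G H (strip c w)" and "headed (\<not> c) (strip c w)"
  using assms by (cases w; auto simp: word_Cons)+

lemma strip_eq_mult:
  assumes "fp_word G H w"
  obtains u where "u \<in> factor c" and "w = u \<otimes>\<^bsub>B\<^esub> strip c w"
proof (cases "w \<noteq> [] \<and> isl (hd w) = c")
  case True
  then obtain s v where w: "w = s # v" "isl s = c"
    by (cases w) auto
  with assms have s: "s \<in> letters c" "headed (\<not> c) v"
    by (auto simp: word_Cons)
  then show thesis
    using w mult_letter[OF s] by (intro that[of "[s]"]) (auto simp: factor_def)
next
  case False
  then show thesis
    by (intro that[of "[]"]) (auto simp: factor_def strip_def mult_B)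
qed

text \<open>
  A coset of \<open>factor c\<close> consists of its shortest element and that element preceded by each letter of
  type \<open>c\<close>.
\<close>

lemma coset_sum:
  assumes w: "fp_word G H w"
  shows "(\<Sum>u\<in>factor c. \<phi> (u \<otimes>\<^bsub>B\<^esub> w)) = \<phi> (strip c w) + (\<Sum>s\<in>letters c. \<phi> (s # strip c w))"
proof -
  obtain v where v: "v \<in> factor c" "w = v \<otimes>\<^bsub>B\<^esub> strip c w"
    using w by (rule strip_eq_mult)
  note mem = subgroup.mem_carrier[OF subgroup_factor[of c]]
  have "strip c w \<in> carrier B"
    using word_strip(1)[OF w] by (simp add: carrier_B)
  then have "u \<otimes>\<^bsub>B\<^esub> w = (u \<otimes>\<^bsub>B\<^esub> v) \<otimes>\<^bsub>B\<^esub> strip c w" if "u \<in> factor c" for u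
    using v mem that B.m_assoc by metis
  then have "(\<Sum>u\<in>factor c. \<phi> (u \<otimes>\<^bsub>B\<^esub> w)) = (\<Sum>u\<in>factor c. \<phi> ((u \<otimes>\<^bsub>B\<^esub> v) \<otimes>\<^bsub>B\<^esub> strip c w))"
    by simp
  also have "\<dots> = (\<Sum>u\<in>factor c. \<phi> (u \<otimes>\<^bsub>B\<^esub> strip c w))"
    by (rule B.subgroup_sum_shift_right[OF subgroup_factor v(1)])
  also have "\<dots> = \<phi> (strip c w) + (\<Sum>s\<in>letters c. \<phi> (s # strip c w))"
    using mult_letter[OF _ word_strip(2)[OF w]] by (simp add: sum_factor mult_B[of "[]"])
  finally show ?thesis .
qed

section \<open>Sums of weights over reduced words\<close>

lemma word_weight_inv:
  fixes t :: "bool \<Rightarrow> 'k::comm_monoid_mult"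
  assumes "fp_word G H w"
  shows "word_weight t (inv\<^bsub>B\<^esub> w) = word_weight t w"
  by (intro word_weight_rev_pattern inv_word assms)

lemma word_weight_inv_Nil:
  fixes t :: "bool \<Rightarrow> 'k::comm_monoid_mult"
  assumes "fp_word G H w"
  shows "word_weight t (inv\<^bsub>B\<^esub> w \<otimes>\<^bsub>B\<^esub> []) = word_weight t w"
proof -
  have "inv\<^bsub>B\<^esub> w \<in> carrier B"
    using assms by (simp add: carrier_B inv_word)
  then have "inv\<^bsub>B\<^esub> w \<otimes>\<^bsub>B\<^esub> [] = inv\<^bsub>B\<^esub> w"
    unfolding one_B[symmetric] by (rule B.r_one)
  then show ?thesis
    using assms by (simp add: word_weight_inv)
qed

lemma word_weight_mult_inv:
  fixes t :: "bool \<Rightarrow> 'k::comm_monoid_mult"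
  assumes "fp_word G H x" "fp_word G H w" "headed c x" "headed (\<not> c) w"
  shows "word_weight t (inv\<^bsub>B\<^esub> x \<otimes>\<^bsub>B\<^esub> w) = word_weight t x * word_weight t w"
  unfolding mult_inv_append[OF assms] using assms(1) by (simp add: word_weight_inv)

lemma word_weight_coset_sum:
  fixes t :: "bool \<Rightarrow> 'k::comm_ring_1"
  assumes "fp_word G H w"
  shows "(\<Sum>u\<in>factor c. word_weight t (u \<otimes>\<^bsub>B\<^esub> w))
           = (1 + of_nat (card (letters c)) * t c) * word_weight t (strip c w)"
  unfolding coset_sum[OF assms] by (simp add: isl_letters algebra_simps)

lemma inv_mult_same_letter:
  assumes s: "s \<in> letters c" and y: "fp_word G H y" "headed (\<not> c) y"
    and v: "fp_word G H v" "headed (\<not> c) v"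
  shows "inv\<^bsub>B\<^esub> (s # y) \<otimes>\<^bsub>B\<^esub> (s # v) = inv\<^bsub>B\<^esub> y \<otimes>\<^bsub>B\<^esub> v"
proof -
  have cl: "[s] \<in> carrier B" "y \<in> carrier B" "v \<in> carrier B"
    using s y v isl_letters[OF s] by (auto simp: carrier_B word_Cons)
  have "inv\<^bsub>B\<^esub> (s # y) \<otimes>\<^bsub>B\<^esub> (s # v)
      = inv\<^bsub>B\<^esub> ([s] \<otimes>\<^bsub>B\<^esub> y) \<otimes>\<^bsub>B\<^esub> ([s] \<otimes>\<^bsub>B\<^esub> v)"
    using s y(2) v(2) by (simp only: mult_letter)
  also have "\<dots> = inv\<^bsub>B\<^esub> y \<otimes>\<^bsub>B\<^esub> (inv\<^bsub>B\<^esub> [s] \<otimes>\<^bsub>B\<^esub> ([s] \<otimes>\<^bsub>B\<^esub> v))"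
    using cl by (simp add: B.inv_mult_group B.m_assoc)
  also have "inv\<^bsub>B\<^esub> [s] \<otimes>\<^bsub>B\<^esub> ([s] \<otimes>\<^bsub>B\<^esub> v) = v"
    using cl by (simp add: B.m_assoc[symmetric])
  finally show ?thesis .
qed

text \<open>
  If \<open>s # y\<close> and \<open>t # v\<close> start with distinct letters of the same type, then these merge into one letter of that
  type in the quotient and there is no further cancellation.
\<close>

lemma inv_mult_other_letter:
  fixes \<eta> :: "bool \<Rightarrow> 'k::comm_monoid_mult"
  assumes s: "s \<in> letters c" and y: "fp_word G H y" "headed (\<not> c) y"
    and v: "fp_word G H v" "headed (\<not> c) v" and t: "t \<in> letters c" "t \<noteq> s"
  shows "word_weight \<eta> (inv\<^bsub>B\<^esub> (s # y) \<otimes>\<^bsub>B\<^esub> (t # v)) = \<eta> c * word_weight \<eta> y * word_weight \<eta> v"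
proof -
  have cl: "[s] \<in> carrier B" "[t] \<in> carrier B" "y \<in> carrier B" "v \<in> carrier B"
    using s t y v isl_letters[OF s] isl_letters[OF t(1)] by (auto simp: carrier_B word_Cons)
  have "[s] \<in> factor c" "[t] \<in> factor c"
    using s t(1) by (auto simp: factor_def)
  then have "inv\<^bsub>B\<^esub> [s] \<otimes>\<^bsub>B\<^esub> [t] \<in> factor c"
    by (intro subgroup.m_closed[OF subgroup_factor] subgroup.m_inv_closed[OF subgroup_factor])
  moreover have "inv\<^bsub>B\<^esub> [s] \<otimes>\<^bsub>B\<^esub> [t] \<noteq> []"
  proof
    assume "inv\<^bsub>B\<^esub> [s] \<otimes>\<^bsub>B\<^esub> [t] = []"
    then have "[s] \<otimes>\<^bsub>B\<^esub> (inv\<^bsub>B\<^esub> [s] \<otimes>\<^bsub>B\<^esub> [t]) = [s] \<otimes>\<^bsub>B\<^esub> \<one>\<^bsub>B\<^esub>"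
      by (simp only: one_B)
    with cl t(2) show False
      by (simp add: B.m_assoc[symmetric])
  qed
  ultimately obtain u where u: "u \<in> letters c" "inv\<^bsub>B\<^esub> [s] \<otimes>\<^bsub>B\<^esub> [t] = [u]"
    by (auto simp: factor_def)
  have uv: "fp_word G H (u # v)" "headed c (u # v)"
    using u(1) v isl_letters[OF u(1)] by (auto simp: word_Cons)
  have "inv\<^bsub>B\<^esub> (s # y) \<otimes>\<^bsub>B\<^esub> (t # v)
      = inv\<^bsub>B\<^esub> ([s] \<otimes>\<^bsub>B\<^esub> y) \<otimes>\<^bsub>B\<^esub> ([t] \<otimes>\<^bsub>B\<^esub> v)"
    using s t(1) y(2) v(2) by (simp only: mult_letter)
  also have "\<dots> = inv\<^bsub>B\<^esub> y \<otimes>\<^bsub>B\<^esub> ((inv\<^bsub>B\<^esub> [s] \<otimes>\<^bsub>B\<^esub> [t]) \<otimes>\<^bsub>B\<^esub> v)"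
    using cl by (simp add: B.inv_mult_group B.m_assoc)
  also have "\<dots> = inv\<^bsub>B\<^esub> y \<otimes>\<^bsub>B\<^esub> (u # v)"
    using u v(2) by (simp add: mult_letter)
  finally show ?thesis
    using y uv isl_letters[OF u(1)]
    by (simp add: word_weight_mult_inv[where c = "\<not> c"] ac_simps)
qed

lemma words_0: "words c 0 = {[]}"
  by (auto simp: words_def)

lemma words_Suc:
  "words c (Suc n) = insert [] ((\<lambda>(s, v). s # v) ` (letters c \<times> words (\<not> c) n))"
proof (intro subset_antisym subsetI)
  fix w assume w: "w \<in> words c (Suc n)"
  show "w \<in> insert [] ((\<lambda>(s, v). s # v) ` (letters c \<times> words (\<not> c) n))"
  proof (cases w)
    case (Cons s v)
    with w have "(s, v) \<in> letters c \<times> words (\<not> c) n"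
      by (auto simp: words_def word_Cons)
    then show ?thesis
      using Cons by (auto intro!: image_eqI[where x = "(s, v)"])
  qed simp
qed (auto simp: words_def word_Cons isl_letters)

lemma finite_words: "finite (words c n)"
  by (induction n arbitrary: c) (auto simp: words_0 words_Suc finite_letters)

lemma sum_words_Suc:
  "(\<Sum>w\<in>words c (Suc n). \<phi> w) = \<phi> [] + (\<Sum>s\<in>letters c. \<Sum>v\<in>words (\<not> c) n. \<phi> (s # v))"
proof -
  have inj: "inj_on (\<lambda>(s, v). s # v) (letters c \<times> words (\<not> c) n)"
    by (auto simp: inj_on_def)
  show ?thesis
    unfolding words_Suc
    by (subst sum.insert)
      (auto simp: finite_letters finite_words sum.reindex[OF inj] sum.cartesian_product
        prod.case_distrib[of \<phi>])
qed

lemma finite_set_words: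
  assumes "finite F" and "F \<subseteq> carrier B"
  obtains n where "F \<subseteq> words True n \<union> words False n"
proof -
  have "F \<subseteq> words True (Max (length ` F)) \<union> words False (Max (length ` F))"
    using assms by (auto simp: words_def carrier_B headed_def)
  then show thesis by (rule that)
qed

text \<open>
  With \<open>m c = deg c * t c\<close>, cutting off the first letter gives \<open>Z c = 1 + m c * Z (\<not> c)\<close> for the sum \<open>Z c\<close> over all
  words headed by \<open>c\<close>, which is solved by the bound in the statement. The truncated sums stay below this
  fixed point.
\<close>

lemma sum_words_weight_le:
  fixes t :: "bool \<Rightarrow> real"
  assumes t: "\<And>c. 0 \<le> t c" and q: "deg True * t True * (deg False * t False) < 1"
  shows "(\<Sum>w\<in>words c n. word_weight t w) \<le> (1 + deg c * t c) /
            (1 - deg True * t True * (deg False * t False))"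
proof -
  define m where "m c = deg c * t c" for c
  have m: "0 \<le> m c" for c
    using t by (simp add: m_def)
  define Z where "Z c = (1 + m c) / (1 - m True * m False)" for c
  have q': "m True * m False < 1"
    using q by (simp add: m_def)
  have rec: "1 + m c * Z (\<not> c) = Z c" for c
    using q' by (cases c) (simp_all add: Z_def field_simps)
  have "(\<Sum>w\<in>words c n. word_weight t w) \<le> Z c"
  proof (induction n arbitrary: c)
    case 0
    have "0 \<le> m c * Z (\<not> c)"
      using m[of c] m[of "\<not> c"] q' by (simp add: Z_def)
    then show ?case
      using rec[of c] by (simp add: words_0)
  next
    case (Suc n)
    have "(\<Sum>w\<in>words c (Suc n). word_weight t w)
        = 1 + m c * (\<Sum>v\<in>words (\<not> c) n. word_weight t v)"
      by (simp add: sum_words_Suc isl_letters m_def sum_distrib_left[symmetric])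
    also have "\<dots> \<le> 1 + m c * Z (\<not> c)"
      using Suc m by (intro add_left_mono mult_left_mono) auto
    finally show ?case
      by (simp add: rec)
  qed
  then show ?thesis
    by (simp add: Z_def m_def)
qed

text \<open>
  The words made of two-letter blocks already contribute a geometric series. Its ratio is the product of
  the two branching numbers and the two weights, so the sum is unbounded as this product tends to \<open>1\<close>.
\<close>

lemma sum_words_weight_ge:
  fixes t :: "bool \<Rightarrow> real"
  assumes t: "\<And>c. 0 \<le> t c"
  shows "(\<Sum>i\<le>n. (deg True * t True * (deg False * t False)) ^ i)
           \<le> (\<Sum>w\<in>words c (2 * n). word_weight t w)"
proof (induction n)
  case (Suc n)
  let ?q = "deg True * t True * (deg False * t False)"
  have q: "deg c * t c * (deg (\<not> c) * t (\<not> c)) = ?q"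
    by (cases c) auto
  have "(\<Sum>i\<le>Suc n. ?q ^ i) = 1 + ?q * (\<Sum>i\<le>n. ?q ^ i)"
    by (simp only: sum.atMost_Suc_shift power_0 power_Suc sum_distrib_left)
  also have "\<dots> \<le> 1 + ?q * (\<Sum>w\<in>words c (2 * n). word_weight t w)"
    using Suc t by (intro add_left_mono mult_left_mono) auto
  also have "\<dots> \<le> 1 + deg c * t c *
      (1 + deg (\<not> c) * t (\<not> c) * (\<Sum>w\<in>words c (2 * n). word_weight t w))"
    unfolding q[symmetric] using t[of c] by (simp add: algebra_simps)
  also have "\<dots> = (\<Sum>w\<in>words c (2 * Suc n). word_weight t w)"
    by (simp add: sum_words_Suc isl_letters sum_distrib_left[symmetric])
  finally show ?case .
qed (simp add: words_0)

text \<open>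
  The estimate behind the Schur test for the kernel \<open>r (inv x \<otimes> y)\<close> with test function \<open>\<eta>\<close>, where \<open>r\<close> and \<open>\<eta>\<close>
  are weights. Compare \<open>w\<close> with \<open>x\<close> letter by letter from the front. As soon as the two words separate there is
  no more cancellation, and the remaining sum is \<open>\<eta> x\<close> times a convergent sum of the weight \<open>r \<eta>\<close>; this needs
  \<open>q\<close>. Each common letter of type \<open>c\<close> contributes the factor \<open>r c\<close> and shortens \<open>x\<close>, which divides \<open>\<eta> x\<close> by \<open>\<eta> c\<close>.
  The total cost \<open>r c / \<eta> c\<close> per common letter is contracting over two consecutive letters by \<open>p\<close>, so the
  contributions of all separation points form a convergent series.
\<close>

lemma sum_words_two_weights_le:
  fixes r \<eta> :: "bool \<Rightarrow> real"
  assumes r: "\<And>c. 0 \<le> r c" and \<eta>: "\<And>c. 0 < \<eta> c"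
    and q: "deg True * (r True * \<eta> True) * (deg False * (r False * \<eta> False)) < 1"
    and p: "r True / \<eta> True * (r False / \<eta> False) < 1"
  obtains D where "0 \<le> D"
    and "\<And>c n x. fp_word G H x \<Longrightarrow>
          (\<Sum>w\<in>words c n. word_weight r w * word_weight \<eta> (inv\<^bsub>B\<^esub> x \<otimes>\<^bsub>B\<^esub> w)) \<le> D * word_weight \<eta> x"
proof -
  define Z where "Z c = (1 + deg c * (r c * \<eta> c)) / (1 -
    deg True * (r True * \<eta> True) * (deg False * (r False * \<eta> False)))" for c
  \<comment> \<open>\<open>A\<close> bounds, for either type, the part of the sum in which the words separate at once.\<close>
  define A where "A = Z True + Z False
    + (1 + deg True * r True * Z False) + (1 + deg False * r False * Z True)"
  define p where "p c = r c / \<eta> c" for c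
  \<comment> \<open>\<open>D\<close> is the fixed point of the recursion \<open>D c = A + p c * D (\<not> c)\<close> along the common prefix.\<close>
  define D where "D c = (A + p c * A) / (1 - p True * p False)" for c
  have Z: "(\<Sum>w\<in>words c n. word_weight r w * word_weight \<eta> w) \<le> Z c" for c n
    using sum_words_weight_le[of "\<lambda>c. r c * \<eta> c" c n] r \<eta> q
    by (simp add: Z_def word_weight_mult less_imp_le)
  have Z0: "0 \<le> Z c" for c
    using r \<eta> q by (auto simp: Z_def less_imp_le intro!: divide_nonneg_pos add_nonneg_nonneg)
  have ZA: "Z c \<le> A" and ZA': "1 + deg c * r c * Z (\<not> c) \<le> A" for c
    using Z0[of True] Z0[of False] r[of True] r[of False] by (cases c; simp add: A_def)+
  have A0: "0 \<le> A"
    using Z0 ZA order_trans by blast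
  have p0: "0 \<le> p c" for c
    using r \<eta> by (simp add: p_def less_imp_le)
  have p1: "p True * p False < 1"
    using p by (simp add: p_def)
  have rec: "A + p c * D (\<not> c) = D c" for c
    using p1 by (cases c) (simp_all add: D_def field_simps)
  have D0: "0 \<le> D c" for c
    using A0 p0[of c] p1 by (simp add: D_def)
  have AD: "A \<le> D c" for c
    using rec[of c] mult_nonneg_nonneg[OF p0[of c] D0[of "\<not> c"]] by linarith
  have wpos: "0 < word_weight \<eta> x" for x :: "('a + 'b) list"
    using \<eta> by (rule word_weight_pos)
  have main: "(\<Sum>w\<in>words c n. word_weight r w * word_weight \<eta> (inv\<^bsub>B\<^esub> x \<otimes>\<^bsub>B\<^esub> w))
      \<le> D c * word_weight \<eta> x" if "fp_word G H x" for c n x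
    using that
  proof (induction n arbitrary: c x)
    case 0
    have "1 \<le> D c"
    proof -
      have "0 \<le> deg c * r c * Z (\<not> c)"
        using r[of c] Z0[of "\<not> c"] by simp
      then show ?thesis
        using ZA'[of c] AD[of c] by linarith
    qed
    then show ?case
      using 0 wpos[of x] by (simp add: words_0 word_weight_inv_Nil)
  next
    case (Suc n)
    show ?case
    proof (cases "headed (\<not> c) x")
      case True
      have "(\<Sum>w\<in>words c (Suc n). word_weight r w * word_weight \<eta> (inv\<^bsub>B\<^esub> x \<otimes>\<^bsub>B\<^esub> w))
          = (\<Sum>w\<in>words c (Suc n). word_weight r w * word_weight \<eta> w * word_weight \<eta> x)"
        using True Suc.prems
        by (intro sum.cong) (auto simp: words_def word_weight_mult_inv[where c = "\<not> c"])
      also have "\<dots> = (\<Sum>w\<in>words c (Suc n). word_weight r w * word_weight \<eta> w) * word_weight \<eta> x"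
        by (simp add: sum_distrib_right)
      also have "\<dots> \<le> D c * word_weight \<eta> x"
        using Z[of c "Suc n"] ZA[of c] AD[of c] wpos[of x] by (intro mult_right_mono) linarith+
      finally show ?thesis .
    next
      case False
      then obtain s y where x: "x = s # y" and s: "isl s = c"
        by (cases x) auto
      with Suc.prems have y: "s \<in> letters c" "fp_word G H y" "headed (\<not> c) y"
        by (auto simp: word_Cons)
      let ?g = "\<lambda>w. word_weight r w * word_weight \<eta> (inv\<^bsub>B\<^esub> x \<otimes>\<^bsub>B\<^esub> w)"
      have same: "?g (s # v) = r c * (word_weight r v * word_weight \<eta> (inv\<^bsub>B\<^esub> y \<otimes>\<^bsub>B\<^esub> v))"
        if v: "v \<in> words (\<not> c) n" for v
      proof -
        have v': "fp_word G H v" "headed (\<not> c) v"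
          using v by (auto simp: words_def)
        have "inv\<^bsub>B\<^esub> x \<otimes>\<^bsub>B\<^esub> (s # v) = inv\<^bsub>B\<^esub> y \<otimes>\<^bsub>B\<^esub> v"
          unfolding x by (rule inv_mult_same_letter[OF y v'])
        then show ?thesis
          by (simp add: s mult.assoc)
      qed
      have other: "?g (t # v) = r c * \<eta> c * word_weight \<eta> y * (word_weight r v * word_weight \<eta> v)"
        if v: "v \<in> words (\<not> c) n" and t: "t \<in> letters c" "t \<noteq> s" for v t
      proof -
        have v': "fp_word G H v" "headed (\<not> c) v"
          using v by (auto simp: words_def)
        show ?thesis
          unfolding x inv_mult_other_letter[OF y v' t] by (simp add: isl_letters[OF t(1)])
      qed
      have wx: "word_weight \<eta> x = \<eta> c * word_weight \<eta> y"
        by (simp add: x s)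
      have "(\<Sum>t\<in>letters c. \<Sum>v\<in>words (\<not> c) n. ?g (t # v))
          = (\<Sum>v\<in>words (\<not> c) n. ?g (s # v))
            + (\<Sum>t\<in>letters c - {s}. \<Sum>v\<in>words (\<not> c) n. ?g (t # v))"
        using y(1) finite_letters by (rule sum.remove[rotated])
      also have "(\<Sum>v\<in>words (\<not> c) n. ?g (s # v)) \<le> p c * D (\<not> c) * word_weight \<eta> x"
      proof -
        have "(\<Sum>v\<in>words (\<not> c) n. ?g (s # v))
            = r c * (\<Sum>v\<in>words (\<not> c) n. word_weight r v * word_weight \<eta> (inv\<^bsub>B\<^esub> y \<otimes>\<^bsub>B\<^esub> v))"
          unfolding sum_distrib_left by (intro sum.cong same refl)
        also have "\<dots> \<le> r c * (D (\<not> c) * word_weight \<eta> y)"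
          using Suc.IH y(2) r by (intro mult_left_mono)
        also have "\<dots> = p c * D (\<not> c) * word_weight \<eta> x"
          using \<eta>[of c] by (simp add: wx p_def)
        finally show ?thesis .
      qed
      also have "(\<Sum>t\<in>letters c - {s}. \<Sum>v\<in>words (\<not> c) n. ?g (t # v))
          \<le> deg c * r c * Z (\<not> c) * word_weight \<eta> x"
      proof -
        have "(\<Sum>t\<in>letters c - {s}. \<Sum>v\<in>words (\<not> c) n. ?g (t # v))
            = real (card (letters c - {s})) * (r c * \<eta> c * word_weight \<eta> y *
                (\<Sum>v\<in>words (\<not> c) n. word_weight r v * word_weight \<eta> v))"
        proof -
          have "(\<Sum>t\<in>letters c - {s}. \<Sum>v\<in>words (\<not> c) n. ?g (t # v))
              = (\<Sum>t\<in>letters c - {s}. \<Sum>v\<in>words (\<not> c) n.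
                  r c * \<eta> c * word_weight \<eta> y * (word_weight r v * word_weight \<eta> v))"
            by (intro sum.cong other refl) auto
          then show ?thesis
            by (simp add: sum_distrib_left[symmetric])
        qed
        also have "\<dots> \<le> deg c * (r c * \<eta> c * word_weight \<eta> y * Z (\<not> c))"
          using r[of c] \<eta>[of c] wpos[of y] Z[of "\<not> c" n]
          by (intro mult_mono mult_left_mono mult_nonneg_nonneg sum_nonneg)
            (auto simp: less_imp_le word_weight_nonneg r \<eta> intro!: card_mono finite_letters)
        finally show ?thesis
          by (simp add: wx algebra_simps)
      qed
      finally have "(\<Sum>w\<in>words c (Suc n). ?g w)
          \<le> word_weight \<eta> x + (p c * D (\<not> c) * word_weight \<eta> x
            + deg c * r c * Z (\<not> c) * word_weight \<eta> x)"
        using Suc.prems by (simp add: sum_words_Suc word_weight_inv_Nil)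
      also have "\<dots> = (1 + deg c * r c * Z (\<not> c) + p c * D (\<not> c)) * word_weight \<eta> x"
        by (simp add: algebra_simps)
      also have "\<dots> \<le> D c * word_weight \<eta> x"
        using ZA'[of c] rec[of c] wpos[of x] by (intro mult_right_mono) linarith+
      finally show ?thesis .
    qed
  qed
  show thesis
  proof (rule that[of "D True + D False"])
    fix c n x assume "fp_word G H x"
    then have "(\<Sum>w\<in>words c n. word_weight r w * word_weight \<eta> (inv\<^bsub>B\<^esub> x \<otimes>\<^bsub>B\<^esub> w)) \<le> D c * word_weight \<eta> x"
      by (rule main)
    also have "\<dots> \<le> (D True + D False) * word_weight \<eta> x"
      using D0[of True] D0[of False] wpos[of x] by (intro mult_right_mono) (cases c, auto)
    finally show "(\<Sum>w\<in>words c n. word_weight r w * word_weight \<eta> (inv\<^bsub>B\<^esub> x \<otimes>\<^bsub>B\<^esub> w))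
        \<le> (D True + D False) * word_weight \<eta> x" .
  qed (use D0 in simp)
qed

section \<open>Radial functions on the free product\<close>

text \<open>
  Elements of \<open>ell2\<close> have to vanish outside the carrier.
\<close>

definition weight_fun :: "(bool \<Rightarrow> complex) \<Rightarrow> ('a + 'b) list \<Rightarrow> complex" where
  "weight_fun t w = (if w \<in> carrier B then word_weight t w else 0)"

lemma finite_sum_words_le:
  assumes F: "finite F" "F \<subseteq> carrier B"
    and f: "\<And>w. 0 \<le> f w" and le: "\<And>c n. (\<Sum>w\<in>words c n. f w) \<le> (D c :: real)"
  shows "(\<Sum>w\<in>F. f w) \<le> D True + D False"
proof -
  obtain n where n: "F \<subseteq> words True n \<union> words False n"
    using F by (rule finite_set_words)
  have "(\<Sum>w\<in>F. f w) \<le> (\<Sum>w\<in>words True n \<union> words False n. f w)"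
    using n f finite_words by (intro sum_mono2) auto
  also have "\<dots> \<le> (\<Sum>w\<in>words True n. f w) + (\<Sum>w\<in>words False n. f w)"
    using f sum_nonneg[of "words True n \<inter> words False n" f]
    by (simp add: sum_Un finite_words)
  also have "\<dots> \<le> D True + D False"
    by (intro add_mono le)
  finally show ?thesis .
qed

lemma weight_fun_in_ell2:
  assumes "deg True * (cmod (t True))\<^sup>2 * (deg False * (cmod (t False))\<^sup>2) < 1"
  shows "weight_fun t \<in> ell2 (carrier B)"
proof -
  define Z where "Z c = (1 + deg c * (cmod (t c))\<^sup>2)
    / (1 - deg True * (cmod (t True))\<^sup>2 * (deg False * (cmod (t False))\<^sup>2))" for c
  have sq: "(cmod (word_weight t w))\<^sup>2 = word_weight (\<lambda>c. (cmod (t c))\<^sup>2) w" for w :: "('a + 'b) list"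
    by (simp add: cmod_word_weight power2_eq_square word_weight_mult)
  have Z: "(\<Sum>w\<in>words c n. (cmod (word_weight t w))\<^sup>2) \<le> Z c" for c n
    unfolding sq Z_def using assms by (intro sum_words_weight_le) auto
  have Z0: "0 \<le> Z c" for c
    using assms by (simp add: Z_def)
  have "(\<Sum>w\<in>F. (cmod (weight_fun t w))\<^sup>2) \<le> (sqrt (Z True + Z False))\<^sup>2"
    if F: "finite F" "F \<subseteq> carrier B" for F
  proof -
    have "(\<Sum>w\<in>F. (cmod (weight_fun t w))\<^sup>2) = (\<Sum>w\<in>F. (cmod (word_weight t w))\<^sup>2)"
      using F by (intro sum.cong) (auto simp: weight_fun_def)
    also have "\<dots> \<le> Z True + Z False"
      using F Z by (intro finite_sum_words_le) auto
    finally show ?thesis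
      using Z0 by simp
  qed
  then show ?thesis
    using Z0 by (intro ell2I(1)[where C = "sqrt (Z True + Z False)"]) (auto simp: weight_fun_def)
qed

lemma weight_fun_norm_ge:
  assumes "weight_fun t \<in> ell2 (carrier B)"
  shows "(\<Sum>i\<le>n. (deg True * (cmod (t True))\<^sup>2 * (deg False * (cmod (t False))\<^sup>2)) ^ i)
           \<le> (ell2_norm (carrier B) (weight_fun t))\<^sup>2"
proof -
  have sub: "words c n \<subseteq> carrier B" for c n
    by (auto simp: words_def carrier_B)
  have sq: "(cmod (weight_fun t w))\<^sup>2 = word_weight (\<lambda>c. (cmod (t c))\<^sup>2) w" if "w \<in> words c n" for c n w
    using sub[of c n] that
    by (auto simp: weight_fun_def cmod_word_weight power2_eq_square word_weight_mult)
  have "(\<Sum>i\<le>n. (deg True * (cmod (t True))\<^sup>2 * (deg False * (cmod (t False))\<^sup>2)) ^ i)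
      \<le> (\<Sum>w\<in>words True (2 * n). word_weight (\<lambda>c. (cmod (t c))\<^sup>2) w)"
    by (rule sum_words_weight_ge) simp
  also have "\<dots> = (\<Sum>w\<in>words True (2 * n). (cmod (weight_fun t w))\<^sup>2)"
    by (intro sum.cong) (auto simp: sq)
  also have "\<dots> \<le> (ell2_norm (carrier B) (weight_fun t))\<^sup>2"
    using assms finite_words sub by (rule ell2_sum_le)
  finally show ?thesis .
qed

text \<open>
  Inversion preserves weights, so the average over the right multiples of \<open>w\<close> is the average over the left
  multiples of its inverse, which is a sum over one coset of words.
\<close>

lemma coset_average_weight_fun:
  assumes w: "w \<in> carrier B"
  shows "coset_average B (factor c) (weight_fun t) w
           = (1 + of_nat (card (letters c)) * t c) / (of_nat (card (letters c)) + 1)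
               * word_weight t (strip c (inv\<^bsub>B\<^esub> w))"
proof -
  note mem = subgroup.mem_carrier[OF subgroup_factor[of c]]
  have word: "fp_word G H (inv\<^bsub>B\<^esub> w)"
    using w by (simp add: carrier_B inv_word)
  have "(\<Sum>u\<in>factor c. weight_fun t (w \<otimes>\<^bsub>B\<^esub> u))
      = (\<Sum>u\<in>factor c. word_weight t (inv\<^bsub>B\<^esub> u \<otimes>\<^bsub>B\<^esub> inv\<^bsub>B\<^esub> w))"
  proof (rule sum.cong)
    fix u assume "u \<in> factor c"
    then have u: "u \<in> carrier B" by (rule mem)
    then have "w \<otimes>\<^bsub>B\<^esub> u \<in> carrier B"
      using w by simp
    moreover from this have "word_weight t (inv\<^bsub>B\<^esub> (w \<otimes>\<^bsub>B\<^esub> u)) = word_weight t (w \<otimes>\<^bsub>B\<^esub> u)"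
      by (intro word_weight_inv) (simp only: carrier_B)
    ultimately show "weight_fun t (w \<otimes>\<^bsub>B\<^esub> u) = word_weight t (inv\<^bsub>B\<^esub> u \<otimes>\<^bsub>B\<^esub> inv\<^bsub>B\<^esub> w)"
      using w u by (simp add: weight_fun_def B.inv_mult_group)
  qed simp
  also have "\<dots> = (\<Sum>u\<in>factor c. word_weight t (u \<otimes>\<^bsub>B\<^esub> inv\<^bsub>B\<^esub> w))"
    by (rule B.subgroup_sum_inv[OF subgroup_factor])
  also have "\<dots> = (1 + of_nat (card (letters c)) * t c) * word_weight t (strip c (inv\<^bsub>B\<^esub> w))"
    by (rule word_weight_coset_sum[OF word])
  finally show ?thesis
    using w by (simp add: coset_average_def card_factor add.commute)
qed

lemma coset_average_weight_zero:
  assumes "1 + of_nat (card (letters c)) * t c = 0"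
  shows "coset_average B (factor c) (weight_fun t) = (\<lambda>w. 0)"
proof
  fix w
  show "coset_average B (factor c) (weight_fun t) w = 0"
    using assms coset_average_weight_fun[of w c t]
    by (cases "w \<in> carrier B") (auto simp: coset_average_def)
qed

lemma word_weight_strip: "t c = 1 \<Longrightarrow> word_weight t (strip c w) = word_weight t w"
  by (cases w) auto

lemma coset_average_weight_invariant:
  assumes "t c = 1"
  shows "coset_average B (factor c) (weight_fun t) = weight_fun t"
proof
  fix w
  show "coset_average B (factor c) (weight_fun t) w = weight_fun t w"
  proof (cases "w \<in> carrier B")
    case True
    have "1 + of_nat n \<noteq> (0 :: complex)" for n
      using of_nat_neq_0[of n, where ?'a = complex] by simp
    then show ?thesis
      using True assms coset_average_weight_fun[OF True, of c t]
      by (simp add: weight_fun_def word_weight_strip carrier_B word_weight_inv add.commute)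
  qed (simp add: coset_average_def weight_fun_def)
qed

lemma strip_factor_mult:
  assumes u: "u \<in> factor c" and w: "fp_word G H w"
  shows "strip c (u \<otimes>\<^bsub>B\<^esub> w) = strip c w"
proof -
  have strip_mult: "strip c (v \<otimes>\<^bsub>B\<^esub> strip c w) = strip c w" if "v \<in> factor c" for v
    using that word_strip[OF w, of c]
    by (cases "strip c w") (auto simp: factor_def mult_letter isl_letters mult_B[of "[]"] word_Cons)
  obtain v where v: "v \<in> factor c" "w = v \<otimes>\<^bsub>B\<^esub> strip c w"
    using w by (rule strip_eq_mult)
  note mem = subgroup.mem_carrier[OF subgroup_factor[of c]]
  have "u \<otimes>\<^bsub>B\<^esub> w = (u \<otimes>\<^bsub>B\<^esub> v) \<otimes>\<^bsub>B\<^esub> strip c w"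
    using u v mem word_strip(1)[OF w] B.m_assoc by (metis carrier_B)
  then show ?thesis
    using strip_mult[OF subgroup.m_closed[OF subgroup_factor u v(1)]] by simp
qed

text \<open>
  The weight of a word under \<open>radial \<rho>\<close> is \<open>\<rho>\<close> to the number of its letters from \<open>G\<close>. For \<open>inv x \<otimes> y\<close> this number is
  half the distance, in the tree of cosets, between the cosets of \<open>x\<close> and \<open>y\<close> under \<open>H\<close>.
\<close>

definition radial :: "complex \<Rightarrow> bool \<Rightarrow> complex" where
  "radial \<rho> c = (if c then \<rho> else 1)"

lemma strip_eq_Nil_iff:
  assumes "fp_word G H w"
  shows "strip c w = [] \<longleftrightarrow> w \<in> factor c"
  using assms by (cases w) (auto simp: factor_def word_Cons dest: isl_letters)

abbreviation (input) M where "M \<equiv> of_nat (card (letters True)) :: complex"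
abbreviation (input) N where "N \<equiv> of_nat (card (letters False)) :: complex"

text \<open>
  For \<open>\<rho> = \<tau> / sqrt (M * N)\<close> the numerator is \<open>M + N + sqrt (M * N) * (\<tau> + 1 / \<tau>)\<close>, an affine image of the Joukowski
  function of \<open>\<tau>\<close>: it maps the unit circle onto a real interval and the punctured open unit disc onto the
  complement of that interval.
\<close>

definition joukowski :: "complex \<Rightarrow> complex" where
  "joukowski \<rho> = (M + N + 1 / \<rho> + M * N * \<rho>) / ((M + 1) * (N + 1))"

text \<open>
  The failure, at the base vertex only, of the radial function to be an eigenfunction.
\<close>

definition defect :: "complex \<Rightarrow> complex" where
  "defect \<rho> = (M * \<rho> + 1) * (\<rho> - 1) / (\<rho> * ((M + 1) * (N + 1)))"

lemma card_factor_neq_0: "of_nat (card (letters c)) + 1 \<noteq> (0 :: complex)"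
  using of_nat_neq_0[of "card (letters c)", where ?'a = complex] by (simp add: add.commute)

text \<open>
  Two steps from a vertex of the tree at distance \<open>2 n\<close> from the base vertex lead once to distance \<open>2 n - 2\<close>,
  \<open>M - 1\<close> times to a sibling at the same distance, \<open>N + 1\<close> times back to the vertex itself and \<open>M * N\<close> times to distance
  \<open>2 n + 2\<close>. This gives the eigenvalue \<open>joukowski \<rho>\<close> away from the base vertex. The base vertex has no neighbour
  closer to itself, which produces the defect.
\<close>

lemma radial_green_identity:
  assumes w: "w \<in> carrier B" and \<rho>: "\<rho> \<noteq> 0"
  shows "(\<Sum>b\<in>factor False. \<Sum>a\<in>factor True. word_weight (radial \<rho>) (a \<otimes>\<^bsub>B\<^esub> (b \<otimes>\<^bsub>B\<^esub> w)))
    = of_nat (card (factor True)) * of_nat (card (factor False)) *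
       (joukowski \<rho> * word_weight (radial \<rho>) w + defect \<rho> * of_bool (w \<in> factor False))"
proof -
  let ?k = "word_weight (radial \<rho>) :: ('a + 'b) list \<Rightarrow> complex"
  have word: "fp_word G H w"
    using w by (simp add: carrier_B)
  define v where "v = strip False w"
  have v: "fp_word G H v" "headed True v" "?k w = ?k v" "w \<in> factor False \<longleftrightarrow> v = []"
    using word_strip[OF word, of False] strip_eq_Nil_iff[OF word, of False]
    by (auto simp: v_def word_weight_strip radial_def)
  have "(\<Sum>b\<in>factor False. \<Sum>a\<in>factor True. ?k (a \<otimes>\<^bsub>B\<^esub> (b \<otimes>\<^bsub>B\<^esub> w)))
      = (\<Sum>b\<in>factor False. (1 + M * \<rho>) * ?k (strip True (b \<otimes>\<^bsub>B\<^esub> w)))"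
  proof (rule sum.cong)
    fix b assume "b \<in> factor False"
    then have "b \<otimes>\<^bsub>B\<^esub> w \<in> carrier B"
      using w subgroup.mem_carrier[OF subgroup_factor] by (intro B.m_closed)
    then show "(\<Sum>a\<in>factor True. ?k (a \<otimes>\<^bsub>B\<^esub> (b \<otimes>\<^bsub>B\<^esub> w))) = (1 + M * \<rho>) * ?k (strip True (b \<otimes>\<^bsub>B\<^esub> w))"
      using word_weight_coset_sum[of "b \<otimes>\<^bsub>B\<^esub> w" "radial \<rho>" True] by (simp add: carrier_B radial_def)
  qed simp
  also have "\<dots> = (1 + M * \<rho>) * (\<Sum>b\<in>factor False. ?k (strip True (b \<otimes>\<^bsub>B\<^esub> w)))"
    by (simp add: sum_distrib_left)
  also have "(\<Sum>b\<in>factor False. ?k (strip True (b \<otimes>\<^bsub>B\<^esub> w))) = ?k (strip True v) + N * ?k v"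
    unfolding coset_sum[OF word, of "\<lambda>u. ?k (strip True u)"]
    by (simp add: v_def isl_letters radial_def)
  also have "(1 + M * \<rho>) * (?k (strip True v) + N * ?k v)
      = (M + 1) * (N + 1) * (joukowski \<rho> * ?k v + defect \<rho> * of_bool (v = []))"
  proof -
    have J: "(M + 1) * (N + 1) * joukowski \<rho> = M + N + 1 / \<rho> + M * N * \<rho>"
      using card_factor_neq_0[of True] card_factor_neq_0[of False] by (simp add: joukowski_def)
    have D: "(M + 1) * (N + 1) * defect \<rho> = (M * \<rho> + 1) * (\<rho> - 1) / \<rho>"
      using card_factor_neq_0[of True] card_factor_neq_0[of False] by (simp add: defect_def)
    have split: "(M + 1) * (N + 1) * (joukowski \<rho> * a + defect \<rho> * b)
        = (M + N + 1 / \<rho> + M * N * \<rho>) * a + ((M * \<rho> + 1) * (\<rho> - 1) / \<rho>) * b" for a b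
      unfolding J[symmetric] D[symmetric] by (simp add: algebra_simps)
    show ?thesis
    proof (cases v)
      case Nil
      then show ?thesis
        unfolding split using \<rho> by (simp add: field_simps)
    next
      case (Cons s u)
      then have "isl s"
        using v(2) by simp
      then show ?thesis
        unfolding split using \<rho> by (simp add: Cons radial_def field_simps)
    qed
  qed
  finally show ?thesis
    by (simp add: v(3,4) card_factor add.commute)
qed

section \<open>The resolvent\<close>

text \<open>
  The Schur test with the test function \<open>(M N) powr (- n / 2)\<close> of the number \<open>n\<close> of letters from \<open>G\<close>, which balances
  the growth of the tree: both conditions of \<open>sum_words_two_weights_le\<close> become \<open>|\<rho>| sqrt (M N) < 1\<close>.
\<close>

lemma radial_kernel_bounded:
  assumes deg: "0 < deg True" "0 < deg False" and \<rho>: "cmod \<rho> * sqrt (deg True * deg False) < 1"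
  shows "admissible_kernel B (word_weight (radial \<rho>))"
    and "ell2_bounded_op (carrier B) (kernel_op B (word_weight (radial \<rho>)))"
proof -
  define q where "q = sqrt (deg True * deg False)"
  define r where "r c = cmod (radial \<rho> c)" for c
  define \<eta> where "\<eta> c = (if c then 1 / q else 1)" for c
  have q: "0 < q" "deg True * deg False = q * q"
    using deg by (simp_all add: q_def)
  have r: "r True = cmod \<rho>" "r False = 1" and r0: "0 \<le> r c" for c
    by (simp_all add: r_def radial_def)
  have \<eta>: "0 < \<eta> c" for c
    using q by (simp add: \<eta>_def)
  have "deg True * (r True * \<eta> True) * (deg False * (r False * \<eta> False)) = cmod \<rho> * (deg True * deg False) / q"
    by (simp add: r \<eta>_def)
  also have "\<dots> = cmod \<rho> * q"
    using q(1) by (simp add: q(2))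
  finally have small1: "deg True * (r True * \<eta> True) * (deg False * (r False * \<eta> False)) < 1"
    using \<rho> by (simp add: q_def)
  have small2: "r True / \<eta> True * (r False / \<eta> False) < 1"
    using \<rho> by (simp add: r \<eta>_def q_def)
  obtain D where D: "0 \<le> D" and sum_le: "\<And>c n x. fp_word G H x \<Longrightarrow>
      (\<Sum>w\<in>words c n. word_weight r w * word_weight \<eta> (inv\<^bsub>B\<^esub> x \<otimes>\<^bsub>B\<^esub> w)) \<le> D * word_weight \<eta> x"
    using sum_words_two_weights_le[OF r0 \<eta> small1 small2] by blast
  define K where "K x y = word_weight (radial \<rho>) (inv\<^bsub>B\<^esub> x \<otimes>\<^bsub>B\<^esub> y)" for x y
  have sym: "cmod (K x y) = cmod (K y x)" if xy: "x \<in> carrier B" "y \<in> carrier B" for x y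
  proof -
    have c: "inv\<^bsub>B\<^esub> y \<otimes>\<^bsub>B\<^esub> x \<in> carrier B" using xy by simp
    have "inv\<^bsub>B\<^esub> (inv\<^bsub>B\<^esub> y \<otimes>\<^bsub>B\<^esub> x) = inv\<^bsub>B\<^esub> x \<otimes>\<^bsub>B\<^esub> y"
      using xy by (simp add: B.inv_mult_group)
    then show ?thesis
      using word_weight_inv[OF c[unfolded carrier_B], of "radial \<rho>"] by (simp add: K_def)
  qed
  have bound: "(\<Sum>y\<in>F. cmod (K x y) * word_weight \<eta> y) \<le> (2 * D) * word_weight \<eta> x"
    if x: "x \<in> carrier B" and F: "finite F" "F \<subseteq> carrier B" for x F
  proof -
    let ?f = "\<lambda>w. word_weight r w * word_weight \<eta> (inv\<^bsub>B\<^esub> (inv\<^bsub>B\<^esub> x) \<otimes>\<^bsub>B\<^esub> w)"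
    have inj: "inj_on (\<lambda>y. inv\<^bsub>B\<^esub> x \<otimes>\<^bsub>B\<^esub> y) F"
      using x by (intro inj_on_subset[OF _ F(2)]) (auto intro!: inj_onI)
    have "(\<Sum>y\<in>F. cmod (K x y) * word_weight \<eta> y) = (\<Sum>y\<in>F. ?f (inv\<^bsub>B\<^esub> x \<otimes>\<^bsub>B\<^esub> y))"
    proof (rule sum.cong)
      fix y assume "y \<in> F"
      then have "y \<in> carrier B" using F by auto
      then show "cmod (K x y) * word_weight \<eta> y = ?f (inv\<^bsub>B\<^esub> x \<otimes>\<^bsub>B\<^esub> y)"
        using x by (simp add: K_def cmod_word_weight r_def[abs_def] B.m_assoc[symmetric])
    qed simp
    also have "\<dots> = (\<Sum>w\<in>(\<lambda>y. inv\<^bsub>B\<^esub> x \<otimes>\<^bsub>B\<^esub> y) ` F. ?f w)"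
      by (simp add: sum.reindex[OF inj])
    also have "\<dots> \<le> D * word_weight \<eta> (inv\<^bsub>B\<^esub> x) + D * word_weight \<eta> (inv\<^bsub>B\<^esub> x)"
    proof (rule finite_sum_words_le)
      show "(\<Sum>w\<in>words c n. ?f w) \<le> D * word_weight \<eta> (inv\<^bsub>B\<^esub> x)" for c n
        using x by (intro sum_le) (simp add: carrier_B inv_word)
      show "0 \<le> ?f w" for w
        using r0 \<eta> by (intro mult_nonneg_nonneg word_weight_nonneg) (auto simp: less_imp_le)
    qed (use x F in auto)
    also have "\<dots> = (2 * D) * word_weight \<eta> x"
      using x by (simp add: carrier_B word_weight_inv)
    finally show ?thesis .
  qed
  have pos: "0 < word_weight \<eta> x" for x :: "('a + 'b) list"
    using \<eta> by (rule word_weight_pos)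
  have D2: "0 \<le> 2 * D"
    using D by simp
  show "admissible_kernel B (word_weight (radial \<rho>))"
    unfolding admissible_kernel_def
    using Schur_test_summable[of "carrier B" K "word_weight \<eta>" "2 * D", OF sym pos D2 bound]
    by (simp add: K_def)
  have "kernel_op B (word_weight (radial \<rho>))
      = (\<lambda>f x. if x \<in> carrier B then \<Sum>\<^sub>\<infinity>y\<in>carrier B. K x y * f y else 0)"
    by (intro ext) (simp add: kernel_op_def K_def)
  then show "ell2_bounded_op (carrier B) (kernel_op B (word_weight (radial \<rho>)))"
    using Schur_test_bounded[of "carrier B" K "word_weight \<eta>" "2 * D", OF sym pos D2 bound]
    by simp
qed

abbreviation "PG \<equiv> coset_average B (factor True)"
abbreviation "PH \<equiv> coset_average B (factor False)"

definition averaging_op :: "complex \<Rightarrow> complex \<Rightarrow> (('a + 'b) list \<Rightarrow> complex) \<Rightarrow> ('a + 'b) list \<Rightarrow> complex"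
  where "averaging_op \<alpha> \<beta> f x = \<alpha> * PG f x + \<beta> * PH f x"

lemma coset_average_bounded: "ell2_bounded_op (carrier B) (coset_average B (factor c))"
  using finite_factor subgroup.subset[OF subgroup_factor] by (rule B.coset_average_bounded_op)

lemma factor_average_idem: "coset_average B (factor c) (coset_average B (factor c) f) = coset_average B (factor c) f"
  using subgroup_factor finite_factor by (rule B.coset_average_idem)

lemma averaging_op_bounded: "ell2_bounded_op (carrier B) (averaging_op \<alpha> \<beta>)"
  unfolding averaging_op_def[abs_def]
  by (intro bounded_op_plus bounded_op_cmult coset_average_bounded)

text \<open>
  The zeros of the defect are \<open>\<rho> = 1\<close> and \<open>\<rho> = - 1 / M\<close>. The second one lies outside the disc
  \<open>|\<rho>| < 1 / sqrt (M N)\<close> because \<open>M < N\<close>.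
\<close>

lemma defect_neq_0:
  assumes deg: "0 < deg True" "deg True < deg False" and \<rho>: "\<rho> \<noteq> 0" "cmod \<rho> * sqrt (deg True * deg False) < 1"
  shows "defect \<rho> \<noteq> 0"
proof -
  have nat: "1 \<le> deg True" "1 \<le> deg False"
    using deg by auto
  have le: "deg True \<le> sqrt (deg True * deg False)"
    using deg by (intro real_le_rsqrt) (simp add: power2_eq_square)
  have small: "cmod \<rho> * deg True < 1"
    using mult_left_mono[OF le, of "cmod \<rho>"] \<rho>(2) by simp
  moreover have "cmod \<rho> \<le> cmod \<rho> * deg True"
    using mult_left_mono[OF nat(1), of "cmod \<rho>"] by simp
  ultimately have "cmod \<rho> \<noteq> 1"
    by linarith
  then have 1: "\<rho> - 1 \<noteq> 0"
    by auto
  have "M * \<rho> + 1 \<noteq> 0"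
  proof
    assume "M * \<rho> + 1 = 0"
    then have "M * \<rho> = - 1"
      by (simp add: eq_neg_iff_add_eq_0)
    then have "cmod (M * \<rho>) = 1"
      by simp
    with small show False
      by (simp add: norm_mult mult.commute)
  qed
  with 1 \<rho>(1) card_factor_neq_0[of True] card_factor_neq_0[of False] show ?thesis
    by (simp add: defect_def)
qed

text \<open>
  Dividing by the defect turns the radial kernel into the Green's function of the two-step walk on the
  cosets of \<open>H\<close>, and \<open>two_projection_resolvent\<close> applies.
\<close>

lemma averaging_op_resolvent:
  assumes deg: "0 < deg True" "deg True < deg False" and \<rho>: "\<rho> \<noteq> 0" "cmod \<rho> * sqrt (deg True * deg False) < 1"
    and nz: "\<alpha> \<noteq> 0" "\<beta> \<noteq> 0" "z \<noteq> 0" "z \<noteq> \<alpha>" and s: "\<alpha> * \<beta> * joukowski \<rho> = (z - \<alpha>) * (z - \<beta>)"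
  shows "z \<notin> ell2_spectrum (carrier B) (averaging_op \<alpha> \<beta>)"
proof -
  let ?k = "word_weight (radial \<rho>) :: ('a + 'b) list \<Rightarrow> complex"
  define C where "C = defect \<rho> * of_nat (card (factor False))"
  have C: "C \<noteq> 0"
    using defect_neq_0[OF deg \<rho>] card_factor_neq_0[of False]
    by (simp add: C_def card_factor add.commute)
  have deg': "0 < deg False" using deg by simp
  note ker = radial_kernel_bounded[OF deg(1) deg' \<rho>(2)]
  have sym: "?k (inv\<^bsub>B\<^esub> w) = ?k w" if "w \<in> carrier B" for w
    using that by (simp add: carrier_B word_weight_inv)
  have invariant: "?k (b \<otimes>\<^bsub>B\<^esub> w) = ?k w" if b: "b \<in> factor False" and w: "w \<in> carrier B" for b w
  proof -
    have bw: "b \<otimes>\<^bsub>B\<^esub> w \<in> carrier B"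
      using w subgroup.mem_carrier[OF subgroup_factor b] by simp
    have "strip False (b \<otimes>\<^bsub>B\<^esub> w) = strip False w"
      using b w by (intro strip_factor_mult) (simp_all add: carrier_B)
    then show ?thesis
      using word_weight_strip[of "radial \<rho>" False w] word_weight_strip[of "radial \<rho>" False "b \<otimes>\<^bsub>B\<^esub> w"]
      by (simp add: radial_def)
  qed
  note two' = B.kernel_op_two_projections[OF subgroup_factor finite_factor subgroup_factor finite_factor
      ker(1) sym invariant radial_green_identity[OF _ \<rho>(1)]]
  have two: "PH (kernel_op B ?k f) = kernel_op B ?k f" "kernel_op B ?k (PH f) = kernel_op B ?k f"
      "PH (PG (kernel_op B ?k f))
         = (\<lambda>x. joukowski \<rho> * kernel_op B ?k f x + C * PH f x)"
      "kernel_op B ?k (PG (PH f))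
         = (\<lambda>x. joukowski \<rho> * kernel_op B ?k f x + C * PH f x)"
    if "f \<in> ell2 (carrier B)" for f
    unfolding C_def using that by - (rule two'; assumption)+
  define K where "K f x = (1 / C) * kernel_op B ?k f x" for f x
  have K: "ell2_bounded_op (carrier B) K"
    unfolding K_def[abs_def] by (intro bounded_op_cmult ker)
  note lin = bounded_op_scale[OF coset_average_bounded]
  note cl = bounded_op_in[OF coset_average_bounded] bounded_op_in[OF ker(2)] ell2_scale(1)
  show ?thesis
    unfolding averaging_op_def[abs_def]
  proof (rule two_projection_resolvent[OF coset_average_bounded coset_average_bounded K _ _ _ _ _ nz s])
    fix f assume f: "f \<in> ell2 (carrier B)"
    show "PG (PG f) = PG f"
      by (rule factor_average_idem)
    show "PH (K f) = K f"
      unfolding K_def by (simp only: lin cl f two(1))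
    show "K (PH f) = K f"
      unfolding K_def by (simp only: two(2)[OF f])
    show "PH (PG (K f)) = (\<lambda>x. joukowski \<rho> * K f x + PH f x)"
      unfolding K_def using C
      by (simp only: lin cl f two(3)) (simp add: fun_eq_iff distrib_left)
    show "K (PG (PH f)) = (\<lambda>x. joukowski \<rho> * K f x + PH f x)"
      unfolding K_def using C
      by (simp only: two(4)[OF f]) (simp add: fun_eq_iff distrib_left)
  qed
qed

section \<open>The spectrum of the weighted sum of the averages\<close>

lemma weight_fun_Nil: "weight_fun t [] \<noteq> 0"
  by (simp add: weight_fun_def carrier_B)

text \<open>
  For the eigenvalue \<open>0\<close>, the weight \<open>(- 1 / M, - 1 / N)\<close> sums to zero over every coset of either group; it is
  square-summable because \<open>M N > 1\<close>. For the eigenvalue \<open>\<alpha>\<close>, the weight \<open>(1, - 1 / N)\<close> is constant on the cosets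
  of \<open>G\<close> and sums to zero over those of \<open>H\<close>; it is square-summable because \<open>M < N\<close>.
\<close>

lemma averaging_op_eigenvalues:
  assumes deg: "0 < deg True" "deg True < deg False"
  shows "0 \<in> ell2_spectrum (carrier B) (averaging_op \<alpha> \<beta>)"
    and "\<alpha> \<in> ell2_spectrum (carrier B) (averaging_op \<alpha> \<beta>)"
proof -
  have nat: "1 \<le> deg True" "1 < deg False"
    using deg by auto
  have ev: "z \<in> ell2_spectrum (carrier B) (averaging_op \<alpha> \<beta>)"
    if "weight_fun t \<in> ell2 (carrier B)" "averaging_op \<alpha> \<beta> (weight_fun t) = (\<lambda>x. z * weight_fun t x)"
    for z t
    by (rule eigenvalue_in_spectrum[where f = "weight_fun t" and x = "[]"])
      (use that weight_fun_Nil bounded_op_in[OF averaging_op_bounded] in auto)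
  define t where "t c = - 1 / (of_nat (card (letters c)) :: complex)" for c
  have nz: "of_nat (card (letters c)) \<noteq> (0 :: complex)" for c
    using nat by (cases c) auto
  have kill: "1 + of_nat (card (letters c)) * t c = 0" for c
    using nz by (simp add: t_def)
  have t: "cmod (t c) = 1 / deg c" for c
    by (simp add: t_def norm_divide)
  have "deg True * (cmod (t True))\<^sup>2 * (deg False * (cmod (t False))\<^sup>2) = 1 / (deg True * deg False)"
    using nat by (simp add: t power2_eq_square)
  also have "\<dots> < 1"
    using mult_le_less_imp_less[of 1 "deg True" 1 "deg False"] nat by simp
  finally have "weight_fun t \<in> ell2 (carrier B)"
    by (rule weight_fun_in_ell2)
  then show "0 \<in> ell2_spectrum (carrier B) (averaging_op \<alpha> \<beta>)"
    by (rule ev)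
      (simp add: averaging_op_def fun_eq_iff coset_average_weight_zero[OF kill])
  define u where "u c = (if c then 1 else t False)" for c
  have "deg True * (cmod (u True))\<^sup>2 * (deg False * (cmod (u False))\<^sup>2) = deg True / deg False"
    using nat by (simp add: u_def t power2_eq_square)
  also have "\<dots> < 1"
    using deg by simp
  finally have "weight_fun u \<in> ell2 (carrier B)"
    by (rule weight_fun_in_ell2)
  then show "\<alpha> \<in> ell2_spectrum (carrier B) (averaging_op \<alpha> \<beta>)"
  proof (rule ev)
    have "PG (weight_fun u) = weight_fun u"
      by (rule coset_average_weight_invariant) (simp add: u_def)
    moreover have "PH (weight_fun u) = (\<lambda>w. 0)"
      using kill[of False] by (intro coset_average_weight_zero) (simp add: u_def)
    ultimately show "averaging_op \<alpha> \<beta> (weight_fun u) = (\<lambda>x. \<alpha> * weight_fun u x)"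
      by (simp add: averaging_op_def fun_eq_iff)
  qed
qed

text \<open>
  The radial function itself is the column of the kernel at the base vertex, so the Green identity applies
  to it directly.
\<close>

lemma radial_almost_eigenfunction:
  assumes \<rho>: "\<rho> \<noteq> 0"
  shows "PH (PG (weight_fun (radial \<rho>))) x
           = joukowski \<rho> * weight_fun (radial \<rho>) x + defect \<rho> * of_bool (x \<in> factor False)"
proof (cases "x \<in> carrier B")
  case x: True
  let ?k = "word_weight (radial \<rho>) :: ('a + 'b) list \<Rightarrow> complex"
  note mem = subgroup.mem_carrier[OF subgroup_factor]
  have "(\<Sum>b\<in>factor False. \<Sum>a\<in>factor True. weight_fun (radial \<rho>) (x \<otimes>\<^bsub>B\<^esub> b \<otimes>\<^bsub>B\<^esub> a))
      = (\<Sum>b\<in>factor False. \<Sum>a\<in>factor True. ?k (inv\<^bsub>B\<^esub> a \<otimes>\<^bsub>B\<^esub> (inv\<^bsub>B\<^esub> b \<otimes>\<^bsub>B\<^esub> inv\<^bsub>B\<^esub> x)))"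
  proof (intro sum.cong refl)
    fix a b assume "b \<in> factor False" "a \<in> factor True"
    then have ab: "a \<in> carrier B" "b \<in> carrier B"
      using mem by auto
    then have c: "x \<otimes>\<^bsub>B\<^esub> b \<otimes>\<^bsub>B\<^esub> a \<in> carrier B"
      using x by simp
    then have "?k (inv\<^bsub>B\<^esub> (x \<otimes>\<^bsub>B\<^esub> b \<otimes>\<^bsub>B\<^esub> a)) = ?k (x \<otimes>\<^bsub>B\<^esub> b \<otimes>\<^bsub>B\<^esub> a)"
      by (intro word_weight_inv) (simp only: carrier_B)
    with c show "weight_fun (radial \<rho>) (x \<otimes>\<^bsub>B\<^esub> b \<otimes>\<^bsub>B\<^esub> a)
        = ?k (inv\<^bsub>B\<^esub> a \<otimes>\<^bsub>B\<^esub> (inv\<^bsub>B\<^esub> b \<otimes>\<^bsub>B\<^esub> inv\<^bsub>B\<^esub> x))"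
      using x ab by (simp add: weight_fun_def B.inv_mult_group B.m_assoc)
  qed
  also have "\<dots> = (\<Sum>b\<in>factor False. \<Sum>a\<in>factor True. ?k (a \<otimes>\<^bsub>B\<^esub> (inv\<^bsub>B\<^esub> b \<otimes>\<^bsub>B\<^esub> inv\<^bsub>B\<^esub> x)))"
    by (intro sum.cong refl B.subgroup_sum_inv[OF subgroup_factor])
  also have "\<dots> = (\<Sum>b\<in>factor False. \<Sum>a\<in>factor True. ?k (a \<otimes>\<^bsub>B\<^esub> (b \<otimes>\<^bsub>B\<^esub> inv\<^bsub>B\<^esub> x)))"
    by (rule B.subgroup_sum_inv[OF subgroup_factor])
  also have "\<dots> = of_nat (card (factor True)) * of_nat (card (factor False)) *
       (joukowski \<rho> * ?k (inv\<^bsub>B\<^esub> x) + defect \<rho> * of_bool (inv\<^bsub>B\<^esub> x \<in> factor False))"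
    using x by (intro radial_green_identity \<rho>) simp
  also have "?k (inv\<^bsub>B\<^esub> x) = weight_fun (radial \<rho>) x"
    using x by (simp add: weight_fun_def carrier_B word_weight_inv)
  also have "inv\<^bsub>B\<^esub> x \<in> factor False \<longleftrightarrow> x \<in> factor False"
    using x subgroup.m_inv_closed[OF subgroup_factor[of False], of x]
      subgroup.m_inv_closed[OF subgroup_factor[of False], of "inv\<^bsub>B\<^esub> x"] by auto
  finally have total: "(\<Sum>b\<in>factor False. \<Sum>a\<in>factor True. weight_fun (radial \<rho>) (x \<otimes>\<^bsub>B\<^esub> b \<otimes>\<^bsub>B\<^esub> a))
      = of_nat (card (factor True)) * of_nat (card (factor False)) *
       (joukowski \<rho> * weight_fun (radial \<rho>) x + defect \<rho> * of_bool (x \<in> factor False))" .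
  have inner: "(\<Sum>b\<in>factor False. PG (weight_fun (radial \<rho>)) (x \<otimes>\<^bsub>B\<^esub> b))
      = (\<Sum>b\<in>factor False. \<Sum>a\<in>factor True. weight_fun (radial \<rho>) (x \<otimes>\<^bsub>B\<^esub> b \<otimes>\<^bsub>B\<^esub> a))
          / of_nat (card (factor True))"
    using x mem by (subst sum_divide_distrib, intro sum.cong refl) (simp add: coset_average_def)
  have outer: "PH (PG (weight_fun (radial \<rho>))) x
      = (\<Sum>b\<in>factor False. PG (weight_fun (radial \<rho>)) (x \<otimes>\<^bsub>B\<^esub> b)) / of_nat (card (factor False))"
    using x by (simp add: coset_average_def[of _ _ "PG _"])
  have "of_nat (card (factor True)) \<noteq> (0 :: complex)" "of_nat (card (factor False)) \<noteq> (0 :: complex)"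
    using card_factor_neq_0[of True] card_factor_neq_0[of False] by (simp_all add: card_factor add.commute)
  then show ?thesis
    unfolding outer inner total by simp
next
  case False
  then have "x \<notin> factor False"
    using subgroup.mem_carrier[OF subgroup_factor] by blast
  with False show ?thesis
    by (simp add: coset_average_def weight_fun_def)
qed

end

text \<open>
  The two preimages of \<open>w\<close> are the roots of \<open>\<tau>\<^sup>2 - w \<tau> + 1\<close>; their product is \<open>1\<close>, so one of them lies in the closed
  unit disc.
\<close>

lemma joukowski_preimage:
  fixes w :: complex
  obtains \<tau> where "\<tau> \<noteq> 0" "cmod \<tau> \<le> 1" "\<tau> + 1 / \<tau> = w"
proof -
  define \<sigma> where "\<sigma> = (w + csqrt (w\<^sup>2 - 4)) / 2"
  have "2 * \<sigma> - w = csqrt (w\<^sup>2 - 4)"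
    by (simp add: \<sigma>_def field_simps)
  moreover have "4 * (\<sigma> * (w - \<sigma>)) = w\<^sup>2 - (2 * \<sigma> - w)\<^sup>2"
    by (simp add: power2_eq_square algebra_simps)
  ultimately have eq: "\<sigma> * (w - \<sigma>) = 1"
    by simp
  then have \<sigma>: "\<sigma> \<noteq> 0"
    by auto
  with eq have inv: "1 / \<sigma> = w - \<sigma>"
    by (simp add: field_simps)
  show thesis
  proof (cases "cmod \<sigma> \<le> 1")
    case True
    with \<sigma> inv show thesis by (intro that[of \<sigma>]) auto
  next
    case False
    then have "cmod (1 / \<sigma>) \<le> 1"
      by (auto simp: norm_divide divide_le_eq_1)
    moreover have "1 / \<sigma> + 1 / (1 / \<sigma>) = w"
    proof -
      have "1 / (1 / \<sigma>) = \<sigma>"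
        by simp
      then show ?thesis
        by (simp only:) (simp add: inv)
    qed
    ultimately show thesis
      using \<sigma> by (intro that[of "1 / \<sigma>"]) auto
  qed
qed

lemma unit_circle_inverse:
  assumes "cmod \<tau> = 1"
  shows "1 / \<tau> = cnj \<tau>"
proof -
  have "\<tau> * cnj \<tau> = 1"
    using complex_norm_square[of \<tau>] assms by simp
  moreover from this have "\<tau> \<noteq> 0"
    by auto
  ultimately show ?thesis
    by (simp add: nonzero_divide_eq_eq mult.commute)
qed

context finite_free_product
begin

text \<open>
  On the critical circle \<open>|\<rho>| = 1 / sqrt (M N)\<close> the radial function just fails to be square-summable. Approach it
  from inside by \<open>\<rho> t\<close> with \<open>t < 1\<close>: as \<open>t\<close> tends to \<open>1\<close>, the norms of the radial functions \<open>v t\<close> tend to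
  infinity, while \<open>Q P v - s v\<close> is \<open>joukowski (\<rho> t) - s\<close>, which tends to \<open>0\<close>, times \<open>v t\<close> plus a bounded multiple of
  a fixed function. A lower bound for \<open>Q P - s\<close> would therefore bound these norms.
\<close>

lemma averaging_op_band:
  assumes deg: "0 < deg True" "deg True < deg False" and \<tau>: "cmod \<tau> = 1"
    and nz: "\<alpha> \<noteq> 0" "\<beta> \<noteq> 0" "z \<noteq> 0" "z \<noteq> \<alpha>"
    and s: "\<alpha> * \<beta> * joukowski (of_real (1 / sqrt (deg True * deg False)) * \<tau>) = (z - \<alpha>) * (z - \<beta>)"
  shows "z \<in> ell2_spectrum (carrier B) (averaging_op \<alpha> \<beta>)"
proof (rule ccontr)
  assume z: "z \<notin> ell2_spectrum (carrier B) (averaging_op \<alpha> \<beta>)"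
  define q where "q = sqrt (deg True * deg False)"
  have q: "0 < q" "deg True * deg False = q * q"
    using deg by (simp_all add: q_def)
  define \<rho> where "\<rho> t = of_real (t / q) * \<tau>" for t
  define v where "v t = weight_fun (radial (\<rho> t))" for t
  define ind :: "('a + 'b) list \<Rightarrow> complex" where "ind x = of_bool (x \<in> factor False)" for x
  note s = s[folded q_def]
  obtain C where C: "0 \<le> C" "\<And>v. v \<in> ell2 (carrier B) \<Longrightarrow> PH v = v \<Longrightarrow>
      ell2_norm (carrier B) v \<le> C * ell2_norm (carrier B) (\<lambda>x. PH (PG v) x - joukowski (\<rho> 1) * v x)"
    using two_projection_lower_bound[OF coset_average_bounded[of True] coset_average_bounded[of False]
        factor_average_idem nz _ z[unfolded averaging_op_def[abs_def]], of "joukowski (\<rho> 1)"] s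
    by (auto simp: \<rho>_def)
  have \<rho>1: "\<rho> 1 \<noteq> 0"
    using q \<tau> by (auto simp: \<rho>_def)
  have ind: "ind \<in> ell2 (carrier B)"
  proof -
    have "(\<lambda>x. (cmod (ind x))\<^sup>2) summable_on carrier B \<longleftrightarrow> (\<lambda>x. 1 :: real) summable_on factor False"
      using subgroup.subset[OF subgroup_factor[of False]]
      by (intro summable_on_cong_neutral) (auto simp: ind_def)
    then show ?thesis
      using subgroup.mem_carrier[OF subgroup_factor[of False]] finite_factor
      by (auto simp: ell2_def ind_def)
  qed
  have lim_J: "((\<lambda>t. joukowski (\<rho> t)) \<longlongrightarrow> joukowski (\<rho> 1)) (at_left 1)"
    using \<rho>1 unfolding joukowski_def \<rho>_def
    by (intro tendsto_intros) (use q card_factor_neq_0 in auto)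
  have lim_d: "((\<lambda>t. defect (\<rho> t)) \<longlongrightarrow> defect (\<rho> 1)) (at_left 1)"
    using \<rho>1 unfolding defect_def \<rho>_def
    by (intro tendsto_intros) (use q card_factor_neq_0 in auto)
  \<comment> \<open>Close to \<open>t = 1\<close> the term with \<open>joukowski (\<rho> t) - joukowski (\<rho> 1)\<close> costs at most half of the norm of \<open>v t\<close>.
      Moving it to the other side doubles the constant in the bound \<open>E\<close>.\<close>
  define E where "E = 4 * C * (cmod (defect (\<rho> 1)) + 1) * ell2_norm (carrier B) ind"
  have "\<forall>\<^sub>F t in at_left 1. 2 * C * cmod (joukowski (\<rho> t) - joukowski (\<rho> 1)) < 1 / 2"
  proof (rule order_tendstoD)
    have "((\<lambda>t. 2 * C * cmod (joukowski (\<rho> t) - joukowski (\<rho> 1))) \<longlongrightarrow>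
        2 * C * cmod (joukowski (\<rho> 1) - joukowski (\<rho> 1))) (at_left 1)"
      by (intro tendsto_intros lim_J)
    then show "((\<lambda>t. 2 * C * cmod (joukowski (\<rho> t) - joukowski (\<rho> 1))) \<longlongrightarrow> 0) (at_left 1)"
      by simp
  qed simp
  moreover have "\<forall>\<^sub>F t in at_left 1. cmod (defect (\<rho> t)) < cmod (defect (\<rho> 1)) + 1"
    by (rule order_tendstoD[OF tendsto_norm[OF lim_d]]) simp
  moreover have "\<forall>\<^sub>F t in at_left (1 :: real). t \<in> {0<..<1}"
    by (rule eventually_at_leftI[of 0]) auto
  ultimately have ev: "\<forall>\<^sub>F t in at_left 1. (\<Sum>i\<le>n. (t\<^sup>2) ^ i) \<le> E\<^sup>2" for n
  proof eventually_elim
    case (elim t)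
    have t: "0 < t" "t < 1"
      using elim(3) by auto
    have \<rho>t: "\<rho> t \<noteq> 0" "cmod (\<rho> t) = t / q"
      using t q \<tau> by (auto simp: \<rho>_def norm_mult norm_divide)
    have "deg True * (cmod (radial (\<rho> t) True))\<^sup>2 * (deg False * (cmod (radial (\<rho> t) False))\<^sup>2)
        = (deg True * deg False) * (t / q)\<^sup>2"
      using \<rho>t by (simp add: radial_def)
    also have "\<dots> = t\<^sup>2"
      using q(1) unfolding q(2) by (simp add: power2_eq_square)
    finally have r: "deg True * (cmod (radial (\<rho> t) True))\<^sup>2 * (deg False * (cmod (radial (\<rho> t) False))\<^sup>2) = t\<^sup>2" .
    have "t\<^sup>2 < 1"
      using t by (simp add: power_less_one_iff abs_square_less_1)
    then have v: "v t \<in> ell2 (carrier B)"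
      unfolding v_def by (intro weight_fun_in_ell2) (simp only: r)
    have inv: "PH (v t) = v t"
      unfolding v_def by (rule coset_average_weight_invariant) (simp add: radial_def)
    let ?n = "ell2_norm (carrier B)"
    have "(\<lambda>x. PH (PG (v t)) x - joukowski (\<rho> 1) * v t x)
        = (\<lambda>x. (joukowski (\<rho> t) - joukowski (\<rho> 1)) * v t x + defect (\<rho> t) * ind x)"
      unfolding v_def ind_def by (simp add: radial_almost_eigenfunction[OF \<rho>t(1)] algebra_simps)
    then have "?n (v t) \<le> C * ?n (\<lambda>x. (joukowski (\<rho> t) - joukowski (\<rho> 1)) * v t x + defect (\<rho> t) * ind x)"
      using C(2)[OF v inv] by simp
    also have "\<dots> \<le> C * (2 * (?n (\<lambda>x. (joukowski (\<rho> t) - joukowski (\<rho> 1)) * v t x)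
        + ?n (\<lambda>x. defect (\<rho> t) * ind x)))"
      by (intro mult_left_mono ell2_add ell2_scale v ind C)
    also have "\<dots> = (2 * C * cmod (joukowski (\<rho> t) - joukowski (\<rho> 1))) * ?n (v t)
        + (2 * C * ?n ind) * cmod (defect (\<rho> t))"
      by (simp only: ell2_scale(2)[OF v] ell2_scale(2)[OF ind]) (simp add: algebra_simps)
    also have "\<dots> \<le> (1 / 2) * ?n (v t) + (2 * C * ?n ind) * (cmod (defect (\<rho> 1)) + 1)"
      using elim(1,2) C(1) by (intro add_mono mult_right_mono mult_left_mono) auto
    finally have "?n (v t) \<le> 2 * ((2 * C * ?n ind) * (cmod (defect (\<rho> 1)) + 1))"
      by simp
    also have "\<dots> = E"
      by (simp add: E_def)
    finally have "?n (v t) \<le> E" .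
    then have "(?n (v t))\<^sup>2 \<le> E\<^sup>2"
      by (intro power_mono) auto
    moreover have "(\<Sum>i\<le>n. (t\<^sup>2) ^ i) \<le> (?n (v t))\<^sup>2"
      using weight_fun_norm_ge[of "radial (\<rho> t)" n] v unfolding r v_def by simp
    ultimately show ?case
      by linarith
  qed
  have "real n \<le> E\<^sup>2" for n
  proof -
    have "((\<lambda>t. \<Sum>i\<le>n. (t\<^sup>2) ^ i) \<longlongrightarrow> (\<Sum>i\<le>n. ((1 :: real)\<^sup>2) ^ i)) (at_left 1)"
      by (intro tendsto_intros)
    then have "(\<Sum>i\<le>n. ((1 :: real)\<^sup>2) ^ i) \<le> E\<^sup>2"
      using ev[of n] by (rule tendsto_upperbound) simp
    then show ?thesis
      by simp
  qed
  moreover obtain n where "E\<^sup>2 < real n"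
    using reals_Archimedean2 by blast
  ultimately show False
    by (meson leD)
qed

text \<open>
  Every \<open>z\<close> outside \<open>{0, \<alpha>}\<close> belongs to some \<open>\<tau>\<close> with \<open>0 < |\<tau>| \<le> 1\<close>. For \<open>|\<tau>| < 1\<close> the resolvent exists; for
  \<open>|\<tau>| = 1\<close> it does not, and then \<open>\<tau> + 1 / \<tau>\<close> is twice the real part of \<open>\<tau>\<close>.
\<close>

lemma averaging_op_spectrum:
  fixes \<alpha> \<beta> :: real
  assumes deg: "0 < deg True" "deg True < deg False" and pos: "0 < \<alpha>" "0 < \<beta>"
  shows "z \<in> ell2_spectrum (carrier B) (averaging_op (of_real \<alpha>) (of_real \<beta>)) \<longleftrightarrow>
    z = 0 \<or> z = of_real \<alpha> \<or> (\<exists>x\<in>{-1..1}. (z - of_real \<alpha>) * (z - of_real \<beta>)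
      = of_real (\<alpha> * \<beta> * (deg True + deg False + 2 * sqrt (deg True * deg False) * x)
          / ((deg True + 1) * (deg False + 1))))"
    (is "?spec \<longleftrightarrow> _ \<or> _ \<or> ?band")
proof -
  define q where "q = sqrt (deg True * deg False)"
  have q: "0 < q" "deg True * deg False = q * q"
    using deg by (simp_all add: q_def)
  define D where "D = (deg True + 1) * (deg False + 1)"
  have D: "0 < D"
    unfolding D_def by (intro mult_pos_pos) auto
  have \<alpha>\<beta>: "complex_of_real \<alpha> \<noteq> 0" "complex_of_real \<beta> \<noteq> 0"
    using pos by auto
  have J: "joukowski (of_real (1 / q) * \<tau>)
      = (of_real (deg True + deg False) + of_real q * (\<tau> + 1 / \<tau>)) / of_real D" if "\<tau> \<noteq> 0" for \<tau>
  proof -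
    have "M * N = of_real q * of_real q"
      using arg_cong[OF q(2), of complex_of_real] by simp
    moreover have "of_real q \<noteq> (0 :: complex)"
      using q by simp
    ultimately have "M * N * (of_real (1 / q) * \<tau>) = of_real q * \<tau>"
        "1 / (of_real (1 / q) * \<tau>) = of_real q * (1 / \<tau>)"
      by (simp_all add: field_simps)
    then show ?thesis
      unfolding joukowski_def D_def by (simp only:) (simp add: algebra_simps)
  qed
  show ?thesis
  proof (intro iffI)
    assume spec: ?spec
    show "z = 0 \<or> z = of_real \<alpha> \<or> ?band"
    proof (cases "z = 0 \<or> z = of_real \<alpha>")
      case False
      define w where "w = ((z - of_real \<alpha>) * (z - of_real \<beta>) * of_real D / (of_real \<alpha> * of_real \<beta>)
        - of_real (deg True + deg False)) / of_real q"
      obtain \<tau> where \<tau>: "\<tau> \<noteq> 0" "cmod \<tau> \<le> 1" "\<tau> + 1 / \<tau> = w"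
        by (rule joukowski_preimage)
      have s: "of_real \<alpha> * of_real \<beta> * joukowski (of_real (1 / q) * \<tau>) = (z - of_real \<alpha>) * (z - of_real \<beta>)"
        unfolding J[OF \<tau>(1)] \<tau>(3) w_def using q D \<alpha>\<beta> by simp
      have "cmod \<tau> = 1"
      proof (rule ccontr)
        assume "cmod \<tau> \<noteq> 1"
        with \<tau>(2) have "cmod (of_real (1 / q) * \<tau>) * q < 1"
          using q by (simp add: norm_mult norm_divide)
        moreover have "of_real (1 / q) * \<tau> \<noteq> 0"
          using q \<tau> by simp
        ultimately have "\<not> ?spec"
          using False \<alpha>\<beta> s unfolding q_def by (intro averaging_op_resolvent[OF deg]) auto
        with spec show False by simp
      qed
      then have w: "w = of_real (2 * Re \<tau>)"
        using \<tau>(3) by (simp add: unit_circle_inverse complex_add_cnj)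
      have "(z - of_real \<alpha>) * (z - of_real \<beta>)
          = of_real (\<alpha> * \<beta> * (deg True + deg False + 2 * q * Re \<tau>) / D)"
        unfolding s[symmetric] J[OF \<tau>(1)] \<tau>(3) w by (simp add: algebra_simps)
      moreover have "Re \<tau> \<in> {-1..1}"
        using abs_Re_le_cmod[of \<tau>] \<tau>(2) by auto
      ultimately show ?thesis
        unfolding q_def D_def by blast
    qed blast
  next
    assume "z = 0 \<or> z = of_real \<alpha> \<or> ?band"
    moreover have ?spec if "z \<noteq> 0" "z \<noteq> of_real \<alpha>" and band: ?band
    proof -
      obtain x where x: "-1 \<le> x" "x \<le> 1" and eq: "(z - of_real \<alpha>) * (z - of_real \<beta>)
          = of_real (\<alpha> * \<beta> * (deg True + deg False + 2 * q * x) / D)"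
        using band by (auto simp: q_def D_def)
      define \<tau> where "\<tau> = Complex x (sqrt (1 - x\<^sup>2))"
      have "x\<^sup>2 \<le> 1"
        using x by (simp add: abs_square_le_1 abs_le_iff)
      then have \<tau>: "cmod \<tau> = 1"
        by (simp add: \<tau>_def cmod_def)
      then have "\<tau> \<noteq> 0" by auto
      have sum: "\<tau> + 1 / \<tau> = of_real (2 * x)"
        using \<tau> by (simp add: unit_circle_inverse complex_add_cnj) (simp add: \<tau>_def)
      have s: "of_real \<alpha> * of_real \<beta> * joukowski (of_real (1 / q) * \<tau>) = (z - of_real \<alpha>) * (z - of_real \<beta>)"
        unfolding J[OF \<open>\<tau> \<noteq> 0\<close>] sum eq by (simp add: algebra_simps)
      show ?spec
        using s that(1,2) \<alpha>\<beta> unfolding q_def by (intro averaging_op_band[OF deg \<tau>]) auto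
    qed
    ultimately show ?spec
      using averaging_op_eigenvalues[OF deg] by blast
  qed
qed

section \<open>The normalized Laplacian\<close>

lemma fp_laplacian_eq_averaging_op:
  fixes \<omega>\<^sub>1 \<omega>\<^sub>2 :: real
  assumes pos: "0 < \<omega>\<^sub>1" "0 < \<omega>\<^sub>2" "0 < deg True" "0 < deg False" and f: "f \<in> ell2 (carrier B)"
  defines "\<kappa> \<equiv> deg True * \<omega>\<^sub>1 + deg False * \<omega>\<^sub>2"
    and "\<alpha> \<equiv> (deg True + 1) * \<omega>\<^sub>1" and "\<beta> \<equiv> (deg False + 1) * \<omega>\<^sub>2"
  shows "fp_laplacian G H \<omega>\<^sub>1 \<omega>\<^sub>2 f x
    = of_real ((\<alpha> + \<beta>) / \<kappa>) * f x - of_real (1 / \<kappa>) * averaging_op (of_real \<alpha>) (of_real \<beta>) f x"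
proof (cases "x \<in> carrier B")
  case x: True
  have \<kappa>: "0 < \<kappa>"
    unfolding \<kappa>_def using pos by (intro add_pos_pos mult_pos_pos)
  have "0 < order G" "0 < order H"
    using G.order_gt_0_iff_finite H.order_gt_0_iff_finite finite_G finite_H by auto
  then have ord: "real (order G) - 1 = deg True" "real (order H) - 1 = deg False"
    by (auto simp: card_letters)
  have one: "x \<otimes>\<^bsub>B\<^esub> [] = x"
    using x B.r_one unfolding one_B by simp
  have avg: "of_nat (card (letters c) + 1) * coset_average B (factor c) f x
      = f x + (\<Sum>s\<in>letters c. f (x \<otimes>\<^bsub>B\<^esub> [s]))" for c
    using x card_factor_neq_0[of c] by (simp add: coset_average_def card_factor sum_factor one add.commute)
  have sumG: "(\<Sum>s\<in>letters True. f (x \<otimes>\<^bsub>B\<^esub> [s])) = (\<Sum>a\<in>carrier G - {\<one>\<^bsub>G\<^esub>}. f (x \<otimes>\<^bsub>B\<^esub> fp_inl G a))"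
    by (simp add: letters_def sum.reindex inj_on_def fp_inl_def)
  have sumH: "(\<Sum>s\<in>letters False. f (x \<otimes>\<^bsub>B\<^esub> [s])) = (\<Sum>b\<in>carrier H - {\<one>\<^bsub>H\<^esub>}. f (x \<otimes>\<^bsub>B\<^esub> fp_inr H b))"
    by (simp add: letters_def sum.reindex inj_on_def fp_inr_def)
  have T: "averaging_op (of_real \<alpha>) (of_real \<beta>) f x
      = of_real \<omega>\<^sub>1 * (f x + (\<Sum>s\<in>letters True. f (x \<otimes>\<^bsub>B\<^esub> [s])))
        + of_real \<omega>\<^sub>2 * (f x + (\<Sum>s\<in>letters False. f (x \<otimes>\<^bsub>B\<^esub> [s])))"
    unfolding avg[symmetric] by (simp add: averaging_op_def \<alpha>_def \<beta>_def algebra_simps)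
  have lap: "fp_laplacian G H \<omega>\<^sub>1 \<omega>\<^sub>2 f x = f x - 1 / of_real \<kappa> *
      (of_real \<omega>\<^sub>1 * (\<Sum>s\<in>letters True. f (x \<otimes>\<^bsub>B\<^esub> [s])) + of_real \<omega>\<^sub>2 * (\<Sum>s\<in>letters False. f (x \<otimes>\<^bsub>B\<^esub> [s])))"
    unfolding fp_laplacian_def Let_def ord sumG sumH using x
    by (simp add: \<kappa>_def sum_distrib_left)
  have "\<alpha> + \<beta> = \<kappa> + \<omega>\<^sub>1 + \<omega>\<^sub>2"
    by (simp add: \<alpha>_def \<beta>_def \<kappa>_def algebra_simps)
  then show ?thesis
    unfolding T lap using \<kappa> by (simp add: field_simps)
next
  case False
  then show ?thesis
    by (simp add: fp_laplacian_def averaging_op_def coset_average_def ell2_outside[OF f])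
qed

end

theorem corollary1p2:
  fixes G :: "('a, 'c) monoid_scheme" and H :: "('b, 'd) monoid_scheme"
    and M N :: nat and \<omega>\<^sub>1 \<omega>\<^sub>2 \<kappa> c lam\<^sub>1 lam\<^sub>2 :: real and R :: "real \<Rightarrow> real"
    and I\<^sub>1 I\<^sub>2 :: "real set"
  assumes "group G" and "group H"
    and "finite (carrier G)" and "finite (carrier H)"
    and "order G = M + 1" and "order H = N + 1"
    and "2 \<le> order G" and "order G < order H"
    and "\<omega>\<^sub>1 > 0" and "\<omega>\<^sub>2 > 0"
  defines "\<kappa> \<equiv> real M * \<omega>\<^sub>1 + real N * \<omega>\<^sub>2"
    and "c \<equiv> ((real M + 1) * \<omega>\<^sub>1 + (real N + 1) * \<omega>\<^sub>2) / (2 * \<kappa>)"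
    and "R \<equiv> \<lambda>x. sqrt (((real M + 1) * \<omega>\<^sub>1 - (real N + 1) * \<omega>\<^sub>2)\<^sup>2
                 + 4 * (real M + real N) * \<omega>\<^sub>1 * \<omega>\<^sub>2
                 + 8 * sqrt (real M * real N) * \<omega>\<^sub>1 * \<omega>\<^sub>2 * cos x)"
    and "lam\<^sub>1 \<equiv> (real N + 1) * \<omega>\<^sub>2 / \<kappa>"
    and "lam\<^sub>2 \<equiv> 1 + (\<omega>\<^sub>1 + \<omega>\<^sub>2) / \<kappa>"
    and "I\<^sub>1 \<equiv> {c - R 0 / (2 * \<kappa>) .. c - R pi / (2 * \<kappa>)}"
    and "I\<^sub>2 \<equiv> {c + R pi / (2 * \<kappa>) .. c + R 0 / (2 * \<kappa>)}"
  shows "ell2_spectrum (carrier (free_product G H)) (fp_laplacian G H \<omega>\<^sub>1 \<omega>\<^sub>2)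
           = complex_of_real ` (I\<^sub>1 \<union> {lam\<^sub>1} \<union> I\<^sub>2 \<union> {lam\<^sub>2}) \<and>
         closed (I\<^sub>1 \<union> {lam\<^sub>1} \<union> I\<^sub>2 \<union> {lam\<^sub>2}) \<and>
         I\<^sub>1 \<inter> {lam\<^sub>1} = {} \<and>
         (I\<^sub>1 \<union> {lam\<^sub>1}) \<inter> I\<^sub>2 = {} \<and>
         (I\<^sub>1 \<union> {lam\<^sub>1} \<union> I\<^sub>2) \<inter> {lam\<^sub>2} = {}"
proof -
  interpret fp: finite_free_product G H
    using assms(1-4) by (simp add: finite_free_product_def finite_free_product_axioms_def)
  have MN: "1 \<le> M" "M < N"
    using assms(5-8) by auto
  have deg: "fp.deg True = real M" "fp.deg False = real N"
    using assms(5,6) by (simp_all add: fp.card_letters)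
  note pos = \<open>\<omega>\<^sub>1 > 0\<close> \<open>\<omega>\<^sub>2 > 0\<close>
  define \<alpha> where "\<alpha> = (real M + 1) * \<omega>\<^sub>1"
  define \<beta> where "\<beta> = (real N + 1) * \<omega>\<^sub>2"
  define q where "q = sqrt (real M * real N)"
  define r where "r x = (\<alpha> - \<beta>)\<^sup>2 + 4 * (real M + real N) * \<omega>\<^sub>1 * \<omega>\<^sub>2 + 8 * q * \<omega>\<^sub>1 * \<omega>\<^sub>2 * x" for x
  have \<alpha>\<beta>: "0 < \<alpha>" "0 < \<beta>"
    using pos by (simp_all add: \<alpha>_def \<beta>_def)
  have q0: "0 < q" and qq: "q * q = real M * real N"
    using MN by (simp_all add: q_def)
  have \<kappa>: "0 < \<kappa>"
    unfolding \<kappa>_def using pos MN by (intro add_pos_pos mult_pos_pos) auto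
  have \<kappa>_eq: "\<alpha> + \<beta> = \<kappa> + \<omega>\<^sub>1 + \<omega>\<^sub>2"
    by (simp add: \<alpha>_def \<beta>_def \<kappa>_def algebra_simps)
  have c: "c = (\<alpha> + \<beta>) / (2 * \<kappa>)"
    by (simp add: c_def \<alpha>_def \<beta>_def)
  have lam1: "lam\<^sub>1 = \<beta> / \<kappa>"
    by (simp add: lam\<^sub>1_def \<beta>_def)
  have lam2: "lam\<^sub>2 = (\<alpha> + \<beta>) / \<kappa>"
    unfolding \<kappa>_eq lam\<^sub>2_def using \<kappa> by (simp add: field_simps)
  have R0: "R 0 = sqrt (r 1)" and Rpi: "R pi = sqrt (r (-1))"
    by (simp_all add: R_def r_def \<alpha>_def \<beta>_def q_def)
  have slope: "0 < 8 * q * \<omega>\<^sub>1 * \<omega>\<^sub>2"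
    using q0 pos by simp
  have r_mono: "r x \<le> r y \<longleftrightarrow> x \<le> y" for x y
    unfolding r_def add_le_cancel_left by (rule mult_le_cancel_left_pos[OF slope])
  \<comment> \<open>The difference is \<open>4 \<omega>\<^sub>1 \<omega>\<^sub>2 (sqrt M - sqrt N)\<^sup>2\<close>; since \<open>M \<noteq> N\<close>, the point \<open>lam\<^sub>1\<close> stays strictly inside the gap.\<close>
  have gap_low: "(\<alpha> - \<beta>)\<^sup>2 < r (-1)"
  proof -
    have "sqrt (real M) \<noteq> sqrt (real N)"
      using MN by simp
    then have "0 < 4 * (sqrt (real M) - sqrt (real N))\<^sup>2 * (\<omega>\<^sub>1 * \<omega>\<^sub>2)"
      using pos by simp
    also have "\<dots> = r (-1) - (\<alpha> - \<beta>)\<^sup>2"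
      by (simp add: r_def q_def power2_diff real_sqrt_mult algebra_simps)
    finally show ?thesis by simp
  qed
  \<comment> \<open>The difference is \<open>4 \<omega>\<^sub>1 \<omega>\<^sub>2 (sqrt (M N) - 1)\<^sup>2\<close>, and \<open>M N > 1\<close>.\<close>
  have gap_high: "r 1 < (\<alpha> + \<beta>)\<^sup>2"
  proof -
    have "1 * 1 < real M * real N"
      using MN by (intro mult_le_less_imp_less) auto
    then have "q \<noteq> 1"
      using qq by auto
    then have "0 < 4 * (q - 1)\<^sup>2 * (\<omega>\<^sub>1 * \<omega>\<^sub>2)"
      using pos by simp
    also have "\<dots> = (\<alpha> + \<beta>)\<^sup>2 - r 1"
    proof -
      have "(\<alpha> + \<beta>)\<^sup>2 - (\<alpha> - \<beta>)\<^sup>2 = 4 * (real M * real N + real M + real N + 1) * (\<omega>\<^sub>1 * \<omega>\<^sub>2)"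
        by (simp add: \<alpha>_def \<beta>_def power2_eq_square algebra_simps)
      then show ?thesis
        unfolding qq[symmetric] by (simp add: r_def power2_eq_square algebra_simps)
    qed
    finally show ?thesis by simp
  qed
  have Rpi_gt: "\<bar>\<alpha> - \<beta>\<bar> < R pi"
    unfolding Rpi using gap_low by (intro real_less_rsqrt) simp
  have R0_lt: "R 0 < \<alpha> + \<beta>"
    unfolding R0 using gap_high \<alpha>\<beta> by (intro real_sqrt_less_mono[THEN order_less_le_trans]) auto

  \<comment> \<open>In the coordinate \<open>2 \<kappa> (t - c)\<close> the bands are \<open>\<plusminus>[R pi, R 0]\<close>, and \<open>lam\<^sub>1\<close>, \<open>lam\<^sub>2\<close> are \<open>\<beta> - \<alpha>\<close> and \<open>\<alpha> + \<beta>\<close>.\<close>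
  have in_I1: "t \<in> I\<^sub>1 \<longleftrightarrow> R pi \<le> - (2 * \<kappa> * (t - c)) \<and> - (2 * \<kappa> * (t - c)) \<le> R 0" for t
    using \<kappa> by (auto simp: I\<^sub>1_def field_simps)
  have in_I2: "t \<in> I\<^sub>2 \<longleftrightarrow> R pi \<le> 2 * \<kappa> * (t - c) \<and> 2 * \<kappa> * (t - c) \<le> R 0" for t
    using \<kappa> by (auto simp: I\<^sub>2_def field_simps)
  have in_bands: "t \<in> I\<^sub>1 \<union> I\<^sub>2 \<longleftrightarrow> R pi \<le> \<bar>2 * \<kappa> * (t - c)\<bar> \<and> \<bar>2 * \<kappa> * (t - c)\<bar> \<le> R 0" for t
    using Rpi_gt by (auto simp: in_I1 in_I2)
  have at_lam1: "2 * \<kappa> * (lam\<^sub>1 - c) = \<beta> - \<alpha>" and at_lam2: "2 * \<kappa> * (lam\<^sub>2 - c) = \<alpha> + \<beta>"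
    using \<kappa> by (simp_all add: lam1 lam2 c field_simps)

  define T where "T = fp.averaging_op (of_real \<alpha>) (of_real \<beta>)"
  let ?X = "carrier (free_product G H)" and ?L = "fp_laplacian G H \<omega>\<^sub>1 \<omega>\<^sub>2"
  have L: "?L f x = of_real ((\<alpha> + \<beta>) / \<kappa>) * f x - of_real (1 / \<kappa>) * T f x" if "f \<in> ell2 ?X" for f x
    using fp.fp_laplacian_eq_averaging_op[OF pos _ _ that, of x] MN
    unfolding deg T_def \<alpha>_def \<beta>_def \<kappa>_def by simp
  have T_bounded: "ell2_bounded_op ?X T"
    unfolding T_def by (rule fp.averaging_op_bounded)
  have L_bounded: "ell2_bounded_op ?X ?L"
  proof (rule bounded_op_cong)
    show "ell2_bounded_op ?X (\<lambda>f x. of_real ((\<alpha> + \<beta>) / \<kappa>) * f x - of_real (1 / \<kappa>) * T f x)"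
      by (intro bounded_op_minus bounded_op_cmult bounded_op_id T_bounded)
    show "?L f = (\<lambda>x. of_real ((\<alpha> + \<beta>) / \<kappa>) * f x - of_real (1 / \<kappa>) * T f x)" if "f \<in> ell2 ?X" for f
      using L[OF that] by (rule ext)
  qed
  have spec: "\<zeta> \<in> ell2_spectrum ?X ?L \<longleftrightarrow> \<zeta> \<in> complex_of_real ` (I\<^sub>1 \<union> {lam\<^sub>1} \<union> I\<^sub>2 \<union> {lam\<^sub>2})" for \<zeta>
  proof -
    define z where "z = of_real (\<alpha> + \<beta>) - of_real \<kappa> * \<zeta>"
    have \<zeta>: "\<zeta> = of_real ((\<alpha> + \<beta>) / \<kappa>) - of_real (1 / \<kappa>) * z"
      using \<kappa> by (simp add: z_def field_simps)
    have "\<zeta> \<in> ell2_spectrum ?X ?L \<longleftrightarrow> z \<in> ell2_spectrum ?X T"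
      unfolding \<zeta> using \<kappa> by (intro affine_spectrum[OF T_bounded _ L L_bounded]) auto
    also have "\<dots> \<longleftrightarrow> z = 0 \<or> z = of_real \<alpha> \<or> (\<exists>x\<in>{-1..1}. (z - of_real \<alpha>) * (z - of_real \<beta>)
        = of_real (\<alpha> * \<beta> * (real M + real N + 2 * q * x) / ((real M + 1) * (real N + 1))))"
      unfolding T_def using fp.averaging_op_spectrum[OF _ _ \<alpha>\<beta>, of z] MN
      unfolding deg q_def by simp
    also have "z = 0 \<longleftrightarrow> \<zeta> = of_real lam\<^sub>2"
      using \<kappa> by (auto simp: z_def lam2 field_simps)
    also have "z = of_real \<alpha> \<longleftrightarrow> \<zeta> = of_real lam\<^sub>1"
      using \<kappa> by (auto simp: z_def lam1 field_simps)
    \<comment> \<open>Completing the square: \<open>(2 z - \<alpha> - \<beta>)\<^sup>2 = (\<alpha> - \<beta>)\<^sup>2 + 4 (z - \<alpha>) (z - \<beta>)\<close>.\<close>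
    also have "(\<exists>x\<in>{-1..1}. (z - of_real \<alpha>) * (z - of_real \<beta>)
        = of_real (\<alpha> * \<beta> * (real M + real N + 2 * q * x) / ((real M + 1) * (real N + 1))))
        \<longleftrightarrow> (\<exists>x\<in>{-1..1}. (of_real (2 * \<kappa>) * (\<zeta> - of_real c))\<^sup>2 = of_real (r x))"
    proof (intro bex_cong refl)
      fix x
      have 1: "\<alpha> * \<beta> * (real M + real N + 2 * q * x) / ((real M + 1) * (real N + 1))
          = \<omega>\<^sub>1 * \<omega>\<^sub>2 * (real M + real N + 2 * q * x)"
        by (simp add: \<alpha>_def \<beta>_def)
      have 2: "complex_of_real (r x) = (of_real (\<alpha> - \<beta>))\<^sup>2
          + 4 * of_real (\<omega>\<^sub>1 * \<omega>\<^sub>2 * (real M + real N + 2 * q * x))"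
        by (simp add: r_def algebra_simps)
      have 3: "of_real (2 * \<kappa>) * (\<zeta> - of_real c) = of_real (\<alpha> + \<beta>) - 2 * z"
        using \<kappa> by (simp add: z_def c field_simps)
      have 4: "(of_real (\<alpha> + \<beta>) - 2 * z)\<^sup>2
          = (of_real (\<alpha> - \<beta>))\<^sup>2 + 4 * ((z - of_real \<alpha>) * (z - of_real \<beta>))"
        by (simp add: power2_eq_square algebra_simps)
      show "(z - of_real \<alpha>) * (z - of_real \<beta>)
          = of_real (\<alpha> * \<beta> * (real M + real N + 2 * q * x) / ((real M + 1) * (real N + 1)))
          \<longleftrightarrow> (of_real (2 * \<kappa>) * (\<zeta> - of_real c))\<^sup>2 = of_real (r x)"
        unfolding 1 2 3 4 by simp
    qed
    also have "\<dots> \<longleftrightarrow> \<zeta> \<in> complex_of_real ` (I\<^sub>1 \<union> I\<^sub>2)"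
    proof
      assume "\<exists>x\<in>{-1..1}. (of_real (2 * \<kappa>) * (\<zeta> - of_real c))\<^sup>2 = of_real (r x)"
      then obtain x where x: "-1 \<le> x" "x \<le> 1" and eq: "(of_real (2 * \<kappa>) * (\<zeta> - of_real c))\<^sup>2 = of_real (r x)"
        by auto
      have rx: "r (-1) \<le> r x" "r x \<le> r 1"
        using x by (simp_all add: r_mono)
      have "0 \<le> r x"
        using rx(1) gap_low zero_le_power2[of "\<alpha> - \<beta>"] by linarith
      then have "(of_real (2 * \<kappa>) * (\<zeta> - of_real c))\<^sup>2 = (of_real (sqrt (r x)))\<^sup>2"
        unfolding eq by (simp flip: of_real_power)
      then obtain y where y: "of_real (2 * \<kappa>) * (\<zeta> - of_real c) = of_real y" "\<bar>y\<bar> = sqrt (r x)"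
        using \<open>0 \<le> r x\<close> unfolding power2_eq_iff
        by (elim disjE) (auto intro: that[of "sqrt (r x)"] that[of "- sqrt (r x)"])
      define t where "t = c + y / (2 * \<kappa>)"
      have "\<zeta> = of_real t"
        using y(1) \<kappa> by (simp add: t_def field_simps)
      moreover have "2 * \<kappa> * (t - c) = y"
        using \<kappa> by (simp add: t_def)
      then have "t \<in> I\<^sub>1 \<union> I\<^sub>2"
        unfolding in_bands y R0 Rpi using rx y(2) by simp
      ultimately show "\<zeta> \<in> complex_of_real ` (I\<^sub>1 \<union> I\<^sub>2)"
        by blast
    next
      assume "\<zeta> \<in> complex_of_real ` (I\<^sub>1 \<union> I\<^sub>2)"
      then obtain t where t: "\<zeta> = of_real t" "t \<in> I\<^sub>1 \<union> I\<^sub>2"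
        by blast
      define y where "y = 2 * \<kappa> * (t - c)"
      have y: "sqrt (r (-1)) \<le> \<bar>y\<bar>" "\<bar>y\<bar> \<le> sqrt (r 1)"
        using t(2) unfolding in_bands y_def R0 Rpi by auto
      define x where "x = (y\<^sup>2 - r 0) / (8 * q * \<omega>\<^sub>1 * \<omega>\<^sub>2)"
      have rx: "r x = y\<^sup>2"
      proof -
        have "r x = r 0 + (8 * q * \<omega>\<^sub>1 * \<omega>\<^sub>2) * x"
          by (simp add: r_def)
        also have "(8 * q * \<omega>\<^sub>1 * \<omega>\<^sub>2) * x = y\<^sup>2 - r 0"
          unfolding x_def using slope by (metis less_irrefl nonzero_mult_div_cancel_left times_divide_eq_right)
        finally show ?thesis by simp
      qed
      have "r (-1) \<le> y\<^sup>2" "y\<^sup>2 \<le> r 1"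
        using y unfolding real_sqrt_abs[symmetric] real_sqrt_le_iff by auto
      then have "x \<in> {-1..1}"
        unfolding rx[symmetric] by (simp add: r_mono)
      moreover have "(of_real (2 * \<kappa>) * (\<zeta> - of_real c))\<^sup>2 = complex_of_real (r x)"
        unfolding rx t(1) y_def by simp
      ultimately show "\<exists>x\<in>{-1..1}. (of_real (2 * \<kappa>) * (\<zeta> - of_real c))\<^sup>2 = complex_of_real (r x)"
        by blast
    qed
    finally show ?thesis
      by auto
  qed

  have "lam\<^sub>1 \<notin> I\<^sub>1" "lam\<^sub>1 \<notin> I\<^sub>2" "lam\<^sub>2 \<notin> I\<^sub>1" "lam\<^sub>2 \<notin> I\<^sub>2"
    using Rpi_gt R0_lt \<alpha>\<beta> unfolding in_I1 in_I2 at_lam1 at_lam2 by linarith+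
  moreover have "lam\<^sub>1 \<noteq> lam\<^sub>2"
    using at_lam1 at_lam2 \<alpha>\<beta> by auto
  moreover have "I\<^sub>1 \<inter> I\<^sub>2 = {}"
    using Rpi_gt by (auto simp: in_I1 in_I2)
  moreover have "closed (I\<^sub>1 \<union> {lam\<^sub>1} \<union> I\<^sub>2 \<union> {lam\<^sub>2})"
    unfolding I\<^sub>1_def I\<^sub>2_def by (intro closed_Un closed_atLeastAtMost closed_singleton)
  ultimately show ?thesis
    using spec by blast
qed

end
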